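(* Let $N$ be a torsion-free finitely generated nilpotent group with a finite generating subset $S$. There exist natural numbers $k_1,k_2,k_3$ and a constant $C\in\mathbb{N}$ such that for every $\varphi\in\mathrm{Aut}(N)$, every $x\in N$ and every $n\in\mathbb{N}$, $$\mathrm{Conj}^{\varphi}_{N,x,S}(n)\le C\,(\|\varphi\|_S)^{k_1}\,(\max\{1,\|x\|_S\})^{k_2}\,(Cn)^{k_3}.$$ In particular, $\mathrm{Conj}^\varphi_{N,S}(n)\preceq(\|\varphi\|_S)^{k_1}n^{k_2+k_3}$ (with implied constant independent of $\varphi$) and $\mathrm{Tconj}_{N,S}(n)\preceq n^{k_1+k_2+k_3}$.
   Context: For a group $G$ with finite generating set $S$, $\|g\|_S$ is word length, and for $\varphi\in\mathrm{Aut}(G)$, $\|\varphi\|_S=\max_{s\in S}\|\varphi(s)\|_S$. Elements $x,y\in G$ are $\varphi$-twisted conjugate if $z\,x\,\varphi(z)^{-1}=y$ for some $z\in G$; $[x]_\varphi$ denotes the $\varphi$-twisted conjugacy class of $x$. For $X\subseteq G$ and $y\in G\setminus X$, $D_G(X,y)$ is the minimal order $|Q|$ of a finite group $Q$ with a surjective homomorphism $\pi:G\to Q$ such that $\pi(y)\notin\pi(X)$ ($\infty$ if none). Define $\mathrm{Conj}^\varphi_{G,x,S}(n)=\max\{D_G([x]_\varphi,y):\|y\|_S\le n,\ y\notin[x]_\varphi\}$ (max of empty set $=0$), $\mathrm{Conj}^\varphi_{G,S}(n)=\max\{\mathrm{Conj}^\varphi_{G,x,S}(n):\|x\|_S\le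 n\}$, and $\mathrm{Tconj}_{G,S}(n)=\max\{\mathrm{Conj}^\varphi_{G,S}(n):\varphi\in\mathrm{Aut}(G),\ \|\varphi\|_S\le n\}$. For $f,g:\mathbb{N}\to\mathbb{N}$, $f\preceq g$ means there is $C\in\mathbb{N}$ with $f(n)\le C\,g(Cn)$ for all $n$. *)

theory Defs
  imports "HOL-Algebra.Algebra" "HOL-Library.Extended_Nat"
begin

fun lower_central :: "('a, 'b) monoid_scheme \<Rightarrow> nat \<Rightarrow> 'a set" where
  "lower_central G 0 = carrier G"
| "lower_central G (Suc i) =
     generate G {g \<otimes>\<^bsub>G\<^esub> h \<otimes>\<^bsub>G\<^esub> inv\<^bsub>G\<^esub> g \<otimes>\<^bsub>G\<^esub> inv\<^bsub>G\<^esub> h | g h.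
                   g \<in> carrier G \<and> h \<in> lower_central G i}"

definition nilpotent_group :: "('a, 'b) monoid_scheme \<Rightarrow> bool" where
  "nilpotent_group G \<longleftrightarrow> group G \<and> (\<exists>c. lower_central G c = {\<one>\<^bsub>G\<^esub>})"

definition torsion_free :: "('a, 'b) monoid_scheme \<Rightarrow> bool" where
  "torsion_free G \<longleftrightarrow>
     (\<forall>g \<in> carrier G. \<forall>m::nat. m > 0 \<longrightarrow> g [^]\<^bsub>G\<^esub> m = \<one>\<^bsub>G\<^esub> \<longrightarrow> g = \<one>\<^bsub>G\<^esub>)"

definition word_length :: "('a, 'b) monoid_scheme \<Rightarrow> 'a set \<Rightarrow> 'a \<Rightarrow> nat" where
  "word_length G S g =
     (LEAST m. \<exists>ws. length ws = m \<and> set ws \<subseteq> S \<union> (\<lambda>s. inv\<^bsub>G\<^esub> s) ` S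
                  \<and> foldr (\<otimes>\<^bsub>G\<^esub>) ws \<one>\<^bsub>G\<^esub> = g)"

definition aut_norm :: "('a, 'b) monoid_scheme \<Rightarrow> 'a set \<Rightarrow> ('a \<Rightarrow> 'a) \<Rightarrow> nat" where
  "aut_norm G S \<phi> = Max (insert 0 ((\<lambda>s. word_length G S (\<phi> s)) ` S))"

definition twisted_class :: "('a, 'b) monoid_scheme \<Rightarrow> ('a \<Rightarrow> 'a) \<Rightarrow> 'a \<Rightarrow> 'a set" where
  "twisted_class G \<phi> x =
     {z \<otimes>\<^bsub>G\<^esub> x \<otimes>\<^bsub>G\<^esub> inv\<^bsub>G\<^esub> (\<phi> z) | z. z \<in> carrier G}"

text \<open>D_G(X,y): minimal order of a finite quotient separating y from X (\<infinity> if none).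
  Finite groups Q are represented with carrier a set of naturals; every finite group is
  isomorphic to such a group, so this is the minimum over all finite groups.\<close>
definition sep_depth :: "('a, 'b) monoid_scheme \<Rightarrow> 'a set \<Rightarrow> 'a \<Rightarrow> enat" where
  "sep_depth G B y =
     Inf ((\<lambda>H. enat (card (carrier H))) `
        {H :: nat monoid. group H \<and> finite (carrier H) \<and>
           (\<exists>f. f \<in> hom G H \<and> f ` carrier G = carrier H \<and> f y \<notin> f ` B)})"

definition conj_x :: "('a, 'b) monoid_scheme \<Rightarrow> 'a set \<Rightarrow> ('a \<Rightarrow> 'a) \<Rightarrow> 'a \<Rightarrow> nat \<Rightarrow> enat" where
  "conj_x G S \<phi> x n =
     Sup ((\<lambda>y. sep_depth G (twisted_class G \<phi> x) y) `
        {y \<in> carrier G. word_length G S y \<le> n \<and> y \<notin> twisted_class G \<phi> x})"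

definition conj_phi :: "('a, 'b) monoid_scheme \<Rightarrow> 'a set \<Rightarrow> ('a \<Rightarrow> 'a) \<Rightarrow> nat \<Rightarrow> enat" where
  "conj_phi G S \<phi> n = Sup ((\<lambda>x. conj_x G S \<phi> x n) ` {x \<in> carrier G. word_length G S x \<le> n})"

definition tconj :: "('a, 'b) monoid_scheme \<Rightarrow> 'a set \<Rightarrow> nat \<Rightarrow> enat" where
  "tconj G S n = Sup ((\<lambda>\<phi>. conj_phi G S \<phi> n) ` {\<phi>. \<phi> \<in> iso G G \<and> aut_norm G S \<phi> \<le> n})"

end

theory Submission
  imports Defs "HOL-Computational_Algebra.Formal_Power_Series"
begin

text \<open>
  Replacing \<open>\<phi>\<close> by \<open>\<psi> = x \<phi> x\<^sup>-\<^sup>1\<close> and \<open>y\<close> by \<open>w = y x\<^sup>-\<^sup>1\<close>, one has to separate \<open>w\<close> from the set of all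
  \<open>z \<psi>(z)\<^sup>-\<^sup>1\<close>. The quotients used are \<open>G / G\<^sup>m\<close>, of order at most \<open>m\<^sup>r\<close> with \<open>r\<close> the length of a central
  series with cyclic factors.

  A function on \<open>G\<close> is polynomial if all its iterated differences of some order vanish. Such an
  integer-valued function grows polynomially in the word length, and modulo \<open>m\<close> it is
  invariant under \<open>G\<close> to the power \<open>m e!\<close>. Polynomial functions separate the points of \<open>G\<close>: a coordinate
  on an infinite cyclic factor of the central series extends step by step to \<open>G\<close>. Finitely many of them,
  closed under differences on both sides, define normal subgroups \<open>K j\<close> decreasing to \<open>1\<close> and homomorphisms
  \<open>delta j\<close> from \<open>K j\<close> to the integers with kernel \<open>K (j + 1)\<close>.

  Let \<open>H j\<close> be the subgroup of all \<open>z\<close> with \<open>z \<psi>(z)\<^sup>-\<^sup>1\<close> in \<open>K j\<close>. Then \<open>z \<mapsto> delta j (z \<psi>(z)\<^sup>-\<^sup>1)\<close> is a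
  homomorphism on \<open>H j\<close> with kernel \<open>H (j + 1)\<close>, so \<open>H j\<close> has, inductively, a bounded number of generators of
  polynomially bounded length. Pushing \<open>w\<close> down the filtration within its twisted class stops at some
  \<open>j\<close> where \<open>delta j\<close> of the element reached is not in the image of \<open>H j\<close>, and this
  survives modulo \<open>G\<^sup>m\<close> because elements satisfying the equation modulo a multiple of \<open>m\<close> are
  close to elements of \<open>H j\<close>.
\<close>

section \<open>Groups and word length\<close>

text \<open>A coordinate on an infinite factor is a homomorphism on \<open>L i\<close>, but often no
  homomorphism of the whole group extends it: the central coordinate of the Heisenberg group is only
  quadratic. Hence polynomial functions. Two obstacles shape their extension. Conjugation may change
  a function by one of the same degree, so degrees are weighted by depth in the series. A factor may
  be finite, and then the new generator is only a root of an old element; translation by a root is a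
  binomial series in a difference operator, which brings in rational values whose denominators are
  cleared later.

  All bounds must be uniform in \<open>\<phi>\<close>: functions, filtration and exponents are fixed
  before \<open>\<psi>\<close>, and only the subgroups \<open>H j\<close> and their pivots, elements
  on which the map to the integers generates its image, depend on it. Pivots come from Bezout
  coefficients at a cost exponential in the number of generators, so this number has to be
  controlled together with their lengths. Nilpotency enters a second time here: iterated commutators
  with the pivot die out, which leaves a finite explicit generating set for the kernel.\<close>

context group
begin

lemma inv_cancel_left: "\<lbrakk>x \<in> carrier G; y \<in> carrier G\<rbrakk> \<Longrightarrow> inv x \<otimes> (x \<otimes> y) = y"
  by (simp add: m_assoc [symmetric])

lemma cancel_inv_left: "\<lbrakk>x \<in> carrier G; y \<in> carrier G\<rbrakk> \<Longrightarrow> x \<otimes> (inv x \<otimes> y) = y"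
  by (simp add: m_assoc [symmetric])

lemmas group_word_simps = m_assoc inv_mult_group inv_cancel_left cancel_inv_left

definition commutator :: "'a \<Rightarrow> 'a \<Rightarrow> 'a"
  where "commutator g h = g \<otimes> h \<otimes> inv g \<otimes> inv h"

lemma commutator_closed [simp]:
  "\<lbrakk>g \<in> carrier G; h \<in> carrier G\<rbrakk> \<Longrightarrow> commutator g h \<in> carrier G"
  by (simp add: commutator_def)

lemma normal_conj:
  assumes "K \<lhd> G" "g \<in> carrier G" "k \<in> K"
  shows "g \<otimes> k \<otimes> inv g \<in> K"
  using assms by (simp add: normal.inv_op_closed2)

lemma normal_conj_inv:
  assumes "K \<lhd> G" "g \<in> carrier G" "k \<in> K"
  shows "inv g \<otimes> k \<otimes> g \<in> K"
  using assms by (simp add: normal.inv_op_closed1)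

lemma normal_subgroup: "K \<lhd> G \<Longrightarrow> subgroup K G"
  by (rule normal_imp_subgroup)

lemma normalI_conj:
  assumes "subgroup K G" "\<And>g k. \<lbrakk>g \<in> carrier G; k \<in> K\<rbrakk> \<Longrightarrow> g \<otimes> k \<otimes> inv g \<in> K"
  shows "K \<lhd> G"
  using assms by (auto simp: normal_inv_iff)

lemma subgroup_int_pow:
  assumes "subgroup H G" "h \<in> H"
  shows "h [^] (k::int) \<in> H"
proof -
  have "h \<in> carrier G" using assms subgroup.mem_carrier by metis
  have n: "h [^] (n::nat) \<in> H" for n
    using assms by (induction n) (auto intro: subgroup.m_closed subgroup.one_closed)
  show ?thesis
    using n \<open>h \<in> carrier G\<close> subgroup.m_inv_closed [OF assms(1)]
    by (cases k rule: int_cases2) (simp_all add: int_pow_int int_pow_neg)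
qed

section \<open>Subgroups generated by \<open>m\<close>-th powers\<close>

definition power_subgroup :: "nat \<Rightarrow> 'a set"
  where "power_subgroup m = generate G {g [^] m | g. g \<in> carrier G}"

lemma power_subgroup_subgroup: "subgroup (power_subgroup m) G"
  unfolding power_subgroup_def by (rule generate_is_subgroup) auto

lemma pow_in_power_subgroup: "g \<in> carrier G \<Longrightarrow> g [^] m \<in> power_subgroup m"
  unfolding power_subgroup_def by (rule generate.incl) auto

lemma int_pow_in_power_subgroup:
  assumes "g \<in> carrier G" "int m dvd k"
  shows "g [^] k \<in> power_subgroup m"
proof -
  obtain q where q: "k = q * int m" using assms(2) by (auto simp: dvd_def mult.commute)
  have "g [^] k = (g [^] q) [^] m"
    using assms(1) unfolding q by (simp add: int_pow_pow int_pow_int [symmetric])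
  then show ?thesis using assms(1) by (simp add: pow_in_power_subgroup)
qed

text \<open>Homomorphisms send \<open>m\<close>-th powers to \<open>m\<close>-th powers. For inner
  automorphisms this gives normality; for \<open>\<psi>\<close> it lets twisting descend to the
  quotient.\<close>

lemma power_subgroup_hom:
  assumes "h \<in> hom G G" "g \<in> power_subgroup m"
  shows "h g \<in> power_subgroup m"
  using assms(2) unfolding power_subgroup_def
proof (induction rule: generate.induct)
  interpret h: group_hom G G h using assms(1) by unfold_locales
  note P = generate_is_subgroup [of "{g [^] m | g. g \<in> carrier G}"]
  have car: "generate G {g [^] m | g. g \<in> carrier G} \<subseteq> carrier G"
    by (rule generate_incl) auto
  { case one then show ?case by (simp add: generate.one)
  next
    case (incl x) then show ?case
      by (auto simp: h.hom_nat_pow intro!: generate.incl)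
  next
    case (inv x)
    then obtain g where g: "x = g [^] m" "g \<in> carrier G" by auto
    then have "h x \<in> {g [^] m | g. g \<in> carrier G}" by (auto simp: h.hom_nat_pow)
    then show ?case using g by (simp add: generate.inv)
  next
    case (eng x y)
    then have "x \<in> carrier G" "y \<in> carrier G" using car by auto
    then show ?case using eng by (simp add: generate.eng)
  }
qed

lemma power_subgroup_normal: "power_subgroup m \<lhd> G"
proof (rule normalI_conj [OF power_subgroup_subgroup])
  fix g k assume g: "g \<in> carrier G" and k: "k \<in> power_subgroup m"
  have "(\<lambda>x. g \<otimes> x \<otimes> inv g) \<in> hom G G"
    using g by (auto simp: hom_def group_word_simps)
  from power_subgroup_hom [OF this k] show "g \<otimes> k \<otimes> inv g \<in> power_subgroup m" .
qed

lemma power_subgroup_mono: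
  assumes "m dvd n" shows "power_subgroup n \<subseteq> power_subgroup m"
proof -
  have "{g [^] n | g. g \<in> carrier G} \<subseteq> power_subgroup m"
  proof clarify
    fix g assume g: "g \<in> carrier G"
    have "g [^] (int n) \<in> power_subgroup m"
      using int_pow_in_power_subgroup [OF g, of m "int n"] assms by simp
    then show "g [^] n \<in> power_subgroup m" by (simp add: int_pow_int)
  qed
  then show ?thesis
    using generate_subgroup_incl power_subgroup_subgroup unfolding power_subgroup_def by blast
qed

end

section \<open>Word length for a finite generating set\<close>

locale fg_group = group G for G (structure) +
  fixes S :: "'a set"
  assumes finite_S: "finite S" and S_sub: "S \<subseteq> carrier G" and gen_S: "generate G S = carrier G"
begin

abbreviation wl :: "'a \<Rightarrow> nat" where "wl \<equiv> word_length G S"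

definition letters :: "'a set" where "letters = S \<union> m_inv G ` S"

abbreviation wprod :: "'a list \<Rightarrow> 'a" where "wprod ws \<equiv> foldr (\<otimes>) ws \<one>"

lemma finite_letters: "finite letters"
  using finite_S by (simp add: letters_def)

lemma letters_closed: "s \<in> letters \<Longrightarrow> s \<in> carrier G"
  using S_sub by (auto simp: letters_def)

lemma letters_inv: "s \<in> letters \<Longrightarrow> inv s \<in> letters"
  using S_sub by (auto simp: letters_def)

lemma wprod_closed: "set ws \<subseteq> letters \<Longrightarrow> wprod ws \<in> carrier G"
  by (induction ws) (auto intro: letters_closed)

lemma wprod_append:
  "\<lbrakk>set us \<subseteq> letters; set vs \<subseteq> letters\<rbrakk> \<Longrightarrow> wprod (us @ vs) = wprod us \<otimes> wprod vs"
  by (induction us) (auto simp: wprod_closed letters_closed m_assoc)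

lemma wprod_exists: 
  assumes "g \<in> carrier G"
  shows "\<exists>ws. set ws \<subseteq> letters \<and> wprod ws = g"
proof -
  have "g \<in> generate G S" using assms gen_S by simp
  then show ?thesis
  proof (induction rule: generate.induct)
    case one show ?case by (rule exI [of _ "[]"]) simp
  next
    case (incl h) then show ?case
      by (intro exI [of _ "[h]"]) (use S_sub in \<open>auto simp: letters_def\<close>)
  next
    case (inv h) then show ?case
      by (intro exI [of _ "[inv h]"]) (use S_sub in \<open>auto simp: letters_def\<close>)
  next
    case (eng x y)
    then obtain us vs where "set us \<subseteq> letters" "wprod us = x" "set vs \<subseteq> letters" "wprod vs = y"
      by blast
    then show ?case
      using wprod_append [of us vs] by (intro exI [of _ "us @ vs"]) (simp del: foldr_append)
  qed
qed

lemma wl_word: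
  assumes "g \<in> carrier G"
  shows "\<exists>ws. set ws \<subseteq> letters \<and> wprod ws = g \<and> length ws = wl g"
proof -
  obtain ws where ws: "set ws \<subseteq> letters" "wprod ws = g" using wprod_exists assms by blast
  have "\<exists>us. length us = wl g \<and> set us \<subseteq> S \<union> (\<lambda>s. inv s) ` S \<and> foldr (\<otimes>) us \<one> = g"
    unfolding word_length_def
    by (rule LeastI_ex) (use ws in \<open>auto simp: letters_def\<close>)
  then show ?thesis by (auto simp: letters_def)
qed

lemma wl_wprod: "set ws \<subseteq> letters \<Longrightarrow> wl (wprod ws) \<le> length ws"
  unfolding word_length_def letters_def by (rule Least_le) blast

lemma wl_one [simp]: "wl \<one> = 0"
  using wl_wprod [of "[]"] by simp

lemma wl_letter: "s \<in> letters \<Longrightarrow> wl s \<le> 1"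
  using wl_wprod [of "[s]"] letters_closed by simp

lemma wl_mult:
  assumes "g \<in> carrier G" "h \<in> carrier G"
  shows "wl (g \<otimes> h) \<le> wl g + wl h"
proof -
  obtain us vs where "set us \<subseteq> letters" "wprod us = g" "length us = wl g"
    "set vs \<subseteq> letters" "wprod vs = h" "length vs = wl h"
    using wl_word assms by metis
  then show ?thesis using wl_wprod [of "us @ vs"] wprod_append [of us vs]
    by (simp del: foldr_append)
qed

lemma wl_hom_wprod:
  assumes "h \<in> hom G G" "\<And>s. s \<in> letters \<Longrightarrow> wl (h s) \<le> A" "set ws \<subseteq> letters"
  shows "wl (h (wprod ws)) \<le> A * length ws"
  using assms(3)
proof (induction ws)
  case Nil
  interpret h: group_hom G G h using assms(1) by unfold_locales
  show ?case by simp
next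
  case (Cons s ws)
  interpret h: group_hom G G h using assms(1) by unfold_locales
  have "h (wprod (s # ws)) = h s \<otimes> h (wprod ws)"
    using Cons by (simp add: letters_closed wprod_closed)
  moreover have "wl (h s) \<le> A" using Cons assms(2) by simp
  moreover have "wl (h s \<otimes> h (wprod ws)) \<le> wl (h s) + wl (h (wprod ws))"
    using Cons by (intro wl_mult) (simp_all add: letters_closed wprod_closed)
  ultimately show ?case using Cons by simp
qed

lemma wl_inv_le:
  assumes "g \<in> carrier G"
  shows "wl (inv g) \<le> wl g"
proof -
  have "set ws \<subseteq> letters \<Longrightarrow> wl (inv (wprod ws)) \<le> length ws" for ws
  proof (induction ws)
    case (Cons s ws)
    have "inv (wprod (s # ws)) = inv (wprod ws) \<otimes> inv s"
      using Cons by (simp add: letters_closed wprod_closed inv_mult_group)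
    moreover have "wl (inv s) \<le> 1" using Cons by (intro wl_letter letters_inv) auto
    moreover have "wl (inv (wprod ws) \<otimes> inv s) \<le> wl (inv (wprod ws)) + wl (inv s)"
      using Cons by (intro wl_mult) (simp_all add: letters_closed wprod_closed)
    ultimately show ?case using Cons by simp
  qed simp
  then show ?thesis using wl_word [OF assms] by metis
qed

lemma wl_inv: 
  assumes "g \<in> carrier G" shows "wl (inv g) = wl g"
  using wl_inv_le [OF assms] wl_inv_le [of "inv g"] assms by simp

lemma wl_hom:
  assumes "h \<in> hom G G" "\<And>s. s \<in> S \<Longrightarrow> wl (h s) \<le> A" "g \<in> carrier G"
  shows "wl (h g) \<le> A * wl g"
proof -
  interpret h: group_hom G G h using assms(1) by unfold_locales
  have "wl (h s) \<le> A" if "s \<in> letters" for s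
    using that assms(2) S_sub by (auto simp: letters_def wl_inv subset_iff)
  then show ?thesis using wl_hom_wprod [OF assms(1)] wl_word [OF assms(3)] by metis
qed

lemma wl_nat_pow:
  assumes "g \<in> carrier G"
  shows "wl (g [^] (n::nat)) \<le> n * wl g"
proof (induction n)
  case (Suc n)
  have "wl (g [^] n \<otimes> g) \<le> wl (g [^] n) + wl g" using assms by (intro wl_mult) auto
  then show ?case using Suc by simp
qed simp

lemma wl_int_pow:
  assumes "g \<in> carrier G"
  shows "wl (g [^] (k::int)) \<le> nat \<bar>k\<bar> * wl g"
  using wl_nat_pow [OF assms] assms
  by (cases k rule: int_cases2) (simp_all add: int_pow_int int_pow_neg wl_inv)

lemma wl_zero: 
  assumes "g \<in> carrier G" "wl g = 0" shows "g = \<one>"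
  using wl_word [OF assms(1)] assms(2) by auto

lemma carrier_right_induct [consumes 1, case_names one step]:
  assumes "g \<in> carrier G" "P \<one>"
    "\<And>g s. \<lbrakk>g \<in> carrier G; s \<in> letters; P g\<rbrakk> \<Longrightarrow> P (g \<otimes> s)"
  shows "P g"
proof -
  have "set ws \<subseteq> letters \<Longrightarrow> P (wprod ws)" for ws
  proof (induction ws rule: rev_induct)
    case (snoc s ws)
    have "wprod (ws @ [s]) = wprod ws \<otimes> s"
      using snoc wprod_append [of ws "[s]"] by (simp add: letters_closed)
    then show ?case using snoc assms(3) by (simp add: wprod_closed)
  qed (use assms in simp)
  then show ?thesis using wprod_exists [OF assms(1)] by blast
qed

lemma carrier_left_induct [consumes 1, case_names one step]:
  assumes "g \<in> carrier G" "P \<one>"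
    "\<And>g s. \<lbrakk>g \<in> carrier G; s \<in> letters; P g\<rbrakk> \<Longrightarrow> P (s \<otimes> g)"
  shows "P g"
proof -
  have "set ws \<subseteq> letters \<Longrightarrow> P (wprod ws)" for ws
    by (induction ws) (use assms in \<open>auto simp: wprod_closed\<close>)
  then show ?thesis using wprod_exists [OF assms(1)] by blast
qed

end

section \<open>Central series with cyclic factors\<close>

locale central_series = group G for G (structure) +
  fixes L :: "nat \<Rightarrow> 'a set" and a :: "nat \<Rightarrow> 'a" and r :: nat
  assumes L_0: "L 0 = carrier G"
    and L_trivial: "r \<le> i \<Longrightarrow> L i = {\<one>}"
    and L_normal: "L i \<lhd> G"
    and a_in: "i < r \<Longrightarrow> a i \<in> L i"
    and L_antimono: "i \<le> j \<Longrightarrow> L j \<subseteq> L i"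
    and L_commutator: "\<lbrakk>g \<in> carrier G; h \<in> L i\<rbrakk> \<Longrightarrow> commutator g h \<in> L (Suc i)"
    and L_decomp: "\<lbrakk>i < r; x \<in> L i\<rbrakk> \<Longrightarrow> \<exists>k::int. \<exists>n\<in>L (Suc i). x = a i [^] k \<otimes> n"
begin

lemma L_subgroup: "subgroup (L i) G"
  using L_normal by (rule normal_subgroup)

lemma L_carrier: "x \<in> L i \<Longrightarrow> x \<in> carrier G"
  using L_subgroup subgroup.mem_carrier by metis

lemma a_carrier: "i < r \<Longrightarrow> a i \<in> carrier G"
  using a_in L_carrier by blast

text \<open>Modulo the \<open>m\<close>-th powers only exponents in \<open>{0..<m}\<close> matter.\<close>

lemma L_mod_power_subgroup:
  assumes "m > 0" "i \<le> r"
  shows "\<exists>R. finite R \<and> card R \<le> m ^ (r - i) \<and> R \<subseteq> carrier G \<and>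
    (\<forall>x\<in>L i. \<exists>y\<in>R. \<exists>p\<in>power_subgroup m. x = y \<otimes> p)"
  using assms(2)
proof (induction i rule: inc_induct)
  case base
  show ?case
    using subgroup.one_closed [OF power_subgroup_subgroup, of m]
    by (intro exI [of _ "{\<one>}"]) (auto simp: L_trivial intro!: bexI [of _ \<one>])
next
  case (step i)
  then obtain R where R: "finite R" "card R \<le> m ^ (r - Suc i)" "R \<subseteq> carrier G"
    "\<And>x. x \<in> L (Suc i) \<Longrightarrow> \<exists>y\<in>R. \<exists>p\<in>power_subgroup m. x = y \<otimes> p" by blast
  have ai: "a i \<in> carrier G" using a_carrier step by simp
  define R' where "R' = (\<lambda>(k::nat, y). a i [^] k \<otimes> y) ` ({..<m} \<times> R)"
  have "card R' \<le> card ({..<m} \<times> R)"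
    unfolding R'_def by (rule card_image_le) (use R in simp)
  also have "\<dots> \<le> m * m ^ (r - Suc i)" using R(2) by (simp add: card_cartesian_product)
  also have "\<dots> = m ^ (r - i)" using step by (simp flip: power_Suc add: Suc_diff_Suc)
  finally have "card R' \<le> m ^ (r - i)" .
  moreover have "\<exists>y\<in>R'. \<exists>p\<in>power_subgroup m. x = y \<otimes> p" if x: "x \<in> L i" for x
  proof -
    obtain k n where kn: "n \<in> L (Suc i)" "x = a i [^] (k::int) \<otimes> n"
      using L_decomp [OF step.hyps(2) x] by blast
    obtain y p where yp: "y \<in> R" "p \<in> power_subgroup m" "n = y \<otimes> p" using R(4) kn by blast
    have y: "y \<in> carrier G" using yp R by blast
    have p: "p \<in> carrier G" using yp power_subgroup_subgroup subgroup.mem_carrier by metis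
    define e where "e = nat (k mod int m)"
    have e: "e < m" "int e = k mod int m" using \<open>m > 0\<close> by (auto simp: e_def nat_less_iff)
    define u where "u = a i [^] (int m * (k div int m))"
    have u: "u \<in> power_subgroup m" unfolding u_def using ai
      by (rule int_pow_in_power_subgroup) simp
    have uc: "u \<in> carrier G" by (simp add: u_def ai)
    have "a i [^] k = a i [^] e \<otimes> u"
    proof -
      have "k = int e + int m * (k div int m)" unfolding e(2) by simp
      then have "a i [^] k = a i [^] (int e + int m * (k div int m))" by simp
      then show ?thesis unfolding u_def using ai by (simp add: int_pow_mult int_pow_int)
    qed
    then have "x = (a i [^] e \<otimes> y) \<otimes> ((inv y \<otimes> u \<otimes> y) \<otimes> p)"
      using ai y p uc unfolding kn(2) yp(3) by (simp add: group_word_simps)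
    moreover have "(inv y \<otimes> u \<otimes> y) \<otimes> p \<in> power_subgroup m"
      using normal_conj_inv [OF power_subgroup_normal y u] yp(2)
        subgroup.m_closed [OF power_subgroup_subgroup] by blast
    moreover have "a i [^] e \<otimes> y \<in> R'"
      unfolding R'_def using e yp by force
    ultimately show ?thesis by blast
  qed
  moreover have "R' \<subseteq> carrier G" "finite R'" using R ai by (auto simp: R'_def)
  ultimately show ?case by blast
qed

end

section \<open>Construction of the series from commutators of generators\<close>

context fg_group
begin

text \<open>The subgroups generated by the tails become the terms of the series. Centrality modulo a
  tail is tested on \<open>S\<close> only, so that finitely many commutators decide it;
  \<open>commutator_central_mod\<close> passes to the whole group.\<close>

fun central_list :: "'a list \<Rightarrow> bool" where
  "central_list [] = True"
| "central_list (x # xs) = (x \<in> carrier G \<and> central_list xs \<and>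
     (\<forall>s\<in>S. commutator s x \<in> generate G (set xs)))"

lemma central_list_closed: "central_list xs \<Longrightarrow> set xs \<subseteq> carrier G"
  by (induction xs) auto

text \<open>The elements commuting with \<open>x\<close> modulo \<open>K\<close> form the preimage
  of a centralizer in the quotient, hence a subgroup, and it contains the generators.\<close>

lemma commutator_central_mod:
  assumes K: "K \<lhd> G" and x: "x \<in> carrier G" and S: "\<And>s. s \<in> S \<Longrightarrow> commutator s x \<in> K"
    and g: "g \<in> carrier G"
  shows "commutator g x \<in> K"
proof -
  interpret K: subgroup K G using K by (rule normal_subgroup)
  have "g \<in> generate G S" using g gen_S by simp
  then have "g \<in> carrier G \<and> commutator g x \<in> K"
  proof (induction rule: generate.induct)
    case one show ?case using x by (simp add: commutator_def)
  next
    case (incl h) then show ?case using S S_sub by auto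
  next
    case (inv h)
    then have h: "h \<in> carrier G" using S_sub by auto
    have "commutator (inv h) x = inv h \<otimes> inv (commutator h x) \<otimes> h"
      using h x by (simp add: commutator_def group_word_simps)
    then show ?case using normal_conj_inv [OF K h] S inv h by simp
  next
    case (eng g h)
    have "commutator (g \<otimes> h) x = (g \<otimes> commutator h x \<otimes> inv g) \<otimes> commutator g x"
      using eng x by (simp add: commutator_def group_word_simps)
    then show ?case using normal_conj [OF K, of g "commutator h x"] eng by simp
  qed
  then show ?thesis by simp
qed

lemma central_list_step:
  assumes K: "generate G (set xs) \<lhd> G" and xs: "central_list (x # xs)"
    and g: "g \<in> carrier G" and h: "h \<in> generate G (set (x # xs))"
  shows "commutator g h \<in> generate G (set xs)"
proof -
  let ?K = "generate G (set xs)"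
  interpret K: subgroup ?K G using K by (rule normal_subgroup)
  have sub: "set (x # xs) \<subseteq> carrier G" using central_list_closed [OF xs] .
  have basic: "commutator g y \<in> ?K" if y: "y \<in> set (x # xs)" for y
  proof (cases "y = x")
    case True
    then show ?thesis using commutator_central_mod [OF K _ _ g, of x] xs by auto
  next
    case False
    then have y: "y \<in> ?K" using y by (simp add: generate.incl)
    have "commutator g y = (g \<otimes> y \<otimes> inv g) \<otimes> inv y" by (simp add: commutator_def)
    then show ?thesis using normal_conj [OF K g y] y by simp
  qed
  from h have "h \<in> carrier G \<and> commutator g h \<in> ?K"
  proof (induction rule: generate.induct)
    case one show ?case using g by (simp add: commutator_def)
  next
    case (incl h) then show ?case using basic sub by auto
  next
    case (inv h)
    then have h: "h \<in> carrier G" using sub by auto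
    have "commutator g (inv h) = inv h \<otimes> inv (commutator g h) \<otimes> h"
      using h g by (simp add: commutator_def group_word_simps)
    then show ?case using normal_conj_inv [OF K h] basic inv h by simp
  next
    case (eng h h')
    have "commutator g (h \<otimes> h') = commutator g h \<otimes> (h \<otimes> commutator g h' \<otimes> inv h)"
      using eng g by (simp add: commutator_def group_word_simps)
    then show ?case using normal_conj [OF K, of h "commutator g h'"] eng by simp
  qed
  then show ?thesis by simp
qed

lemma central_list_normal: "central_list xs \<Longrightarrow> generate G (set xs) \<lhd> G"
proof (induction xs)
  case Nil
  have "generate G {} = {\<one>}" by (rule generate_empty)
  then show ?case by (simp add: one_is_normal)
next
  case (Cons x xs)
  have sub: "set (x # xs) \<subseteq> carrier G" using central_list_closed [OF Cons.prems] .
  have H: "subgroup (generate G (set (x # xs))) G" using sub by (rule generate_is_subgroup)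
  have mono: "generate G (set xs) \<subseteq> generate G (set (x # xs))" by (rule mono_generate) auto
  show ?case
  proof (rule normalI_conj [OF H])
    fix g h assume g: "g \<in> carrier G" and h: "h \<in> generate G (set (x # xs))"
    have hc: "h \<in> carrier G" using h H subgroup.mem_carrier by metis
    have "commutator g h \<in> generate G (set (x # xs))"
      using central_list_step [OF _ Cons.prems g h] Cons mono by auto
    moreover have "g \<otimes> h \<otimes> inv g = commutator g h \<otimes> h"
      using g hc by (simp add: commutator_def group_word_simps)
    ultimately show "g \<otimes> h \<otimes> inv g \<in> generate G (set (x # xs))"
      using h subgroup.m_closed [OF H] by simp
  qed
qed

lemma generate_Cons_decomp:
  assumes K: "generate G (set xs) \<lhd> G" and x: "x \<in> carrier G"
    and h: "h \<in> generate G (set (x # xs))"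
  shows "\<exists>k::int. \<exists>n\<in>generate G (set xs). h = x [^] k \<otimes> n"
proof -
  let ?K = "generate G (set xs)"
  interpret K: subgroup ?K G using K by (rule normal_subgroup)
  from h show ?thesis
  proof (induction rule: generate.induct)
    case one show ?case by (intro exI [of _ 0] bexI [of _ \<one>]) auto
  next
    case (incl h)
    show ?case
    proof (cases "h = x")
      case True then show ?thesis using x by (intro exI [of _ 1] bexI [of _ \<one>]) auto
    next
      case False
      with incl have "h \<in> ?K" by (simp add: generate.incl)
      then show ?thesis by (intro exI [of _ 0] bexI [of _ h]) auto
    qed
  next
    case (inv h)
    show ?case
    proof (cases "h = x")
      case True then show ?thesis using x
        by (intro exI [of _ "-1"] bexI [of _ \<one>]) (auto simp: int_pow_neg)
    next
      case False
      with inv have "inv h \<in> ?K" by (simp add: generate.inv)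
      then show ?thesis by (intro exI [of _ 0] bexI [of _ "inv h"]) auto
    qed
  next
    case (eng h h')
    then obtain k n k' n' where *: "n \<in> ?K" "h = x [^] (k::int) \<otimes> n"
      "n' \<in> ?K" "h' = x [^] (k'::int) \<otimes> n'" by blast
    let ?c = "x [^] k'"
    have "h \<otimes> h' = x [^] (k + k') \<otimes> ((inv ?c \<otimes> n \<otimes> ?c) \<otimes> n')"
      using x * by (simp add: int_pow_mult group_word_simps)
    moreover have "(inv ?c \<otimes> n \<otimes> ?c) \<otimes> n' \<in> ?K"
      using normal_conj_inv [OF K, of ?c n] x * by simp
    ultimately show ?case by blast
  qed
qed

text \<open>Every commutator of a new element with \<open>S\<close> falls into the old subgroup at
  once, so the new elements may be listed in any order.\<close>

lemma central_list_append:
  assumes "central_list xs" "set ys \<subseteq> carrier G"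
    "\<And>s y. \<lbrakk>s \<in> S; y \<in> set ys\<rbrakk> \<Longrightarrow> commutator s y \<in> generate G (set xs)"
  shows "central_list (ys @ xs)"
  using assms(2,3)
proof (induction ys)
  case (Cons y ys)
  have "generate G (set xs) \<subseteq> generate G (set (ys @ xs))" by (rule mono_generate) auto
  with Cons show ?case by auto
qed (use assms(1) in simp)

primrec iterated_commutators :: "nat \<Rightarrow> 'a set" where
  "iterated_commutators 0 = S"
| "iterated_commutators (Suc i) = (\<lambda>(s, t). commutator s t) ` (S \<times> iterated_commutators i)"

lemma iterated_commutators_finite: "finite (iterated_commutators i)"
  by (induction i) (simp_all add: finite_S)

lemma iterated_commutators_closed: "iterated_commutators i \<subseteq> carrier G"
  by (induction i) (use S_sub in \<open>auto intro!: commutator_closed\<close>)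

lemma iterated_commutators_lower_central: "iterated_commutators i \<subseteq> lower_central G i"
proof (induction i)
  case (Suc i)
  show ?case
  proof
    fix x assume "x \<in> iterated_commutators (Suc i)"
    then obtain s t where "s \<in> S" "t \<in> iterated_commutators i" "x = commutator s t" by auto
    then show "x \<in> lower_central G (Suc i)"
      using Suc S_sub by (auto simp: commutator_def intro!: generate.incl)
  qed
qed (use S_sub in simp)

text \<open>The list grows from the bottom. At depth \<open>c\<close> the iterated commutators of
  generators are trivial; those of depth \<open>i\<close> may be put in front because bracketing
  them with \<open>S\<close> yields commutators of depth \<open>i + 1\<close>, which the list
  already generates. At depth \<open>0\<close> it generates \<open>S\<close>, hence the
  group.\<close>

theorem central_series_exists:
  assumes "nilpotent_group G"
  shows "\<exists>L a r. central_series G L a r"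
proof -
  obtain c where c: "lower_central G c = {\<one>}" using assms by (auto simp: nilpotent_group_def)
  have "\<exists>xs. central_list xs \<and> iterated_commutators i \<subseteq> generate G (set xs)" if "i \<le> c" for i
    using that
  proof (induction i rule: inc_induct)
    case base
    then show ?case
      using iterated_commutators_lower_central [of c] c
      by (intro exI [of _ "[]"]) (auto simp: generate_empty)
  next
    case (step i)
    then obtain xs where xs: "central_list xs" "iterated_commutators (Suc i) \<subseteq> generate G (set xs)"
      by blast
    obtain ts where ts: "set ts = iterated_commutators i"
      using iterated_commutators_finite finite_list by blast
    have "central_list (ts @ xs)"
      using xs ts iterated_commutators_closed by (intro central_list_append) auto
    moreover have "iterated_commutators i \<subseteq> generate G (set (ts @ xs))"
      by (auto simp: ts intro: generate.incl)
    ultimately show ?case by blast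
  qed
  from this [of 0] obtain xs where xs: "central_list xs" "S \<subseteq> generate G (set xs)" by auto
  define L where "L i = generate G (set (drop i xs))" for i
  have cl: "central_list (drop i xs)" for i
    using xs(1)
  proof (induction xs arbitrary: i)
    case (Cons x xs) then show ?case by (cases i) auto
  qed simp
  have normal: "L i \<lhd> G" for i unfolding L_def by (rule central_list_normal [OF cl])
  have "central_series G L (\<lambda>i. xs ! i) (length xs)"
  proof (intro central_series.intro central_series_axioms.intro group_axioms)
    have "generate G S \<subseteq> L 0"
      using generate_subgroup_incl [OF _ normal_subgroup [OF normal [of 0]]] xs(2)
      by (simp add: L_def)
    moreover have "L 0 \<subseteq> carrier G" using normal normal_subgroup subgroup.subset by blast
    ultimately show "L 0 = carrier G" using gen_S by simp
  next
    fix i assume "length xs \<le> i"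
    then show "L i = {\<one>}" by (simp add: L_def generate_empty)
  next
    fix i show "L i \<lhd> G" by (rule normal)
  next
    fix i assume "i < length xs"
    then have "xs ! i \<in> set (drop i xs)"
      by (metis Cons_nth_drop_Suc list.set_intros(1))
    then show "xs ! i \<in> L i" by (simp add: L_def generate.incl)
  next
    fix i j :: nat assume "i \<le> j"
    then show "L j \<subseteq> L i" unfolding L_def by (intro mono_generate set_drop_subset_set_drop) 
  next
    fix g h i assume gh: "g \<in> carrier G" "h \<in> L i"
    show "commutator g h \<in> L (Suc i)"
    proof (cases "i < length xs")
      case True
      then have d: "drop i xs = xs ! i # drop (Suc i) xs" by (simp add: Cons_nth_drop_Suc)
      show ?thesis
        using central_list_step [OF normal [of "Suc i", unfolded L_def] cl [of i, unfolded d] gh(1)] gh(2)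
        by (simp add: L_def d)
    next
      case False
      then have "h = \<one>" using gh by (simp add: L_def generate_empty)
      then show ?thesis using gh False by (simp add: commutator_def L_def generate.one)
    qed
  next
    fix i and x :: 'a assume i: "i < length xs" "x \<in> L i"
    then have d: "drop i xs = xs ! i # drop (Suc i) xs" by (simp add: Cons_nth_drop_Suc)
    have "xs ! i \<in> carrier G" using central_list_closed xs(1) i nth_mem by blast
    from generate_Cons_decomp [OF normal [of "Suc i", unfolded L_def] this] i(2)
    show "\<exists>k::int. \<exists>n\<in>L (Suc i). x = xs ! i [^] k \<otimes> n" by (simp add: L_def d)
  qed
  then show ?thesis by blast
qed

end

section \<open>Polynomial functions\<close>

context group
begin

definition rdiff :: "'a \<Rightarrow> ('a \<Rightarrow> 'c::ab_group_add) \<Rightarrow> 'a \<Rightarrow> 'c"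
  where "rdiff h f x = f (x \<otimes> h) - f x"

definition ldiff :: "'a \<Rightarrow> ('a \<Rightarrow> 'c::ab_group_add) \<Rightarrow> 'a \<Rightarrow> 'c"
  where "ldiff h f x = f (h \<otimes> x) - f x"

text \<open>The index is one more than the degree: on a subgroup, \<open>0\<close> is the zero
  function, \<open>1\<close> the constants, \<open>2\<close> the homomorphisms plus a
  constant.\<close>

primrec poly_fun :: "'a set \<Rightarrow> nat \<Rightarrow> ('a \<Rightarrow> 'c::ab_group_add) \<Rightarrow> bool" where
  "poly_fun N 0 f = (\<forall>x\<in>N. f x = 0)"
| "poly_fun N (Suc d) f = (\<forall>h\<in>N. poly_fun N d (rdiff h f))"

lemma poly_fun_cong:
  assumes "subgroup N G" "\<And>x. x \<in> N \<Longrightarrow> f x = g x"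
  shows "poly_fun N d f = poly_fun N d g"
  using assms(2)
proof (induction d arbitrary: f g)
  case (Suc d)
  have "poly_fun N d (rdiff h f) = poly_fun N d (rdiff h g)" if "h \<in> N" for h
    using that Suc.prems subgroup.m_closed [OF assms(1)]
    by (intro Suc.IH) (simp add: rdiff_def)
  then show ?case by simp
qed simp

lemma poly_fun_add:
  assumes "poly_fun N d f" "poly_fun N d g"
  shows "poly_fun N d (\<lambda>x. f x + g x)"
  using assms
proof (induction d arbitrary: f g)
  case (Suc d)
  have "rdiff h (\<lambda>x. f x + g x) = (\<lambda>x. rdiff h f x + rdiff h g x)" for h
    by (auto simp: rdiff_def fun_eq_iff)
  then show ?case using Suc by simp
qed simp

lemma poly_fun_uminus: "poly_fun N d f \<Longrightarrow> poly_fun N d (\<lambda>x. - f x)"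
proof (induction d arbitrary: f)
  case (Suc d)
  have "rdiff h (\<lambda>x. - f x) = (\<lambda>x. - rdiff h f x)" for h
    by (auto simp: rdiff_def fun_eq_iff)
  then show ?case using Suc by simp
qed simp

lemma poly_fun_zero: "poly_fun N d (\<lambda>x. 0 :: 'c::ab_group_add)"
proof (induction d)
  case (Suc d)
  have "rdiff h (\<lambda>x. 0) = (\<lambda>x. 0 :: 'c)" for h by (auto simp: rdiff_def fun_eq_iff)
  then show ?case using Suc by simp
qed simp

lemma poly_fun_Suc:
  assumes "subgroup N G" "poly_fun N d f" shows "poly_fun N (Suc d) f"
  using assms(2)
proof (induction d arbitrary: f)
  case 0
  then show ?case using subgroup.m_closed [OF assms(1)] by (simp add: rdiff_def)
next
  case (Suc d)
  show ?case
    using Suc.IH [of "rdiff h f" for h] Suc.prems by (subst poly_fun.simps) simp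
qed

lemma poly_fun_mono:
  assumes "subgroup N G" "poly_fun N d f" "d \<le> e" shows "poly_fun N e f"
  using assms(3,2) by (induction rule: dec_induct) (auto intro: poly_fun_Suc [OF assms(1)] simp del: poly_fun.simps)

text \<open>A difference along \<open>h\<close> of the translate is the translate of the difference
  along \<open>inv g \<otimes> h \<otimes> g\<close>. Since all directions are quantified over, the
  conjugation is absorbed.\<close>

lemma poly_fun_shift:
  assumes N: "subgroup N G" and g: "g \<in> N" and "poly_fun N d f"
  shows "poly_fun N d (\<lambda>x. f (x \<otimes> g))"
  using assms(3)
proof (induction d arbitrary: f)
  case 0
  then show ?case using g subgroup.m_closed [OF N] by simp
next
  case (Suc d)
  interpret N: subgroup N G by (rule N)
  have "poly_fun N d (rdiff h (\<lambda>x. f (x \<otimes> g)))" if h: "h \<in> N" for h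
  proof -
    have "poly_fun N d (\<lambda>x. rdiff (inv g \<otimes> h \<otimes> g) f (x \<otimes> g))"
      using Suc g h by simp
    then show ?thesis
      by (rule poly_fun_cong [OF N, THEN iffD1, rotated])
         (use g h in \<open>simp add: rdiff_def group_word_simps\<close>)
  qed
  then show ?case by simp
qed

text \<open>Cocycle rule: a difference along \<open>g \<otimes> h\<close> is one along
  \<open>g\<close> plus a translate of one along \<open>h\<close>, and translates keep the degree.
  An inverse direction gives a negated translate.\<close>

lemma poly_fun_generators:
  fixes f :: "'a \<Rightarrow> 'c::ab_group_add"
  assumes N: "subgroup N G" and T: "T \<subseteq> N" "N \<subseteq> generate G T"
    and f: "\<And>h. h \<in> T \<Longrightarrow> poly_fun N d (rdiff h f)"
  shows "poly_fun N (Suc d) f"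
proof -
  interpret N: subgroup N G by (rule N)
  have "h \<in> N \<and> poly_fun N d (rdiff h f)" if "h \<in> generate G T" for h
    using that
  proof (induction rule: generate.induct)
    case one
    have "poly_fun N d (rdiff \<one> f) = poly_fun N d (\<lambda>x. 0 :: 'c)"
      by (rule poly_fun_cong [OF N]) (simp add: rdiff_def)
    then show ?case by (simp add: poly_fun_zero)
  next
    case (incl h) then show ?case using f T by auto
  next
    case (inv h)
    then have h: "h \<in> N" using T by auto
    have "poly_fun N d (\<lambda>x. rdiff h f x)" using f inv by simp
    then have "poly_fun N d (\<lambda>x. rdiff h f (x \<otimes> inv h))"
      by (rule poly_fun_shift [OF N, rotated]) (use h in simp)
    then have "poly_fun N d (\<lambda>x. - rdiff h f (x \<otimes> inv h))"
      by (rule poly_fun_uminus)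
    then have "poly_fun N d (rdiff (inv h) f)"
      by (rule poly_fun_cong [OF N, THEN iffD1, rotated])
         (use h in \<open>simp add: rdiff_def group_word_simps\<close>)
    then show ?case using h by simp
  next
    case (eng g h)
    then have "poly_fun N d (\<lambda>x. rdiff g f x + rdiff h f (x \<otimes> g))"
      by (intro poly_fun_add poly_fun_shift [OF N]) auto
    then have "poly_fun N d (rdiff (g \<otimes> h) f)"
      by (rule poly_fun_cong [OF N, THEN iffD1, rotated])
         (use eng in \<open>simp add: rdiff_def group_word_simps\<close>)
    then show ?case using eng by simp
  qed
  then show ?thesis using T by auto
qed

lemma poly_fun_const:
  assumes "subgroup N G" "poly_fun N (Suc 0) f" "x \<in> N" "y \<in> N"
  shows "f x = f y"
proof -
  interpret N: subgroup N G by (rule assms)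
  have "rdiff (inv y \<otimes> x) f y = 0" using assms by simp
  then show ?thesis using assms by (simp add: rdiff_def group_word_simps)
qed

text \<open>Left and right translations commute, so the left difference passes through the right
  ones until a constant is left, which it kills. At \<open>d = 0\<close> the truncated subtraction
  is harmless, as \<open>f\<close> already vanishes.\<close>

lemma poly_fun_ldiff:
  assumes N: "subgroup N G" and "poly_fun N d f" and h: "h \<in> N"
  shows "poly_fun N (d - 1) (ldiff h f)"
  using assms(2)
proof (induction d arbitrary: f)
  case 0
  then show ?case using h subgroup.m_closed [OF N] by (simp add: ldiff_def)
next
  case (Suc d)
  interpret N: subgroup N G by (rule N)
  show ?case
  proof (cases d)
    case 0
    then have "f (h \<otimes> x) = f x" if "x \<in> N" for x
      using that h Suc.prems by (intro poly_fun_const [OF N]) auto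
    then show ?thesis using 0 by (simp add: ldiff_def)
  next
    case (Suc e)
    have "poly_fun N e (rdiff g (ldiff h f))" if g: "g \<in> N" for g
    proof -
      have "poly_fun N (d - 1) (ldiff h (rdiff g f))" using Suc.IH Suc.prems g by simp
      then have "poly_fun N e (ldiff h (rdiff g f))" using Suc by simp
      then show ?thesis
        by (rule poly_fun_cong [OF N, THEN iffD1, rotated])
           (use g h in \<open>simp add: rdiff_def ldiff_def group_word_simps algebra_simps\<close>)
    qed
    then show ?thesis using Suc by simp
  qed
qed

end

section \<open>Weighted degree and unipotence of conjugation\<close>

context central_series
begin

text \<open>A difference in a direction from \<open>L i\<close> lowers the weighted degree by \<open>i + 1\<close>. Passing to
  weighted degrees makes conjugation by elements of the group act unipotently.\<close>

fun weighted_poly :: "'a set \<Rightarrow> nat \<Rightarrow> ('a \<Rightarrow> rat) \<Rightarrow> bool" where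
  "weighted_poly N 0 f = (\<forall>x\<in>N. f x = 0)"
| "weighted_poly N (Suc W) f = (\<forall>i\<le>W. \<forall>h\<in>N \<inter> L i. weighted_poly N (W - i) (rdiff h f))"

end

locale central_series_normal = central_series +
  fixes N
  assumes N_normal: "N \<lhd> G"
begin

sublocale N: subgroup N G by (rule normal_subgroup [OF N_normal])

lemma weighted_cong:
  assumes "\<And>x. x \<in> N \<Longrightarrow> f x = g x"
  shows "weighted_poly N W f = weighted_poly N W g"
  using assms
proof (induction W arbitrary: f g rule: less_induct)
  case (less W)
  show ?case
  proof (cases W)
    case (Suc V)
    have "weighted_poly N (V - i) (rdiff h f) = weighted_poly N (V - i) (rdiff h g)" if "h \<in> N" for h i
      by (rule less.IH) (use Suc less.prems that in \<open>auto simp: rdiff_def\<close>)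
    then show ?thesis using Suc by auto
  qed (use less.prems in simp)
qed

lemma weighted_lin:
  assumes "weighted_poly N W f" "weighted_poly N W g"
  shows "weighted_poly N W (\<lambda>x. c * f x + d * g x)"
  using assms
proof (induction W arbitrary: f g rule: less_induct)
  case (less W)
  show ?case
  proof (cases W)
    case (Suc V)
    have "rdiff h (\<lambda>x. c * f x + d * g x) = (\<lambda>x. c * rdiff h f x + d * rdiff h g x)" for h
      by (auto simp: rdiff_def fun_eq_iff algebra_simps)
    then show ?thesis using Suc less by auto
  qed (use less.prems in simp)
qed

lemma weighted_zero: "weighted_poly N W (\<lambda>x. 0)"
proof (induction W rule: less_induct)
  case (less W)
  have "rdiff h (\<lambda>x. 0) = (\<lambda>x. 0 :: rat)" for h by (auto simp: rdiff_def fun_eq_iff)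
  then show ?case using less by (cases W) auto
qed

lemma weighted_add:
  "\<lbrakk>weighted_poly N W f; weighted_poly N W g\<rbrakk> \<Longrightarrow> weighted_poly N W (\<lambda>x. f x + g x)"
  using weighted_lin [of W f g 1 1] by simp

lemma weighted_scale:
  "weighted_poly N W f \<Longrightarrow> weighted_poly N W (\<lambda>x. c * f x)"
  using weighted_lin [of W f f c 0] by simp

lemma weighted_sum:
  assumes "\<And>j. j \<in> J \<Longrightarrow> weighted_poly N W (f j)"
  shows "weighted_poly N W (\<lambda>x. \<Sum>j\<in>J. f j x)"
  using assms
  by (induction J rule: infinite_finite_induct) (auto intro: weighted_zero weighted_add)

lemma weighted_Suc: "weighted_poly N W f \<Longrightarrow> weighted_poly N (Suc W) f"
proof (induction W arbitrary: f rule: less_induct)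
  case (less W)
  show ?case
  proof (cases W)
    case 0 then show ?thesis using less.prems by (simp add: rdiff_def)
  next
    case (Suc V)
    have "weighted_poly N (W - i) (rdiff h f)" if i: "i \<le> W" and h: "h \<in> N \<inter> L i" for h i
    proof (cases "i \<le> V")
      case True
      have "weighted_poly N (V - i) (rdiff h f)" using less.prems h True Suc by simp
      then have "weighted_poly N (Suc (V - i)) (rdiff h f)" by (rule less.IH [rotated]) (use Suc in simp)
      then show ?thesis using True Suc by (simp add: Suc_diff_le)
    next
      case False
      then have "h \<in> L V" using h L_antimono [of V i] by auto
      then have "weighted_poly N (V - V) (rdiff h f)" using less.prems h unfolding Suc
        by (subst (asm) weighted_poly.simps) blast
      then show ?thesis using False i Suc by simp
    qed
    then show ?thesis by simp
  qed
qed

lemma weighted_mono: "\<lbrakk>weighted_poly N V f; V \<le> W\<rbrakk> \<Longrightarrow> weighted_poly N W f"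
  by (rotate_tac 1, induction rule: dec_induct) (auto intro: weighted_Suc simp del: weighted_poly.simps)

lemma weighted_rdiff:
  assumes "weighted_poly N W f" "h \<in> N" "h \<in> L i"
  shows "weighted_poly N (W - Suc i) (rdiff h f)"
proof (cases W)
  case 0 then show ?thesis using assms by (simp add: rdiff_def)
next
  case (Suc V)
  show ?thesis
  proof (cases "i \<le> V")
    case True then show ?thesis using assms Suc by simp
  next
    case False
    then have "h \<in> L V" using assms L_antimono [of V i] by auto
    then have "weighted_poly N (V - V) (rdiff h f)" using assms unfolding Suc
      by (subst (asm) weighted_poly.simps) blast
    then show ?thesis using False Suc by simp
  qed
qed

lemma weighted_const:
  assumes "weighted_poly N (Suc 0) f" "x \<in> N" "y \<in> N"
  shows "f x = f y"
proof -
  have "inv y \<otimes> x \<in> N \<inter> L 0" using assms by (simp add: L_0)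
  then have "rdiff (inv y \<otimes> x) f y = 0" using assms by simp
  then show ?thesis using assms by (simp add: rdiff_def group_word_simps)
qed

lemma weighted_ldiff:
  assumes b: "b \<in> N"
  shows "weighted_poly N W f \<Longrightarrow> weighted_poly N (W - 1) (ldiff b f)"
proof (induction W arbitrary: f rule: less_induct)
  case (less W)
  consider "W = 0" | "W = Suc 0" | U where "W = Suc (Suc U)" by (metis not0_implies_Suc)
  then show ?case
  proof cases
    case 1 then show ?thesis using less.prems b by (simp add: ldiff_def)
  next
    case 2
    then have "f (b \<otimes> x) = f x" if "x \<in> N" for x
      using that b less.prems by (intro weighted_const) auto
    then show ?thesis using 2 by (simp add: ldiff_def)
  next
    case 3
    have "weighted_poly N (U - i) (rdiff h (ldiff b f))" if "i \<le> U" "h \<in> N \<inter> L i" for i h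
    proof -
      have "weighted_poly N (Suc U - i) (rdiff h f)" using weighted_rdiff [of W f h i] less.prems that 3 by simp
      then have "weighted_poly N (Suc U - i - 1) (ldiff b (rdiff h f))"
        by (rule less.IH [rotated]) (use 3 in simp)
      then have "weighted_poly N (U - i) (ldiff b (rdiff h f))" using that by simp
      then show ?thesis
        by (rule weighted_cong [THEN iffD1, rotated])
           (use that b in \<open>simp add: rdiff_def ldiff_def group_word_simps algebra_simps\<close>)
    qed
    then show ?thesis using 3 by simp
  qed
qed

definition conj_fun :: "'a \<Rightarrow> ('a \<Rightarrow> rat) \<Rightarrow> 'a \<Rightarrow> rat"
  where "conj_fun g f x = f (inv g \<otimes> x \<otimes> g)"

text \<open>Write the conjugate \<open>h' = inv g \<otimes> h \<otimes> g\<close> as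
  \<open>h \<otimes> k\<close>. The difference of \<open>conj_fun g f - f\<close> along
  \<open>h\<close> is the same expression for \<open>rdiff h' f\<close>, covered by induction, plus
  a translate along \<open>h\<close> of \<open>rdiff k f\<close>. The element \<open>k\<close> is a
  commutator, hence one step deeper in the series than \<open>h\<close>, and the weighting counts
  exactly this step.\<close>

lemma weighted_conj_diff:
  assumes g: "g \<in> carrier G"
  shows "weighted_poly N W f \<Longrightarrow> weighted_poly N (W - 1) (\<lambda>x. conj_fun g f x - f x)"
proof (induction W arbitrary: f rule: less_induct)
  case (less W)
  have cN: "inv g \<otimes> x \<otimes> g \<in> N" if "x \<in> N" for x using normal_conj_inv [OF N_normal g that] .
  consider "W = 0" | "W = Suc 0" | U where "W = Suc (Suc U)" by (metis not0_implies_Suc)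
  then show ?case
  proof cases
    case 1 then show ?thesis using less.prems cN by (simp add: conj_fun_def)
  next
    case 2
    then have "f (inv g \<otimes> x \<otimes> g) = f x" if "x \<in> N" for x
      using that cN less.prems by (intro weighted_const) auto
    then show ?thesis using 2 by (simp add: conj_fun_def)
  next
    case 3
    have "weighted_poly N (U - i) (rdiff h (\<lambda>x. conj_fun g f x - f x))"
      if i: "i \<le> U" and h: "h \<in> N" "h \<in> L i" for i h
    proof -
      define h' where "h' = inv g \<otimes> h \<otimes> g"
      define k where "k = inv h \<otimes> h'"
      have h': "h' \<in> N" "h' \<in> L i"
        using cN h normal_conj_inv [OF L_normal g] by (auto simp: h'_def)
      have kN: "k \<in> N" using h h' by (simp add: k_def)
      have hc: "h \<in> carrier G" using h by simp
      have "k = commutator (inv h) (inv g)"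
        using hc g by (simp add: k_def h'_def commutator_def group_word_simps)
      also have "\<dots> = inv (commutator (inv g) (inv h))"
        using hc g by (simp add: commutator_def group_word_simps)
      finally have kL: "k \<in> L (Suc i)"
        using L_commutator [of "inv g" "inv h" i] h g subgroup.m_inv_closed [OF L_subgroup] by simp
      have "weighted_poly N (Suc U - i) (rdiff h' f)"
        using weighted_rdiff [of W f h' i] less.prems h' 3 by simp
      then have "weighted_poly N (Suc U - i - 1) (\<lambda>x. conj_fun g (rdiff h' f) x - rdiff h' f x)"
        by (rule less.IH [rotated]) (use 3 in simp)
      then have 1: "weighted_poly N (U - i) (\<lambda>x. conj_fun g (rdiff h' f) x - rdiff h' f x)"
        using i by simp
      have 2: "weighted_poly N (U - i) (rdiff k f)"
        using weighted_rdiff [of W f k "Suc i"] less.prems kN kL 3 by simp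
      have 4: "weighted_poly N (U - i) (rdiff h (rdiff k f))"
        using weighted_mono [OF weighted_rdiff [OF 2 h]] by simp
      have "weighted_poly N (U - i) (\<lambda>x. (conj_fun g (rdiff h' f) x - rdiff h' f x) +
          (rdiff k f x + rdiff h (rdiff k f) x))"
        by (intro weighted_add 1 2 4)
      then show ?thesis
      proof (rule weighted_cong [THEN iffD1, rotated])
        fix x assume x: "x \<in> N"
        have e1: "x \<otimes> h \<otimes> k = x \<otimes> h'" using x h h' by (simp add: k_def group_word_simps)
        have e2: "inv g \<otimes> x \<otimes> g \<otimes> h' = inv g \<otimes> (x \<otimes> h) \<otimes> g"
          using x hc g by (simp add: h'_def group_word_simps)
        show "(conj_fun g (rdiff h' f) x - rdiff h' f x) + (rdiff k f x + rdiff h (rdiff k f) x)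
          = rdiff h (\<lambda>x. conj_fun g f x - f x) x"
          unfolding rdiff_def conj_fun_def e1 e2 by (simp add: algebra_simps)
      qed
    qed
    then show ?thesis using 3 by simp
  qed
qed

lemma weighted_conj:
  assumes "g \<in> carrier G" "weighted_poly N W f"
  shows "weighted_poly N W (conj_fun g f)"
  using weighted_add [OF weighted_mono [OF weighted_conj_diff [OF assms]] assms(2)] by simp

text \<open>A direction in \<open>L i\<close> costs \<open>i + 1\<close> units of weight and is
  trivial for \<open>i > r\<close>, so a budget of \<open>Suc r\<close> pays for each ordinary
  difference.\<close>

lemma poly_fun_imp_weighted_poly: "poly_fun N d f \<Longrightarrow> weighted_poly N (d * Suc r) f"
proof (induction d arbitrary: f)
  case (Suc d)
  have "weighted_poly N (d * Suc r + r - i) (rdiff h f)" if h: "h \<in> N" "h \<in> L i" for i h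
  proof (cases "i \<le> r")
    case True
    have "weighted_poly N (d * Suc r) (rdiff h f)" using Suc h by simp
    then show ?thesis by (rule weighted_mono) (use True in simp)
  next
    case False
    then have "h = \<one>" using h L_trivial [of i] by simp
    then show ?thesis
      using weighted_cong [of "rdiff h f" "\<lambda>x. 0" "d * Suc r + r - i"] weighted_zero
      by (simp add: rdiff_def del: weighted_poly.simps)
  qed
  then have "weighted_poly N (Suc (d * Suc r + r)) f"
    by (subst weighted_poly.simps) blast
  moreover have "Suc d * Suc r = Suc (d * Suc r + r)" by simp
  ultimately show ?case by (simp only:)
qed simp

end

section \<open>Extending polynomial functions\<close>

context group
begin

lemma poly_fun_additive:
  assumes "subgroup N G" "\<And>x y. \<lbrakk>x \<in> N; y \<in> N\<rbrakk> \<Longrightarrow> f (x \<otimes> y) = f x + f y"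
  shows "poly_fun N 2 f"
proof -
  have "poly_fun N (Suc (Suc 0)) f"
    using assms(2) subgroup.m_closed [OF assms(1)] by (simp add: rdiff_def)
  then show ?thesis by (simp only: numeral_2_eq_2)
qed

end

text \<open>The generalized binomial series gives the fractional powers \<open>(1 + ldiff b)\<^sup>t\<close> of left
  translation by \<open>b\<close>. They are used to extend a polynomial function over a finite cyclic extension,
  where a generator plays the role of a root of \<open>b\<close>.\<close>

locale fractional_shift = central_series_normal +
  fixes b :: 'a and B :: nat
  assumes b_in: "b \<in> N"
begin

definition ldiff_iter :: "nat \<Rightarrow> ('a \<Rightarrow> rat) \<Rightarrow> 'a \<Rightarrow> rat"
  where "ldiff_iter j = ldiff b ^^ j"

lemma ldiff_iter_0 [simp]: "ldiff_iter 0 f = f"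
  by (simp add: ldiff_iter_def)

lemma ldiff_iter_Suc: "ldiff_iter (Suc j) f x = ldiff_iter j f (b \<otimes> x) - ldiff_iter j f x"
  by (simp add: ldiff_iter_def ldiff_def)

lemma ldiff_iter_add: "ldiff_iter j (ldiff_iter l f) = ldiff_iter (j + l) f"
  by (simp add: ldiff_iter_def funpow_add)

lemma ldiff_iter_diff: "ldiff_iter j (\<lambda>x. f x - g x) x = ldiff_iter j f x - ldiff_iter j g x"
  by (induction j arbitrary: x) (simp_all add: ldiff_iter_Suc)

lemma ldiff_iter_sum:
  "ldiff_iter j (\<lambda>x. \<Sum>i\<in>I. c i * f i x) x = (\<Sum>i\<in>I. c i * ldiff_iter j (f i) x)"
  by (induction j arbitrary: x) (simp_all add: ldiff_iter_Suc sum_subtractf right_diff_distrib)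

lemma weighted_ldiff_iter: "weighted_poly N W f \<Longrightarrow> weighted_poly N (W - j) (ldiff_iter j f)"
proof (induction j)
  case (Suc j)
  have "weighted_poly N (W - j - 1) (ldiff b (ldiff_iter j f))"
    using weighted_ldiff [OF b_in] Suc by blast
  then show ?case by (simp add: ldiff_iter_def)
qed simp

lemma ldiff_iter_vanish:
  assumes "weighted_poly N W f" "W \<le> j" "x \<in> N"
  shows "ldiff_iter j f x = 0"
  using weighted_ldiff_iter [OF assms(1), of j] assms by simp

text \<open>Left translation by a formal \<open>t\<close>-th power of \<open>b\<close>. Truncation
  at \<open>B\<close> loses nothing on functions of weight at most \<open>B\<close>, whose further
  differences vanish on \<open>N\<close>.\<close>

definition frac_shift :: "rat \<Rightarrow> ('a \<Rightarrow> rat) \<Rightarrow> 'a \<Rightarrow> rat"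
  where "frac_shift t f x = (\<Sum>j<B. (t gchoose j) * ldiff_iter j f x)"

lemma frac_shift_diff: "frac_shift t (\<lambda>x. f x - g x) x = frac_shift t f x - frac_shift t g x"
  by (simp add: frac_shift_def ldiff_iter_diff right_diff_distrib sum_subtractf)

lemma frac_shift_vanish:
  assumes "\<And>x. x \<in> N \<Longrightarrow> f x = 0" "x \<in> N" shows "frac_shift t f x = 0"
proof -
  have "ldiff_iter j f x = 0" for j
    using assms(2) by (induction j arbitrary: x) (use assms(1) b_in in \<open>simp_all add: ldiff_iter_Suc\<close>)
  then show ?thesis by (simp add: frac_shift_def)
qed

lemma frac_shift_Suc:
  assumes "B = Suc C"
  shows "frac_shift t f x = f x + (\<Sum>j<C. (t gchoose Suc j) * ldiff_iter (Suc j) f x)"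
  unfolding frac_shift_def unfolding assms by (subst sum.lessThan_Suc_shift) simp

lemma frac_shift_0:
  assumes "weighted_poly N W f" "W \<le> B" "x \<in> N"
  shows "frac_shift 0 f x = f x"
proof (cases B)
  case 0 then show ?thesis unfolding frac_shift_def using assms by simp
next
  case (Suc C)
  then show ?thesis by (subst frac_shift_Suc [OF Suc]) simp
qed

text \<open>Pascal's rule; the one term that truncation drops is a vanishing top difference.\<close>

lemma frac_shift_plus_1:
  assumes f: "weighted_poly N W f" "W \<le> B" and x: "x \<in> N"
  shows "frac_shift (t + 1) f x = frac_shift t f (b \<otimes> x)"
proof (cases B)
  case 0 then show ?thesis unfolding frac_shift_def by simp
next
  case (Suc C)
  have top: "ldiff_iter B f x = 0" by (rule ldiff_iter_vanish [OF f x])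
  have "frac_shift (t + 1) f x = ldiff_iter 0 f x + (\<Sum>j<C. ((t + 1) gchoose Suc j) * ldiff_iter (Suc j) f x)"
    by (subst frac_shift_Suc [OF Suc]) simp
  also have "\<dots> = (ldiff_iter 0 f x + (\<Sum>j<C. (t gchoose Suc j) * ldiff_iter (Suc j) f x)) +
      (\<Sum>j<C. (t gchoose j) * ldiff_iter (Suc j) f x)"
    by (simp add: gbinomial_Suc_Suc distrib_right sum.distrib)
  also have "ldiff_iter 0 f x + (\<Sum>j<C. (t gchoose Suc j) * ldiff_iter (Suc j) f x) = frac_shift t f x"
    by (subst frac_shift_Suc [OF Suc]) simp
  also have "(\<Sum>j<C. (t gchoose j) * ldiff_iter (Suc j) f x) = (\<Sum>j<B. (t gchoose j) * ldiff_iter (Suc j) f x)"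
    using top by (simp add: Suc)
  also have "\<dots> = (\<Sum>j<B. (t gchoose j) * (ldiff_iter j f (b \<otimes> x) - ldiff_iter j f x))"
    by (simp add: ldiff_iter_Suc)
  finally show ?thesis
    by (simp add: frac_shift_def right_diff_distrib sum_subtractf)
qed

lemma frac_shift_int:
  assumes f: "weighted_poly N W f" "W \<le> B" and x: "x \<in> N"
  shows "frac_shift (t + of_int l) f x = frac_shift t f (b [^] l \<otimes> x)"
proof -
  have b: "b \<in> carrier G" using b_in by simp
  have nat: "frac_shift (s + of_nat n) f y = frac_shift s f (b [^] n \<otimes> y)" if "y \<in> N" for s n y
    using that
  proof (induction n arbitrary: y)
    case (Suc n)
    have "frac_shift (s + of_nat (Suc n)) f y = frac_shift ((s + of_nat n) + 1) f y"
      by (simp add: algebra_simps)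
    also have "\<dots> = frac_shift (s + of_nat n) f (b \<otimes> y)" by (rule frac_shift_plus_1 [OF f Suc.prems])
    also have "\<dots> = frac_shift s f (b [^] n \<otimes> (b \<otimes> y))" using Suc b_in by simp
    finally show ?case using b Suc.prems by (simp add: m_assoc)
  qed simp
  show ?thesis
  proof (cases l rule: int_cases2)
    case (nonneg n) then show ?thesis using nat x by (simp add: int_pow_int)
  next
    case (nonpos n)
    have bn: "b [^] n \<in> N" using subgroup_int_pow [OF N.subgroup_axioms b_in, of "int n"] by (simp add: int_pow_int)
    have "inv (b [^] n) \<otimes> x \<in> N" using x bn by simp
    from nat [OF this, of "t - of_nat n" n] show ?thesis using nonpos b x bn
      by (simp add: int_pow_neg int_pow_int cancel_inv_left)
  qed
qed

text \<open>Vandermonde's identity. The square of index pairs may be cut down to the triangle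
  \<open>i + j < B\<close>, because longer differences vanish.\<close>

lemma frac_shift_add:
  assumes f: "weighted_poly N W f" "W \<le> B" and x: "x \<in> N"
  shows "frac_shift (s + t) f x = frac_shift s (frac_shift t f) x"
proof -
  let ?g = "\<lambda>i j. (s gchoose i) * (t gchoose j) * ldiff_iter (i + j) f x"
  have "frac_shift s (frac_shift t f) x
      = (\<Sum>i<B. \<Sum>j<B. ?g i j)"
    unfolding frac_shift_def ldiff_iter_sum
    by (simp add: sum_distrib_left ldiff_iter_add mult.assoc)
  also have "\<dots> = (\<Sum>(i, j) \<in> {..<B} \<times> {..<B}. ?g i j)"
    by (simp add: sum.cartesian_product)
  also have "\<dots> = (\<Sum>(i, j) \<in> {(i, j). i + j < B}. ?g i j)"
  proof (rule sum.mono_neutral_right)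
    show "\<forall>p\<in>{..<B} \<times> {..<B} - {(i, j). i + j < B}. (case p of (i, j) \<Rightarrow> ?g i j) = 0"
    proof
      fix p assume p: "p \<in> {..<B} \<times> {..<B} - {(i, j). i + j < B}"
      obtain i j where ij: "p = (i, j)" by (cases p)
      then have "W \<le> i + j" using p f(2) by auto
      then show "(case p of (i, j) \<Rightarrow> ?g i j) = 0"
        using ldiff_iter_vanish [OF f(1) _ x] ij by simp
    qed
  qed auto
  also have "\<dots> = (\<Sum>k<B. \<Sum>i\<le>k. ?g i (k - i))"
    by (rule sum.triangle_reindex)
  also have "\<dots> = (\<Sum>k<B. (\<Sum>i\<le>k. (s gchoose i) * (t gchoose (k - i))) * ldiff_iter k f x)"
    by (simp add: sum_distrib_right)
  also have "\<dots> = frac_shift (s + t) f x"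
    unfolding frac_shift_def by (simp add: gbinomial_Vandermonde atMost_atLeast0)
  finally show ?thesis by simp
qed

text \<open>The term \<open>j = 0\<close> is the identity and all others contain a left difference:
  fractional translations are unipotent for the weight.\<close>

lemma weighted_frac_shift_diff:
  assumes f: "weighted_poly N W f" "W \<le> B"
  shows "weighted_poly N (W - 1) (\<lambda>x. frac_shift t f x - f x)"
proof (cases B)
  case 0
  then show ?thesis
    unfolding frac_shift_def
    using assms weighted_cong [of "\<lambda>x. - f x" "\<lambda>x. 0" 0] weighted_zero by simp
next
  case (Suc C)
  have "weighted_poly N (W - 1) (\<lambda>x. \<Sum>j<C. (t gchoose Suc j) * ldiff_iter (Suc j) f x)"
    by (intro weighted_sum weighted_scale weighted_mono [OF weighted_ldiff_iter [OF f(1)]]) simp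
  moreover have "frac_shift t f x - f x = (\<Sum>j<C. (t gchoose Suc j) * ldiff_iter (Suc j) f x)" for x
    by (subst frac_shift_Suc [OF Suc]) simp
  ultimately show ?thesis by simp
qed

lemma frac_shift_rdiff:
  assumes "h \<in> N" "x \<in> N"
  shows "frac_shift t (rdiff h f) x = frac_shift t f (x \<otimes> h) - frac_shift t f x"
proof -
  have "ldiff_iter j (rdiff h f) x = ldiff_iter j f (x \<otimes> h) - ldiff_iter j f x" for j
    using assms(2)
    by (induction j arbitrary: x)
       (use assms(1) b_in in \<open>simp_all add: ldiff_iter_Suc rdiff_def m_assoc\<close>)
  then show ?thesis by (simp add: frac_shift_def right_diff_distrib sum_subtractf)
qed

lemma frac_shift_conj:
  assumes u: "u \<in> carrier G" "u \<otimes> b = b \<otimes> u" and "x \<in> N"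
  shows "frac_shift t (conj_fun u f) x = frac_shift t f (inv u \<otimes> x \<otimes> u)"
proof -
  have b: "b \<in> carrier G" using b_in by simp
  have c: "inv u \<otimes> (b \<otimes> y) \<otimes> u = b \<otimes> (inv u \<otimes> y \<otimes> u)" if "y \<in> carrier G" for y
  proof -
    have "inv u \<otimes> b = b \<otimes> inv u"
      using u b by (metis inv_closed inv_solve_left inv_solve_right m_assoc m_closed)
    then show ?thesis using u b that by (simp add: m_assoc [symmetric])
  qed
  have "ldiff_iter j (conj_fun u f) x = ldiff_iter j f (inv u \<otimes> x \<otimes> u)" for j
    using assms(3)
    by (induction j arbitrary: x) (use b_in in \<open>simp_all add: ldiff_iter_Suc conj_fun_def c\<close>)
  then show ?thesis by (simp add: frac_shift_def)
qed

end

section \<open>Extension over one cyclic factor\<close>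

locale cyclic_extension = fractional_shift +
  fixes M :: "'a set" and u :: 'a and q :: rat
  assumes M: "subgroup M G" and N_sub_M: "N \<subseteq> M" and u_in: "u \<in> M"
    and M_decomp: "x \<in> M \<Longrightarrow> \<exists>k::int. \<exists>n\<in>N. x = u [^] k \<otimes> n"
    and ab: "u \<otimes> b = b \<otimes> u"
    and power_in: "u [^] (i::int) \<in> N \<Longrightarrow> \<exists>l::int. of_int i * q = of_int l \<and> u [^] i = b [^] l"
begin

lemma u_carrier: "u \<in> carrier G"
  using u_in M subgroup.mem_carrier by metis

text \<open>By \<open>power_in\<close> the element \<open>u\<close> behaves like the
  \<open>q\<close>-th power of \<open>b\<close>. So the value at \<open>u [^] k \<otimes> n\<close>
  should be the value at \<open>n\<close> of \<open>f\<close> translated by the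
  \<open>k * q\<close>-th power of \<open>b\<close>.\<close>

definition extension :: "('a \<Rightarrow> rat) \<Rightarrow> 'a \<Rightarrow> rat" where
  "extension f x = (let p = SOME p. snd p \<in> N \<and> x = u [^] (fst p :: int) \<otimes> snd p
     in frac_shift (of_int (fst p) * q) f (snd p))"

text \<open>Two decompositions of an element differ by a power of \<open>u\<close> inside
  \<open>N\<close>. This is an integral power of \<open>b\<close>, and for integral exponents the
  fractional shift is an actual translation, so the chosen decomposition is irrelevant.\<close>

lemma extension_eq:
  assumes f: "weighted_poly N W f" "W \<le> B" and n: "n \<in> N"
  shows "extension f (u [^] (k::int) \<otimes> n) = frac_shift (of_int k * q) f n"
proof -
  define p where "p = (SOME p. snd p \<in> N \<and> u [^] k \<otimes> n = u [^] (fst p :: int) \<otimes> snd p)"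
  have p: "snd p \<in> N \<and> u [^] k \<otimes> n = u [^] fst p \<otimes> snd p"
    unfolding p_def by (rule someI [of _ "(k, n)"]) (use n in simp)
  have nc: "n \<in> carrier G" "snd p \<in> carrier G" using n p by auto
  define i where "i = fst p - k"
  have "u [^] i = n \<otimes> inv (snd p)"
  proof -
    have "u [^] (fst p) = u [^] k \<otimes> n \<otimes> inv (snd p)"
      using p nc u_carrier by (simp add: m_assoc)
    then have "inv (u [^] k) \<otimes> u [^] fst p = n \<otimes> inv (snd p)"
      using nc u_carrier by (simp add: group_word_simps)
    moreover have "inv (u [^] k) \<otimes> u [^] fst p = u [^] i"
      using u_carrier by (simp add: i_def int_pow_neg [symmetric] int_pow_mult [symmetric])
    ultimately show ?thesis by simp
  qed
  then have *: "u [^] i \<in> N" "n = u [^] i \<otimes> snd p" using n p nc by (auto simp: m_assoc)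
  then obtain l where l: "of_int i * q = of_int l" "u [^] i = b [^] (l::int)" using power_in by blast
  have "extension f (u [^] k \<otimes> n) = frac_shift (of_int (fst p) * q) f (snd p)"
    unfolding extension_def p_def Let_def ..
  also have "of_int (fst p) * q = of_int k * q + of_int l"
    using l by (simp add: i_def algebra_simps)
  also have "frac_shift (of_int k * q + of_int l) f (snd p) = frac_shift (of_int k * q) f (b [^] l \<otimes> snd p)"
    by (rule frac_shift_int [OF f]) (use p in simp)
  also have "b [^] l \<otimes> snd p = n" using * l by simp
  finally show ?thesis .
qed

text \<open>In directions from \<open>N\<close>, extending commutes with taking differences. Along
  \<open>u\<close> the difference is the extension of \<open>v\<close>, which compares
  \<open>f\<close> with its conjugate by \<open>u\<close> shifted by \<open>q\<close>. Both
  operations are unipotent, so \<open>v\<close> has smaller weight; weight on \<open>N\<close>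
  thereby bounds the ordinary degree on \<open>M\<close>.\<close>

lemma extension_poly:
  "\<lbrakk>weighted_poly N W f; W \<le> B\<rbrakk> \<Longrightarrow> poly_fun M W (extension f)"
proof (induction W arbitrary: f)
  case 0
  have "extension f x = 0" if "x \<in> M" for x
  proof -
    obtain k n where kn: "n \<in> N" "x = u [^] (k::int) \<otimes> n" using M_decomp \<open>x \<in> M\<close> by blast
    then show ?thesis using extension_eq [OF 0 kn(1), of k] frac_shift_vanish [of f n] 0 by simp
  qed
  then show ?case by simp
next
  case (Suc W)
  note f = Suc.prems
  have N_dir: "poly_fun M W (rdiff h (extension f))" if h: "h \<in> N" for h
  proof -
    have w: "weighted_poly N W (rdiff h f)"
      using weighted_rdiff [OF f(1) h, of 0] h by (simp add: L_0)
    have "poly_fun M W (extension (rdiff h f))" using Suc.IH w f(2) by simp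
    then show ?thesis
    proof (rule poly_fun_cong [OF M, THEN iffD1, rotated])
      fix x assume "x \<in> M"
      then obtain k n where kn: "n \<in> N" "x = u [^] (k::int) \<otimes> n" using M_decomp by blast
      have "x \<otimes> h = u [^] k \<otimes> (n \<otimes> h)" using kn h u_carrier by (simp add: m_assoc)
      moreover have "n \<otimes> h \<in> N" using kn h by simp
      ultimately show "extension (rdiff h f) x = rdiff h (extension f) x"
        using extension_eq [OF w _ kn(1)] extension_eq [OF f, of _ k] kn f(2) frac_shift_rdiff [OF h kn(1)]
        by (simp add: rdiff_def)
    qed
  qed
  have a_dir: "poly_fun M W (rdiff u (extension f))"
  proof -
    define v where "v x = frac_shift q (conj_fun u f) x - f x" for x
    have cf: "weighted_poly N (Suc W) (conj_fun u f)" by (rule weighted_conj [OF u_carrier f(1)])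
    have "weighted_poly N (Suc W - 1)
        (\<lambda>x. (frac_shift q (conj_fun u f) x - conj_fun u f x) + (conj_fun u f x - f x))"
      by (intro weighted_add weighted_frac_shift_diff [OF cf f(2)] weighted_conj_diff [OF u_carrier f(1)])
    then have w: "weighted_poly N W v" by (simp add: v_def [abs_def])
    have "poly_fun M W (extension v)" using Suc.IH w f(2) by simp
    then show ?thesis
    proof (rule poly_fun_cong [OF M, THEN iffD1, rotated])
      fix x assume "x \<in> M"
      then obtain k n where kn: "n \<in> N" "x = u [^] (k::int) \<otimes> n" using M_decomp by blast
      define n' where "n' = inv u \<otimes> n \<otimes> u"
      have n': "n' \<in> N" unfolding n'_def by (rule normal_conj_inv [OF N_normal u_carrier kn(1)])
      have "x \<otimes> u = u [^] (k + 1) \<otimes> n'"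
        using kn u_carrier by (simp add: n'_def int_pow_mult group_word_simps)
      then have "extension f (x \<otimes> u) = frac_shift (of_int (k + 1) * q) f n'"
        using extension_eq [OF f n', of "k + 1"] by simp
      also have "\<dots> = frac_shift (of_int k * q + q) (conj_fun u f) n"
        using frac_shift_conj [OF u_carrier ab kn(1)] by (simp add: n'_def algebra_simps)
      also have "\<dots> = frac_shift (of_int k * q) (frac_shift q (conj_fun u f)) n"
        by (rule frac_shift_add [OF cf f(2) kn(1)])
      finally show "extension v x = rdiff u (extension f) x"
        using extension_eq [OF w _ kn(1), of k] extension_eq [OF f kn(1), of k] f(2)
        by (simp add: rdiff_def v_def [abs_def] frac_shift_diff kn(2))
    qed
  qed
  show ?case
  proof (rule poly_fun_generators [OF M, of "insert u N"])
    show "insert u N \<subseteq> M" using u_in N_sub_M by simp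
    have sub: "subgroup (generate G (insert u N)) G"
      by (rule generate_is_subgroup) (use u_carrier in auto)
    show "M \<subseteq> generate G (insert u N)"
    proof
      fix x assume "x \<in> M"
      then obtain k n where kn: "n \<in> N" "x = u [^] (k::int) \<otimes> n" using M_decomp by blast
      have "u \<in> generate G (insert u N)" "n \<in> generate G (insert u N)"
        using kn by (auto intro: generate.incl)
      then show "x \<in> generate G (insert u N)"
        using subgroup_int_pow [OF sub] subgroup.m_closed [OF sub] kn by simp
    qed
  qed (use N_dir a_dir in auto)
qed

lemma extension_extends:
  assumes "weighted_poly N W f" "W \<le> B" "n \<in> N"
  shows "extension f n = f n"
  using extension_eq [OF assms, of 0] frac_shift_0 [OF assms] assms(3) by simp

end

context group
begin

lemma mult_normal_pow:
  assumes K: "K \<lhd> G" and x: "x \<in> carrier G" and n: "n \<in> K"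
  shows "\<exists>n'\<in>K. (x \<otimes> n) [^] (t::nat) = x [^] t \<otimes> n'"
proof (induction t)
  interpret K: subgroup K G using K by (rule normal_subgroup)
  case 0
  show ?case by (rule bexI [of _ \<one>]) auto
next
  interpret K: subgroup K G using K by (rule normal_subgroup)
  case (Suc t)
  then obtain n' where n': "n' \<in> K" "(x \<otimes> n) [^] t = x [^] t \<otimes> n'" by blast
  have "(x \<otimes> n) [^] Suc t = x [^] Suc t \<otimes> ((inv x \<otimes> n' \<otimes> x) \<otimes> n)"
    using n' x n by (simp add: group_word_simps)
  moreover have "(inv x \<otimes> n' \<otimes> x) \<otimes> n \<in> K"
    using normal_conj_inv [OF K x n'(1)] n by simp
  ultimately show ?case by blast
qed

lemma poly_fun_of_int:
  "poly_fun N d (\<lambda>x. of_int (f x) :: rat) \<Longrightarrow> poly_fun N d f"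
proof (induction d arbitrary: f)
  case (Suc d)
  have "rdiff h (\<lambda>x. of_int (f x) :: rat) = (\<lambda>x. of_int (rdiff h f x))" for h
    by (auto simp: rdiff_def fun_eq_iff)
  then show ?case using Suc by simp
qed simp

lemma poly_fun_scale:
  fixes f :: "'a \<Rightarrow> rat"
  shows "poly_fun N d f \<Longrightarrow> poly_fun N d (\<lambda>x. c * f x)"
proof (induction d arbitrary: f)
  case (Suc d)
  have "rdiff h (\<lambda>x. c * f x) = (\<lambda>x. c * rdiff h f x)" for h
    by (auto simp: rdiff_def fun_eq_iff algebra_simps)
  then show ?case using Suc by simp
qed simp

end

context central_series
begin

lemma extend_poly_fun_step:
  assumes i: "i < r" and f: "poly_fun (L (Suc i)) d (f :: 'a \<Rightarrow> rat)"
  shows "\<exists>e F. poly_fun (L i) e F \<and> (\<forall>x\<in>L (Suc i). F x = f x)"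
proof -
  let ?N = "L (Suc i)" and ?u = "a i"
  interpret N: central_series_normal G L a r ?N
    by (intro central_series_normal.intro central_series_normal_axioms.intro
        central_series_axioms L_normal)
  have u: "?u \<in> carrier G" by (rule a_carrier [OF i])
  define W where "W = d * Suc r"
  have w: "weighted_poly ?N W f"
    unfolding W_def by (rule N.poly_fun_imp_weighted_poly [OF f])
  have "\<exists>b q. b \<in> ?N \<and> ?u \<otimes> b = b \<otimes> ?u \<and>
    (\<forall>k::int. ?u [^] k \<in> ?N \<longrightarrow> (\<exists>l::int. of_int k * (q::rat) = of_int l \<and> ?u [^] k = b [^] l))"
  proof (cases "\<exists>m::nat. m > 0 \<and> ?u [^] m \<in> ?N")
    case True
    \<comment> \<open>Finite factor: \<open>m\<close> is the order of the generator modulo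
      \<open>?N\<close>, and \<open>b = ?u [^] m\<close> with \<open>q = 1 / m\<close> makes the
      generator an \<open>m\<close>-th root of \<open>b\<close>.\<close>
    define m where "m = (LEAST m::nat. m > 0 \<and> ?u [^] m \<in> ?N)"
    have m: "m > 0" "?u [^] m \<in> ?N" using LeastI_ex [OF True] by (auto simp: m_def)
    have "\<exists>l::int. of_int k * (1 / of_nat m :: rat) = of_int l \<and> ?u [^] k = (?u [^] m) [^] l"
      if k: "?u [^] (k::int) \<in> ?N" for k
    proof -
      have split: "?u [^] k = (?u [^] m) [^] (k div int m) \<otimes> ?u [^] nat (k mod int m)"
      proof -
        have "k = int m * (k div int m) + int (nat (k mod int m))" using m(1) by simp
        then have "?u [^] k = ?u [^] (int m * (k div int m) + int (nat (k mod int m)))" by simp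
        also have "\<dots> = (?u [^] int m) [^] (k div int m) \<otimes> ?u [^] int (nat (k mod int m))"
          using u by (simp add: int_pow_mult int_pow_pow)
        finally show ?thesis by (simp add: int_pow_int)
      qed
      have "(?u [^] m) [^] (k div int m) \<in> ?N" using m(2) by (rule subgroup_int_pow [OF L_subgroup])
      then have "inv ((?u [^] m) [^] (k div int m)) \<otimes> ?u [^] k \<in> ?N" using k by simp
      then have "?u [^] nat (k mod int m) \<in> ?N" using u unfolding split by (simp add: inv_cancel_left)
      moreover have "nat (k mod int m) < m" using m(1) by (simp add: nat_less_iff)
      ultimately have "nat (k mod int m) = 0"
        using not_less_Least [of "nat (k mod int m)" "\<lambda>m. m > 0 \<and> ?u [^] m \<in> ?N"]
        by (auto simp: m_def)
      then have k0: "k mod int m = 0"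
        using m(1) pos_mod_sign [of "int m" k] by linarith
      then have "?u [^] k = (?u [^] m) [^] (k div int m)" using split u by simp
      moreover have "k = k div int m * int m" using k0 by (metis add.right_neutral div_mult_mod_eq)
      then have "of_int k = (of_int (k div int m) * of_nat m :: rat)"
        by (metis of_int_mult of_int_of_nat_eq)
      then have "of_int k * (1 / of_nat m :: rat) = of_int (k div int m)" using m(1) by simp
      ultimately show ?thesis by blast
    qed
    moreover have "?u \<otimes> ?u [^] m = ?u [^] m \<otimes> ?u"
      using u by (metis nat_pow_Suc nat_pow_Suc2)
    ultimately show ?thesis using m(2) by blast
  next
    case False
    \<comment> \<open>Infinite factor: only the zeroth power lies in \<open>?N\<close>, so
      \<open>b = \<one>\<close> and \<open>q = 0\<close> are consistent, and the extension ignores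
      the power of the generator.\<close>
    have "k = 0" if k: "?u [^] (k::int) \<in> ?N" for k
    proof (rule ccontr)
      assume "k \<noteq> 0"
      have "?u [^] nat \<bar>k\<bar> \<in> ?N"
      proof (cases k rule: int_cases2)
        case (nonneg n) then show ?thesis using k by (simp add: int_pow_int)
      next
        case (nonpos n)
        then have "inv (?u [^] n) \<in> ?N" using k u by (simp add: int_pow_neg int_pow_int)
        then have "inv (inv (?u [^] n)) \<in> ?N" by simp
        then show ?thesis using u nonpos by simp
      qed
      moreover have "nat \<bar>k\<bar> > 0" using \<open>k \<noteq> 0\<close> by simp
      ultimately show False using False by blast
    qed
    then have "\<exists>l::int. of_int k * (0::rat) = of_int l \<and> ?u [^] k = \<one> [^] l"
      if k: "?u [^] (k::int) \<in> ?N" for k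
    proof -
      have "k = 0" using \<open>\<And>k. ?u [^] (k::int) \<in> ?N \<Longrightarrow> k = 0\<close> k by blast
      then show ?thesis by (intro exI [of _ 0]) simp
    qed
    then show ?thesis using u by (intro exI [of _ \<one>] exI [of _ 0]) simp
  qed
  then obtain b q where b: "b \<in> ?N" "?u \<otimes> b = b \<otimes> ?u"
    "\<And>k::int. ?u [^] k \<in> ?N \<Longrightarrow> \<exists>l::int. of_int k * (q::rat) = of_int l \<and> ?u [^] k = b [^] l"
    by blast
  interpret E: cyclic_extension G L a r ?N b W "L i" ?u q
  proof (intro cyclic_extension.intro fractional_shift.intro cyclic_extension_axioms.intro
      fractional_shift_axioms.intro N.central_series_normal_axioms)
    show "?N \<subseteq> L i" by (rule L_antimono) simp
    show "\<And>x. x \<in> L i \<Longrightarrow> \<exists>k::int. \<exists>n\<in>?N. x = ?u [^] k \<otimes> n" using L_decomp [OF i] by blast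
    show "subgroup (L i) G" by (rule L_subgroup)
  qed (use b a_in [OF i] in auto)
  show ?thesis
    using E.extension_poly [OF w order_refl] E.extension_extends [OF w order_refl] by blast
qed

lemma extend_poly_fun:
  assumes "i \<le> r" "poly_fun (L i) d (f :: 'a \<Rightarrow> rat)"
  shows "\<exists>e F. poly_fun (carrier G) e F \<and> (\<forall>x\<in>L i. F x = f x)"
  using assms
proof (induction i arbitrary: d f)
  case 0 then show ?case by (auto simp: L_0)
next
  case (Suc i)
  obtain e F where F: "poly_fun (L i) e F" "\<forall>x\<in>L (Suc i). F x = f x"
    using extend_poly_fun_step [of i d f] Suc by auto
  then obtain e' F' where F': "poly_fun (carrier G) e' F'" "\<forall>x\<in>L i. F' x = F x"
    using Suc.IH [of e F] Suc.prems by auto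
  then show ?case using F L_antimono [of i "Suc i"] by (metis le_SucI order_refl subsetD)
qed

text \<open>The exponent of \<open>a i\<close> is well defined since the factor is infinite, and
  additive on \<open>L i\<close> since reordering a product changes only the part in the normal
  subgroup \<open>L (Suc i)\<close>. An additive function is polynomial, so it extends.\<close>

lemma coordinate_poly_fun:
  assumes i: "i < r" and inf: "\<And>m::nat. m > 0 \<Longrightarrow> a i [^] m \<notin> L (Suc i)"
  shows "\<exists>d F. poly_fun (carrier G) d F \<and>
    (\<forall>k::int. \<forall>n\<in>L (Suc i). F (a i [^] k \<otimes> n) = (of_int k :: rat))"
proof -
  let ?N = "L (Suc i)"
  have u: "a i \<in> carrier G" by (rule a_carrier [OF i])
  interpret N: subgroup ?N G by (rule L_subgroup)
  have uniq: "k = l" if "n \<in> ?N" "n' \<in> ?N" "a i [^] (k::int) \<otimes> n = a i [^] (l::int) \<otimes> n'" for k l n n'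
  proof -
    have wlog: "\<not> k < l" if h: "n \<in> ?N" "n' \<in> ?N" "a i [^] (k::int) \<otimes> n = a i [^] (l::int) \<otimes> n'" for k l n n'
    proof
      assume "k < l"
      then obtain m where m: "m > 0" "l = k + int m" by (metis zless_iff_Suc_zadd zero_less_Suc)
      have "n = a i [^] m \<otimes> n'" using h u m by (simp add: int_pow_mult int_pow_int m_assoc)
      then have "a i [^] m = n \<otimes> inv n'" using h u by (simp add: m_assoc)
      moreover have "n \<otimes> inv n' \<in> ?N" using h by simp
      ultimately show False using inf [OF m(1)] by simp
    qed
    show ?thesis using wlog [of n n' k l] wlog [of n' n l k] that by force
  qed
  define f :: "'a \<Rightarrow> rat" where "f x = of_int (THE k::int. \<exists>n\<in>?N. x = a i [^] k \<otimes> n)" for x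
  have f: "f (a i [^] k \<otimes> n) = of_int k" if "n \<in> ?N" for k n
  proof -
    have "(THE l::int. \<exists>n'\<in>?N. a i [^] k \<otimes> n = a i [^] l \<otimes> n') = k"
      by (rule the_equality) (use that uniq in blast)+
    then show ?thesis by (simp add: f_def)
  qed
  have "poly_fun (L i) 2 f"
  proof (rule poly_fun_additive [OF L_subgroup])
    fix x y assume "x \<in> L i" "y \<in> L i"
    then obtain k n l n' where *: "n \<in> ?N" "x = a i [^] (k::int) \<otimes> n"
      "n' \<in> ?N" "y = a i [^] (l::int) \<otimes> n'"
      using L_decomp [OF i] by meson
    let ?c = "a i [^] l"
    have "x \<otimes> y = a i [^] (k + l) \<otimes> ((inv ?c \<otimes> n \<otimes> ?c) \<otimes> n')"
      using u * by (simp add: int_pow_mult group_word_simps)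
    moreover have "(inv ?c \<otimes> n \<otimes> ?c) \<otimes> n' \<in> ?N"
      using normal_conj_inv [OF L_normal, of ?c n] u * by simp
    ultimately show "f (x \<otimes> y) = f x + f y" using f * by simp
  qed
  then obtain e F where F: "poly_fun (carrier G) e F" "\<forall>x\<in>L i. F x = f x"
    using extend_poly_fun [of i] i by force
  have "F (a i [^] k \<otimes> n) = of_int k" if n: "n \<in> ?N" for k n
  proof -
    have "a i [^] k \<otimes> n \<in> L i"
      using subgroup.m_closed [OF L_subgroup] subgroup_int_pow [OF L_subgroup a_in [OF i]]
        L_antimono [of i "Suc i"] n by auto
    then show ?thesis using F f n by simp
  qed
  then show ?thesis using F by blast
qed

text \<open>Suppose \<open>g\<close> fixes all functions, and take a term containing a positive
  power \<open>g [^] m\<close> whose successor contains no positive power of \<open>g\<close>;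
  torsion-freeness provides it when \<open>g\<close> is not \<open>\<one>\<close>. The factor there
  is infinite, for otherwise a further power would reach the successor. Its coordinate agrees at
  \<open>g [^] m\<close> and \<open>\<one>\<close>, so \<open>g [^] m\<close> lies in the successor
  after all.\<close>

lemma separating_poly_funs:
  assumes tf: "torsion_free G"
  shows "\<exists>Fs :: ('a \<Rightarrow> rat) list. (\<forall>F\<in>set Fs. \<exists>d. poly_fun (carrier G) d F) \<and>
    (\<forall>g\<in>carrier G. (\<forall>F\<in>set Fs. \<forall>x\<in>carrier G. F (x \<otimes> g) = F x) \<longrightarrow> g = \<one>)"
proof -
  define I where "I = {i. i < r \<and> (\<forall>m::nat. m > 0 \<longrightarrow> a i [^] m \<notin> L (Suc i))}"
  have "finite I" by (auto simp: I_def)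
  then obtain idx where idx: "set idx = I" using finite_list by blast
  have "\<forall>i\<in>I. \<exists>F. (\<exists>d. poly_fun (carrier G) d F) \<and>
    (\<forall>k::int. \<forall>n\<in>L (Suc i). F (a i [^] k \<otimes> n) = (of_int k :: rat))"
  proof
    fix i assume "i \<in> I"
    then show "\<exists>F. (\<exists>d. poly_fun (carrier G) d F) \<and>
      (\<forall>k::int. \<forall>n\<in>L (Suc i). F (a i [^] k \<otimes> n) = (of_int k :: rat))"
      using coordinate_poly_fun [of i] by (auto simp: I_def)
  qed
  from bchoice [OF this] obtain F where "\<forall>i\<in>I. (\<exists>d. poly_fun (carrier G) d (F i)) \<and>
    (\<forall>k::int. \<forall>n\<in>L (Suc i). F i (a i [^] k \<otimes> n) = (of_int k :: rat))" by blast
  then have F: "\<And>i. i \<in> I \<Longrightarrow> \<exists>d. poly_fun (carrier G) d (F i)"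
    "\<And>i k n. \<lbrakk>i \<in> I; n \<in> L (Suc i)\<rbrakk> \<Longrightarrow> F i (a i [^] (k::int) \<otimes> n) = (of_int k :: rat)"
    by auto
  have "g = \<one>" if g: "g \<in> carrier G"
    and inv: "\<forall>i\<in>I. \<forall>x\<in>carrier G. F i (x \<otimes> g) = F i x" for g
  proof (rule ccontr)
    assume "g \<noteq> \<one>"
    define P where "P i \<longleftrightarrow> (\<exists>m::nat. m > 0 \<and> g [^] m \<in> L i)" for i
    have "P 0" unfolding P_def using g by (auto simp: L_0 intro!: exI [of _ 1])
    moreover have "\<not> P r"
    proof
      assume "P r"
      then obtain m :: nat where "m > 0" "g [^] m = \<one>" by (auto simp: P_def L_trivial)
      then show False using tf g \<open>g \<noteq> \<one>\<close> unfolding torsion_free_def by blast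
    qed
    moreover have "P r" if "P 0" "\<not> (\<exists>i<r. P i \<and> \<not> P (Suc i))"
    proof -
      have "i \<le> r \<Longrightarrow> P i" for i by (induction i) (use that in auto)
      then show ?thesis by simp
    qed
    ultimately obtain i where i: "i < r" "P i" "\<not> P (Suc i)" by blast
    then obtain m :: nat where m: "m > 0" "g [^] m \<in> L i" unfolding P_def by blast
    then obtain k n where kn: "n \<in> L (Suc i)" "g [^] m = a i [^] (k::int) \<otimes> n"
      using L_decomp [OF i(1)] by blast
    have u: "a i \<in> carrier G" by (rule a_carrier [OF i(1)])
    interpret N: subgroup "L (Suc i)" G by (rule L_subgroup)
    have "i \<in> I"
    proof -
      have False if t: "(t::nat) > 0" "a i [^] t \<in> L (Suc i)" for t
      proof -
        obtain n' where n': "n' \<in> L (Suc i)" "(a i [^] k \<otimes> n) [^] t = (a i [^] k) [^] t \<otimes> n'"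
          using mult_normal_pow [OF L_normal _ kn(1), of "a i [^] k" t] u by auto
        have "(a i [^] k) [^] t = (a i [^] t) [^] k"
        proof -
          have "(a i [^] k) [^] int t = (a i [^] int t) [^] k"
            using u by (simp only: int_pow_pow mult.commute)
          then show ?thesis by (simp add: int_pow_int)
        qed
        then have "(a i [^] k) [^] t \<in> L (Suc i)"
          using subgroup_int_pow [OF L_subgroup t(2)] by simp
        then have "(g [^] m) [^] t \<in> L (Suc i)" using n' kn by simp
        then have "g [^] (m * t) \<in> L (Suc i)" using g by (simp add: nat_pow_pow)
        moreover have "m * t > 0" using m t by simp
        ultimately show False using i(3) unfolding P_def by blast
      qed
      then show ?thesis using i(1) by (auto simp: I_def)
    qed
    have "F i (g [^] l) = F i \<one>" for l :: nat
    proof (induction l)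
      case (Suc l)
      have "F i (g [^] l \<otimes> g) = F i (g [^] l)" using inv \<open>i \<in> I\<close> g by simp
      then show ?case using Suc by simp
    qed simp
    from this [of m] have "of_int k = F i \<one>" using F(2) [OF \<open>i \<in> I\<close> kn(1), of k] kn(2) by simp
    also have "F i \<one> = of_int 0" using F(2) [OF \<open>i \<in> I\<close>, of \<one> 0] by simp
    finally have "k = 0" by simp
    then have "g [^] m \<in> L (Suc i)" using kn by simp
    then show False using i(3) m unfolding P_def by blast
  qed
  note main = this
  have "\<exists>d. poly_fun (carrier G) d h" if "h \<in> set (map F idx)" for h
    using that F(1) by (auto simp: idx)
  moreover have "g = \<one>" if g: "g \<in> carrier G"
    and inv: "\<forall>h\<in>set (map F idx). \<forall>x\<in>carrier G. h (x \<otimes> g) = h x" for g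
    by (rule main [OF g]) (use inv in \<open>simp add: idx\<close>)
  ultimately show ?thesis by blast
qed

end

section \<open>Integral functions and flags\<close>

context fg_group
begin

text \<open>Values are reached from \<open>f \<one>\<close> by adding letter differences. By
  induction each of the finitely many letters contributes one denominator.\<close>

lemma poly_fun_denominator:
  "poly_fun (carrier G) d f \<Longrightarrow> \<exists>q::int. q > 0 \<and> (\<forall>x\<in>carrier G. of_int q * f x \<in> (\<int> :: rat set))"
proof (induction d arbitrary: f)
  case 0 then show ?case by (intro exI [of _ 1]) simp
next
  case (Suc d)
  have "\<forall>s\<in>letters. \<exists>q::int. q > 0 \<and> (\<forall>x\<in>carrier G. of_int q * rdiff s f x \<in> \<int>)"
    using Suc.IH Suc.prems letters_closed by simp
  then obtain q where q: "\<And>s. s \<in> letters \<Longrightarrow> (q s :: int) > 0"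
    "\<And>s x. \<lbrakk>s \<in> letters; x \<in> carrier G\<rbrakk> \<Longrightarrow> of_int (q s) * rdiff s f x \<in> \<int>"
    by metis
  obtain n m where nm: "quotient_of (f \<one>) = (n, m)" by (cases "quotient_of (f \<one>)")
  then have f1: "f \<one> = of_int n / of_int m" "m > 0"
    using quotient_of_div quotient_of_denom_pos by auto
  define Q where "Q = m * (\<Prod>s\<in>letters. q s)"
  have "Q > 0" unfolding Q_def using f1 q by (intro mult_pos_pos prod_pos) auto
  have step: "of_int Q * rdiff s f x \<in> \<int>" if "s \<in> letters" "x \<in> carrier G" for s x
  proof -
    have "Q = (m * (\<Prod>s\<in>letters - {s}. q s)) * q s"
      unfolding Q_def using prod.remove [OF finite_letters that(1), of q] by simp
    then have "of_int Q * rdiff s f x = of_int (m * (\<Prod>s\<in>letters - {s}. q s)) * (of_int (q s) * rdiff s f x)"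
      by simp
    then show ?thesis using q(2) [OF that] by (metis Ints_mult Ints_of_int)
  qed
  have "of_int Q * f x \<in> \<int>" if "x \<in> carrier G" for x
    using that
  proof (induction rule: carrier_right_induct)
    case one
    have "of_int Q * f \<one> = of_int (n * (\<Prod>s\<in>letters. q s))"
      using f1 by (simp add: Q_def)
    then show ?case by (metis Ints_of_int)
  next
    case (step g s)
    have "of_int Q * f (g \<otimes> s) = of_int Q * f g + of_int Q * rdiff s f g"
      by (simp add: rdiff_def algebra_simps)
    then show ?case using step \<open>\<And>s x. \<lbrakk>s \<in> letters; x \<in> carrier G\<rbrakk> \<Longrightarrow> of_int Q * rdiff s f x \<in> \<int>\<close>
      by (simp add: Ints_add)
  qed
  then show ?case using \<open>Q > 0\<close> by blast
qed

text \<open>Right differences will make the stabilizers \<open>K j\<close> normal, left ones will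
  make \<open>delta j\<close> additive, and both together make it invariant under
  conjugation.\<close>

definition flag_step :: "('a \<Rightarrow> int) list \<Rightarrow> ('a \<Rightarrow> int) \<Rightarrow> bool" where
  "flag_step fs f \<longleftrightarrow> (\<forall>s\<in>letters. \<forall>D\<in>{rdiff s f, ldiff s f}.
     (\<exists>h\<in>set fs. \<forall>x\<in>carrier G. D x = h x) \<or> (\<forall>x\<in>carrier G. D x = 0))"

definition flag :: "('a \<Rightarrow> int) list \<Rightarrow> bool" where
  "flag fs \<longleftrightarrow> (\<forall>j<length fs. flag_step (take j fs) (fs ! j))"

lemma flag_step_mono: "\<lbrakk>flag_step fs f; set fs \<subseteq> set gs\<rbrakk> \<Longrightarrow> flag_step gs f"
  unfolding flag_step_def by blast

lemma flag_append:
  assumes "flag fs" "flag gs" shows "flag (fs @ gs)"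
  unfolding flag_def
proof (intro allI impI)
  fix j assume j: "j < length (fs @ gs)"
  show "flag_step (take j (fs @ gs)) ((fs @ gs) ! j)"
  proof (cases "j < length fs")
    case True
    then have "flag_step (take j fs) (fs ! j)" using assms(1) by (simp add: flag_def)
    then show ?thesis using True by (simp add: nth_append)
  next
    case False
    then have "flag_step (take (j - length fs) gs) (gs ! (j - length fs))"
      using assms(2) j by (simp add: flag_def)
    then have "flag_step (take j (fs @ gs)) (gs ! (j - length fs))"
      by (rule flag_step_mono) (use False in auto)
    then show ?thesis using False by (simp add: nth_append)
  qed
qed

lemma flag_concat: "(\<And>fs. fs \<in> set fss \<Longrightarrow> flag fs) \<Longrightarrow> flag (concat fss)"
proof (induction fss)
  case Nil show ?case by (simp add: flag_def)
next
  case (Cons fs fss) then show ?case by (simp add: flag_append)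
qed

lemma flag_snoc:
  assumes "flag fs" "flag_step fs f" shows "flag (fs @ [f])"
  using assms by (auto simp: flag_def nth_append less_Suc_eq)

text \<open>Flags of all letter differences are listed before \<open>f\<close>. Left differences
  lower the degree just as right ones do, so the recursion ends.\<close>

lemma flag_exists:
  "poly_fun (carrier G) d f \<Longrightarrow> \<exists>fs. flag fs \<and> f \<in> set fs \<and> (\<forall>h\<in>set fs. poly_fun (carrier G) d h)"
proof (induction d arbitrary: f)
  case 0
  then have "flag [f]"
    using letters_closed by (auto simp: flag_def flag_step_def rdiff_def ldiff_def)
  then show ?case using 0 by (intro exI [of _ "[f]"]) simp
next
  case (Suc d)
  let ?Q = "\<lambda>g fs. flag fs \<and> g \<in> set fs \<and> (\<forall>h\<in>set fs. poly_fun (carrier G) d h)"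
  have "\<exists>fs. ?Q (rdiff s f) fs" if "s \<in> letters" for s
    using Suc letters_closed [OF that] by simp
  then obtain A where A: "\<And>s. s \<in> letters \<Longrightarrow> ?Q (rdiff s f) (A s)" by metis
  have "\<exists>fs. ?Q (ldiff s f) fs" if "s \<in> letters" for s
    using Suc.IH [of "ldiff s f"] poly_fun_ldiff [OF subgroup_self Suc.prems letters_closed [OF that]] by simp
  then obtain B where B: "\<And>s. s \<in> letters \<Longrightarrow> ?Q (ldiff s f) (B s)" by metis
  obtain ss where ss: "set ss = letters" using finite_letters finite_list by blast
  define fs where "fs = concat (map (\<lambda>s. A s @ B s) ss)"
  have "flag fs" unfolding fs_def
    by (rule flag_concat) (use A B ss in \<open>auto intro: flag_append\<close>)
  then have "flag (fs @ [f])"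
    by (rule flag_snoc) (use A B ss in \<open>fastforce simp: fs_def flag_step_def\<close>)
  moreover have "\<forall>h\<in>set (fs @ [f]). poly_fun (carrier G) (Suc d) h"
    using Suc.prems A B ss by (auto simp: fs_def intro!: poly_fun_Suc [OF subgroup_self] simp del: poly_fun.simps)
  ultimately show ?case by (intro exI [of _ "fs @ [f]"]) simp
qed

theorem separating_flag_exists:
  assumes tf: "torsion_free G" and nil: "nilpotent_group G"
  shows "\<exists>fs e. flag fs \<and> (\<forall>f\<in>set fs. poly_fun (carrier G) e f) \<and>
    (\<forall>g\<in>carrier G. (\<forall>f\<in>set fs. \<forall>x\<in>carrier G. f (x \<otimes> g) = f x) \<longrightarrow> g = \<one>)"
proof -
  obtain L a r where "central_series G L a r" using central_series_exists [OF nil] by blast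
  then interpret central_series G L a r .
  obtain Fs :: "('a \<Rightarrow> rat) list" where Fs: "\<forall>F\<in>set Fs. \<exists>d. poly_fun (carrier G) d F"
    "\<forall>g\<in>carrier G. (\<forall>F\<in>set Fs. \<forall>x\<in>carrier G. F (x \<otimes> g) = F x) \<longrightarrow> g = \<one>"
    using separating_poly_funs [OF tf] by blast
  define P where "P F fs e \<longleftrightarrow> flag fs \<and> (\<forall>f\<in>set fs. poly_fun (carrier G) e f) \<and>
    (\<forall>g\<in>carrier G. (\<forall>f\<in>set fs. \<forall>x\<in>carrier G. f (x \<otimes> g) = f x) \<longrightarrow>
       (\<forall>x\<in>carrier G. F (x \<otimes> g) = F x))" for F :: "'a \<Rightarrow> rat" and fs e
  have "\<exists>fs e. P F fs e" if F: "F \<in> set Fs" for F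
  proof -
    obtain d where d: "poly_fun (carrier G) d F" using Fs F by blast
    then obtain q :: int where q: "q > 0" "\<forall>x\<in>carrier G. of_int q * F x \<in> \<int>"
      using poly_fun_denominator by blast
    define f where "f x = \<lfloor>of_int q * F x\<rfloor>" for x
    have f: "of_int (f x) = of_int q * F x" if "x \<in> carrier G" for x
      using q that by (simp add: f_def)
    have "poly_fun (carrier G) d (\<lambda>x. of_int q * F x)" by (rule poly_fun_scale [OF d])
    then have "poly_fun (carrier G) d (\<lambda>x. of_int (f x) :: rat)"
      by (rule poly_fun_cong [OF subgroup_self, THEN iffD1, rotated]) (simp add: f)
    then have "poly_fun (carrier G) d f" by (rule poly_fun_of_int)
    then obtain fs where fs: "flag fs" "f \<in> set fs" "\<forall>h\<in>set fs. poly_fun (carrier G) d h"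
      using flag_exists by blast
    have "F (x \<otimes> g) = F x" if "g \<in> carrier G" "x \<in> carrier G" "f (x \<otimes> g) = f x" for g x
    proof -
      have "of_int q * F (x \<otimes> g) = of_int q * F x"
        using f [of x] f [of "x \<otimes> g"] that by (metis m_closed)
      then show ?thesis using q(1) by simp
    qed
    then have "P F fs d" unfolding P_def using fs by blast
    then show ?thesis by blast
  qed
  then obtain fs e where fsP: "\<And>F. F \<in> set Fs \<Longrightarrow> P F (fs F) (e F)" by metis
  have fs: "\<And>F. F \<in> set Fs \<Longrightarrow> flag (fs F)"
    "\<And>F f. \<lbrakk>F \<in> set Fs; f \<in> set (fs F)\<rbrakk> \<Longrightarrow> poly_fun (carrier G) (e F) f"
    "\<And>F g x. \<lbrakk>F \<in> set Fs; g \<in> carrier G; \<forall>f\<in>set (fs F). \<forall>x\<in>carrier G. f (x \<otimes> g) = f x; x \<in> carrier G\<rbrakk>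
      \<Longrightarrow> F (x \<otimes> g) = F x"
    using fsP unfolding P_def by blast+
  define E where "E = (\<Sum>F\<in>set Fs. e F)"
  have "poly_fun (carrier G) E f" if "F \<in> set Fs" "f \<in> set (fs F)" for F f
  proof (rule poly_fun_mono [OF subgroup_self])
    show "poly_fun (carrier G) (e F) f" using fs that by blast
    show "e F \<le> E" unfolding E_def by (rule member_le_sum) (use that in auto)
  qed
  moreover have "flag (concat (map fs Fs))" by (rule flag_concat) (use fs in auto)
  moreover have "g = \<one>"
    if "g \<in> carrier G" "\<forall>f\<in>set (concat (map fs Fs)). \<forall>x\<in>carrier G. f (x \<otimes> g) = f x" for g
  proof -
    have "F (x \<otimes> g) = F x" if "F \<in> set Fs" "x \<in> carrier G" for F x
      using fs(3) [OF that(1)] that \<open>g \<in> carrier G\<close>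
        \<open>\<forall>f\<in>set (concat (map fs Fs)). \<forall>x\<in>carrier G. f (x \<otimes> g) = f x\<close> by auto
    then show ?thesis using Fs(2) \<open>g \<in> carrier G\<close> by blast
  qed
  ultimately show ?thesis
    by (intro exI [of _ "concat (map fs Fs)"] exI [of _ E]) auto
qed

end

section \<open>The filtration of a separating flag\<close>

context group
begin

lemma newton_forward:
  fixes f :: "'a \<Rightarrow> int"
  assumes "x \<in> carrier G" "g \<in> carrier G"
  shows "f (x \<otimes> g [^] (n::nat)) = (\<Sum>i\<le>n. int (n choose i) * (rdiff g ^^ i) f x)"
proof (induction n arbitrary: f)
  case (Suc n)
  let ?c = "\<lambda>i. (rdiff g ^^ i) f x"
  have "f (x \<otimes> g [^] Suc n) = f (x \<otimes> g [^] n) + rdiff g f (x \<otimes> g [^] n)"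
    using assms by (simp add: rdiff_def m_assoc)
  also have "\<dots> = (\<Sum>i\<le>n. int (n choose i) * ?c i) + (\<Sum>i\<le>n. int (n choose i) * ?c (Suc i))"
    by (simp only: Suc funpow_Suc_right comp_def)
  also have "(\<Sum>i\<le>n. int (n choose i) * ?c i) = (\<Sum>i\<le>Suc n. int (n choose i) * ?c i)"
    by simp
  also have "\<dots> = ?c 0 + (\<Sum>i\<le>n. int (n choose Suc i) * ?c (Suc i))"
    by (subst sum.atMost_Suc_shift) simp
  also have "\<dots> + (\<Sum>i\<le>n. int (n choose i) * ?c (Suc i))
      = ?c 0 + (\<Sum>i\<le>n. int (Suc n choose Suc i) * ?c (Suc i))"
    by (simp add: distrib_right sum.distrib)
  also have "\<dots> = (\<Sum>i\<le>Suc n. int (Suc n choose i) * ?c i)"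
    by (subst sum.atMost_Suc_shift) (simp del: binomial_Suc_Suc)
  finally show ?case .
qed (use assms in simp)

lemma rdiff_iter_vanish:
  assumes "poly_fun (carrier G) d f" "g \<in> carrier G" "d \<le> i" "x \<in> carrier G"
  shows "(rdiff g ^^ i) f x = 0"
proof -
  have *: "poly_fun (carrier G) (d - i) ((rdiff g ^^ i) f)" for i
  proof (induction i)
    case (Suc i)
    show ?case
    proof (cases "d - i")
      case 0
      then show ?thesis using Suc assms(2) by (simp add: rdiff_def)
    next
      case (Suc l)
      then have "d - Suc i = l" by simp
      then show ?thesis using Suc.IH Suc assms(2) by simp
    qed
  qed (use assms in simp)
  show ?thesis using * [of i] assms by simp
qed

text \<open>Absorption gives \<open>i * (n choose i) = n * ((n - 1) choose (i - 1))\<close>; the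
  factor \<open>fact d\<close> of \<open>n\<close> cancels \<open>i\<close> and leaves
  \<open>m\<close>.\<close>

lemma dvd_binomial:
  assumes "m * fact d dvd n" "0 < i" "i \<le> d"
  shows "m dvd (n choose i)"
proof -
  obtain t where t: "n = m * fact d * t" using assms(1) by (auto simp: dvd_def)
  have "i dvd fact d" using assms by (intro dvd_fact) auto
  then obtain u where u: "fact d = i * u" by (auto simp: dvd_def)
  have "i * (n choose i) = n * ((n - 1) choose (i - 1))"
    using binomial_absorption [of "i - 1" n] assms by simp
  then have "i * (n choose i) = i * (m * (u * t * ((n - 1) choose (i - 1))))"
    by (simp add: t u algebra_simps)
  then have "n choose i = m * (u * t * ((n - 1) choose (i - 1)))" using assms by simp
  then show ?thesis by simp
qed

text \<open>In the Newton expansion along a generating power, the binomials with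
  \<open>0 < i \<le> d\<close> are divisible by \<open>m\<close> and the later differences vanish.
  The elements preserving \<open>f\<close> modulo \<open>m\<close> form a subgroup.\<close>

lemma poly_fun_power_subgroup:
  fixes f :: "'a \<Rightarrow> int"
  assumes f: "poly_fun (carrier G) d f" and g: "g \<in> power_subgroup (m * fact d)"
    and x: "x \<in> carrier G"
  shows "int m dvd f (x \<otimes> g) - f x"
proof -
  let ?n = "m * fact d"
  have pow: "int m dvd f (y \<otimes> h [^] ?n) - f y" if "h \<in> carrier G" "y \<in> carrier G" for h y
  proof -
    have "f (y \<otimes> h [^] ?n) - f y = (\<Sum>i\<in>{..?n} - {0}. int (?n choose i) * (rdiff h ^^ i) f y)"
      unfolding newton_forward [OF that(2,1)] by (subst sum.remove [of _ 0]) auto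
    also have "int m dvd \<dots>"
    proof (rule dvd_sum)
      fix i assume i: "i \<in> {..?n} - {0}"
      show "int m dvd int (?n choose i) * (rdiff h ^^ i) f y"
      proof (cases "i \<le> d")
        case True
        then show ?thesis using dvd_binomial [of m d ?n i] i by simp
      next
        case False
        then show ?thesis using rdiff_iter_vanish [OF f that(1) _ that(2), of i] by simp
      qed
    qed
    finally show ?thesis .
  qed
  let ?T = "{g [^] ?n | g. g \<in> carrier G}"
  have "g \<in> carrier G \<and> (\<forall>y\<in>carrier G. int m dvd f (y \<otimes> g) - f y)"
    using g unfolding power_subgroup_def
  proof (induction rule: generate.induct)
    case (incl h) then show ?case using pow by auto
  next
    case (inv h)
    then obtain k where k: "h = k [^] ?n" "k \<in> carrier G" by auto
    have "int m dvd f (y \<otimes> inv h) - f y" if y: "y \<in> carrier G" for y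
    proof -
      have "int m dvd f ((y \<otimes> inv h) \<otimes> h) - f (y \<otimes> inv h)"
        using pow [OF k(2), of "y \<otimes> inv h"] k y by simp
      then have "int m dvd f y - f (y \<otimes> inv h)" using k y by (simp add: m_assoc)
      then show ?thesis by (simp add: dvd_diff_commute)
    qed
    then show ?case using k by simp
  next
    case (eng g h)
    have "int m dvd f (y \<otimes> (g \<otimes> h)) - f y" if y: "y \<in> carrier G" for y
    proof -
      have "int m dvd (f ((y \<otimes> g) \<otimes> h) - f (y \<otimes> g)) + (f (y \<otimes> g) - f y)"
        using eng y by (intro dvd_add) auto
      then show ?thesis using eng y by (simp add: m_assoc)
    qed
    then show ?case using eng by simp
  qed simp
  then show ?thesis using x by blast
qed

end

context fg_group
begin

text \<open>Telescoping along a word sums one letter difference per letter. The \<open>+ 1\<close>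
  leaves room for the value at \<open>\<one>\<close>, whose length is \<open>0\<close>.\<close>

lemma poly_fun_growth:
  fixes f :: "'a \<Rightarrow> int"
  assumes "poly_fun (carrier G) d f"
  shows "\<exists>C::nat. \<forall>g\<in>carrier G. \<bar>f g\<bar> \<le> int (C * (wl g + 1) ^ d)"
proof -
  have "\<exists>C::nat. \<forall>ws. set ws \<subseteq> letters \<longrightarrow> \<bar>f (wprod ws)\<bar> \<le> int (C * (length ws + 1) ^ d)"
    using assms
  proof (induction d arbitrary: f)
    case 0 then show ?case by (intro exI [of _ 0]) (simp add: wprod_closed)
  next
    case (Suc d)
    have "\<forall>s\<in>letters. \<exists>C::nat. \<forall>ws. set ws \<subseteq> letters \<longrightarrow>
        \<bar>rdiff s f (wprod ws)\<bar> \<le> int (C * (length ws + 1) ^ d)"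
      using Suc.IH Suc.prems letters_closed by simp
    then obtain C where C: "\<And>s ws. \<lbrakk>s \<in> letters; set ws \<subseteq> letters\<rbrakk> \<Longrightarrow>
        \<bar>rdiff s f (wprod ws)\<bar> \<le> int (C s * (length ws + 1) ^ d)"
      by metis
    define D where "D = sum C letters"
    have D: "\<bar>rdiff s f (wprod ws)\<bar> \<le> int (D * (length ws + 1) ^ d)"
      if "s \<in> letters" "set ws \<subseteq> letters" for s ws
    proof -
      have "C s \<le> D" unfolding D_def by (rule member_le_sum) (use that finite_letters in auto)
      then have "int (C s * (length ws + 1) ^ d) \<le> int (D * (length ws + 1) ^ d)"
        by (simp only: of_nat_le_iff mult_right_mono)
      then show ?thesis using C [OF that] by linarith
    qed
    have "\<bar>f (wprod ws)\<bar> \<le> \<bar>f \<one>\<bar> + int (length ws * (D * (length ws + 1) ^ d))"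
      if "set ws \<subseteq> letters" for ws
      using that
    proof (induction ws rule: rev_induct)
      case (snoc s ws)
      let ?l = "length ws"
      have "wprod (ws @ [s]) = wprod ws \<otimes> s"
        using snoc wprod_append [of ws "[s]"] by (simp add: letters_closed)
      then have "f (wprod (ws @ [s])) = f (wprod ws) + rdiff s f (wprod ws)"
        by (simp add: rdiff_def del: foldr_append)
      then have "\<bar>f (wprod (ws @ [s]))\<bar> \<le> \<bar>f \<one>\<bar> + int (?l * (D * (?l + 1) ^ d)) + int (D * (?l + 1) ^ d)"
        using snoc D [of s ws] by (simp del: foldr_append of_nat_mult of_nat_add of_nat_power)
      also have "\<dots> = \<bar>f \<one>\<bar> + int ((?l + 1) * (D * (?l + 1) ^ d))" by (simp add: algebra_simps)
      also have "\<dots> \<le> \<bar>f \<one>\<bar> + int ((?l + 1) * (D * (?l + 1 + 1) ^ d))"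
        by (simp only: add_le_cancel_left of_nat_le_iff) (intro mult_left_mono power_mono; simp)
      finally show ?case by simp
    qed simp
    note bound = this
    have "\<bar>f (wprod ws)\<bar> \<le> int ((nat \<bar>f \<one>\<bar> + D) * (length ws + 1) ^ Suc d)" if "set ws \<subseteq> letters" for ws
    proof -
      let ?l = "length ws"
      have "nat \<bar>f \<one>\<bar> + ?l * (D * (?l + 1) ^ d)
          \<le> nat \<bar>f \<one>\<bar> * (?l + 1) ^ Suc d + (?l + 1) * (D * (?l + 1) ^ d)"
      proof (rule add_mono)
        have "nat \<bar>f \<one>\<bar> * 1 \<le> nat \<bar>f \<one>\<bar> * (?l + 1) ^ Suc d"
          by (rule mult_left_mono) (rule one_le_power, simp_all)
        then show "nat \<bar>f \<one>\<bar> \<le> nat \<bar>f \<one>\<bar> * (?l + 1) ^ Suc d" by simp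
      qed simp
      also have "\<dots> = (nat \<bar>f \<one>\<bar> + D) * (?l + 1) ^ Suc d" by (simp add: algebra_simps)
      finally have "int (nat \<bar>f \<one>\<bar> + ?l * (D * (?l + 1) ^ d)) \<le> int ((nat \<bar>f \<one>\<bar> + D) * (?l + 1) ^ Suc d)"
        by (simp only: of_nat_le_iff)
      moreover have "int (nat \<bar>f \<one>\<bar> + ?l * (D * (?l + 1) ^ d)) = \<bar>f \<one>\<bar> + int (?l * (D * (?l + 1) ^ d))"
        by simp
      ultimately show ?thesis using bound [OF that] by linarith
    qed
    then show ?case by blast
  qed
  then show ?thesis using wl_word by metis
qed

end

section \<open>Stabilizers \<open>K j\<close> and the homomorphisms \<open>delta j\<close>\<close>

locale separating_flag = fg_group +
  fixes fs :: "('a \<Rightarrow> int) list" and e :: nat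
  assumes fs_flag: "flag fs"
    and fs_poly: "f \<in> set fs \<Longrightarrow> poly_fun (carrier G) e f"
    and fs_sep: "\<lbrakk>g \<in> carrier G; \<And>f x. \<lbrakk>f \<in> set fs; x \<in> carrier G\<rbrakk> \<Longrightarrow> f (x \<otimes> g) = f x\<rbrakk> \<Longrightarrow> g = \<one>"
begin

abbreviation R :: nat where "R \<equiv> length fs"

definition K :: "nat \<Rightarrow> 'a set" where
  "K j = {g \<in> carrier G. \<forall>i<j. \<forall>x\<in>carrier G. (fs ! i) (x \<otimes> g) = (fs ! i) x}"

definition delta :: "nat \<Rightarrow> 'a \<Rightarrow> int" where "delta j k = (fs ! j) k - (fs ! j) \<one>"

lemma K_carrier: "k \<in> K j \<Longrightarrow> k \<in> carrier G"
  by (simp add: K_def)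

lemma K_subgroup: "subgroup (K j) G"
proof
  fix k assume k: "k \<in> K j"
  have "(fs ! i) (x \<otimes> inv k) = (fs ! i) x" if "i < j" "x \<in> carrier G" for i x
  proof -
    have "(fs ! i) ((x \<otimes> inv k) \<otimes> k) = (fs ! i) (x \<otimes> inv k)"
      using k that unfolding K_def by blast
    then show ?thesis using k that by (simp add: K_def m_assoc)
  qed
  then show "inv k \<in> K j" using k by (simp add: K_def)
qed (auto simp: K_def m_assoc [symmetric])

lemma K_0: "K 0 = carrier G"
  by (simp add: K_def)

lemma K_R: "K R = {\<one>}"
proof -
  have "g = \<one>" if "g \<in> K R" for g
    by (rule fs_sep) (use that in \<open>auto simp: K_def in_set_conv_nth\<close>)
  moreover have "\<one> \<in> K R" by (rule subgroup.one_closed [OF K_subgroup])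
  ultimately show ?thesis by blast
qed

lemma K_Suc_subset: "K (Suc j) \<subseteq> K j"
  by (auto simp: K_def)

lemma flag_diff_invariant:
  assumes "j < R" "s \<in> letters" "D \<in> {rdiff s (fs ! j), ldiff s (fs ! j)}" "k \<in> K j" "x \<in> carrier G"
  shows "D (x \<otimes> k) = D x"
proof -
  have k: "k \<in> carrier G" using assms K_carrier by blast
  have "flag_step (take j fs) (fs ! j)" using fs_flag assms(1) by (simp add: flag_def)
  then consider h where "h \<in> set (take j fs)" "\<forall>x\<in>carrier G. D x = h x" | "\<forall>x\<in>carrier G. D x = 0"
    using assms(2,3) unfolding flag_step_def by blast
  then show ?thesis
  proof cases
    case 1
    then obtain i where "i < j" "h = fs ! i" by (auto simp: in_set_conv_nth)
    then have "h (x \<otimes> k) = h x" using assms unfolding K_def by blast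
    then show ?thesis using 1 k assms by simp
  next
    case 2 then show ?thesis using k assms by simp
  qed
qed

text \<open>For a letter \<open>s\<close> the conjugate of \<open>k\<close> lies in
  \<open>K j\<close> by induction, so \<open>rdiff s (fs ! j)\<close> does not see it. Multiplying
  by \<open>s\<close> on the right therefore turns invariance of \<open>fs ! j\<close> under the
  conjugate into invariance under \<open>k\<close>.\<close>

lemma K_normal: "j \<le> R \<Longrightarrow> K j \<lhd> G"
proof (rule normalI_conj [OF K_subgroup])
  have letter: "s \<otimes> k \<otimes> inv s \<in> K j" if "j \<le> R" "s \<in> letters" "k \<in> K j" for s k j
    using that
  proof (induction j)
    case 0 then show ?case by (simp add: K_0 letters_closed)
  next
    case (Suc j)
    have s: "s \<in> carrier G" and k: "k \<in> carrier G" using Suc letters_closed K_carrier by auto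
    let ?k = "s \<otimes> k \<otimes> inv s"
    have kj: "?k \<in> K j" using Suc K_Suc_subset by auto
    have "(fs ! j) (x \<otimes> ?k) = (fs ! j) x" if x: "x \<in> carrier G" for x
    proof -
      have "rdiff s (fs ! j) (x \<otimes> ?k) = rdiff s (fs ! j) x"
        using flag_diff_invariant [of j s _ ?k x] kj x Suc by simp
      moreover have "x \<otimes> ?k \<otimes> s = (x \<otimes> s) \<otimes> k" using x s k by (simp add: group_word_simps)
      moreover have "(fs ! j) ((x \<otimes> s) \<otimes> k) = (fs ! j) (x \<otimes> s)"
        using Suc.prems x s unfolding K_def by blast
      ultimately show ?thesis by (simp add: rdiff_def)
    qed
    then show ?case using kj s k by (auto simp: K_def less_Suc_eq)
  qed
  fix g k assume j: "j \<le> R" and g: "g \<in> carrier G" and k: "k \<in> K j"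
  have kc: "k \<in> carrier G" using k K_carrier by blast
  from g show "g \<otimes> k \<otimes> inv g \<in> K j"
  proof (induction rule: carrier_left_induct)
    case one then show ?case using k kc by simp
  next
    case (step g s)
    have "(s \<otimes> g) \<otimes> k \<otimes> inv (s \<otimes> g) = s \<otimes> (g \<otimes> k \<otimes> inv g) \<otimes> inv s"
      using step kc by (simp add: group_word_simps letters_closed)
    then show ?case using letter [OF j] step by simp
  qed
qed

lemma K_rdiff:
  assumes "j < R" "h \<in> carrier G" "k \<in> K j" "x \<in> carrier G"
  shows "rdiff h (fs ! j) (x \<otimes> k) = rdiff h (fs ! j) x"
  using assms(2,3)
proof (induction arbitrary: k rule: carrier_right_induct)
  case one
  then show ?case using assms(4) K_carrier by (simp add: rdiff_def)
next
  case (step h s)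
  have k: "k \<in> carrier G" and s: "s \<in> carrier G" using step K_carrier letters_closed by auto
  have sum: "rdiff (h \<otimes> s) (fs ! j) y = rdiff s (fs ! j) (y \<otimes> h) + rdiff h (fs ! j) y"
    if "y \<in> carrier G" for y
    using that step s by (simp add: rdiff_def m_assoc)
  have "x \<otimes> k \<otimes> h = (x \<otimes> h) \<otimes> (inv h \<otimes> k \<otimes> h)"
    using assms(4) k step by (simp add: group_word_simps)
  moreover have "inv h \<otimes> k \<otimes> h \<in> K j"
    by (rule normal_conj_inv [OF K_normal]) (use assms step in auto)
  ultimately have "rdiff s (fs ! j) (x \<otimes> k \<otimes> h) = rdiff s (fs ! j) (x \<otimes> h)"
    using flag_diff_invariant [of j s _ "inv h \<otimes> k \<otimes> h" "x \<otimes> h"] assms step by simp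
  then show ?case using sum [of "x \<otimes> k"] sum [of x] step k assms(4) by simp
qed

lemma K_ldiff:
  assumes "j < R" "h \<in> carrier G" "k \<in> K j" "x \<in> carrier G"
  shows "ldiff h (fs ! j) (x \<otimes> k) = ldiff h (fs ! j) x"
  using assms(2)
proof (induction rule: carrier_left_induct)
  case one
  then show ?case using assms K_carrier by (simp add: ldiff_def)
next
  case (step h s)
  have k: "k \<in> carrier G" and s: "s \<in> carrier G" using step assms K_carrier letters_closed by auto
  have "ldiff s (fs ! j) ((h \<otimes> x) \<otimes> k) = ldiff s (fs ! j) (h \<otimes> x)"
    using flag_diff_invariant [of j s _ k "h \<otimes> x"] assms step by simp
  then show ?case using step k s assms(4) by (simp add: ldiff_def m_assoc)
qed

text \<open>The left difference along \<open>h\<close> is invariant under \<open>K j\<close>;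
  comparing it at \<open>k\<close> and \<open>\<one>\<close> shows that \<open>k\<close> adds the
  same amount at every point. Additivity of \<open>delta j\<close> is a special case.\<close>

lemma K_shift:
  assumes "j < R" "h \<in> carrier G" "k \<in> K j"
  shows "(fs ! j) (h \<otimes> k) = (fs ! j) h + delta j k"
  using K_ldiff [OF assms, of \<one>] K_carrier [OF assms(3)] assms(2)
  by (simp add: ldiff_def delta_def)

lemma delta_mult:
  assumes "j < R" "h \<in> K j" "k \<in> K j"
  shows "delta j (h \<otimes> k) = delta j h + delta j k"
  using K_shift [OF assms(1) _ assms(3), of h] K_carrier [OF assms(2)] by (simp add: delta_def)

lemma delta_one [simp]: "delta j \<one> = 0"
  by (simp add: delta_def)

lemma delta_conj:
  assumes "j < R" "h \<in> carrier G" "k \<in> K j"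
  shows "delta j (h \<otimes> k \<otimes> inv h) = delta j k"
proof -
  let ?k = "h \<otimes> k \<otimes> inv h"
  have k: "k \<in> carrier G" using assms K_carrier by blast
  have "?k \<in> K j" by (rule normal_conj [OF K_normal]) (use assms in auto)
  then have "rdiff h (fs ! j) ?k = rdiff h (fs ! j) \<one>"
    using K_rdiff [OF assms(1,2), of ?k \<one>] assms k by simp
  moreover have "?k \<otimes> h = h \<otimes> k" using assms k by (simp add: group_word_simps)
  ultimately show ?thesis
    using K_shift [OF assms] assms(2) by (simp add: rdiff_def delta_def)
qed

lemma K_SucI:
  assumes "j < R" "k \<in> K j" "delta j k = 0" shows "k \<in> K (Suc j)"
  using assms K_shift [OF assms(1) _ assms(2)] unfolding K_def by (auto simp: less_Suc_eq)

lemma delta_K_Suc: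
  assumes "k \<in> K (Suc j)" shows "delta j k = 0"
proof -
  have "(fs ! j) (\<one> \<otimes> k) = (fs ! j) \<one>" using assms unfolding K_def by blast
  then show ?thesis using K_carrier [OF assms] by (simp add: delta_def)
qed

lemma fs_congruence:
  assumes "j < R" "g \<in> power_subgroup (m * fact e)" "x \<in> carrier G"
  shows "int m dvd (fs ! j) (x \<otimes> g) - (fs ! j) x"
  using poly_fun_power_subgroup [OF fs_poly assms(2,3)] assms(1) by simp

lemma delta_bound:
  "\<exists>p. \<forall>j<R. \<forall>g\<in>carrier G. \<forall>B\<ge>2. wl g \<le> B \<longrightarrow> nat \<bar>delta j g\<bar> \<le> B ^ p"
proof -
  have "\<forall>j\<in>{..<R}. \<exists>C::nat. \<forall>g\<in>carrier G. \<bar>(fs ! j) g\<bar> \<le> int (C * (wl g + 1) ^ e)"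
    using poly_fun_growth fs_poly by simp
  then obtain C where C: "\<And>j g. \<lbrakk>j < R; g \<in> carrier G\<rbrakk> \<Longrightarrow> \<bar>(fs ! j) g\<bar> \<le> int (C j * (wl g + 1) ^ e)"
    by (metis lessThan_iff)
  define D where "D = sum C {..<R}"
  \<comment> \<open>The values at \<open>g\<close> and at \<open>\<one>\<close> give the coefficient
    \<open>2 * D\<close>, absorbed by \<open>B ^ (2 * D)\<close>; the other \<open>2 * e\<close>
    comes from \<open>B + 1 \<le> B ^ 2\<close>.\<close>
  have "nat \<bar>delta j g\<bar> \<le> B ^ (2 * D + 2 * e)" if "j < R" "g \<in> carrier G" "2 \<le> B" "wl g \<le> B" for j g B
  proof -
    have "C j \<le> D" unfolding D_def by (rule member_le_sum) (use that in auto)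
    have B: "B + 1 \<le> B ^ 2"
    proof -
      have "B + 1 \<le> 2 * B" using that by simp
      also have "\<dots> \<le> B * B" using that by (intro mult_right_mono) auto
      finally show ?thesis by (simp add: power2_eq_square)
    qed
    have bd: "C j * (wl h + 1) ^ e \<le> D * (B ^ 2) ^ e" if "wl h \<le> B" for h
      using \<open>C j \<le> D\<close> B that by (intro mult_mono power_mono) auto
    have "\<bar>delta j g\<bar> \<le> \<bar>(fs ! j) g\<bar> + \<bar>(fs ! j) \<one>\<bar>" by (simp add: delta_def)
    also have "\<dots> \<le> int (C j * (wl g + 1) ^ e) + int (C j * (wl \<one> + 1) ^ e)"
      using that by (intro add_mono C) auto
    also have "\<dots> \<le> int (D * (B ^ 2) ^ e) + int (D * (B ^ 2) ^ e)"
      by (intro add_mono) (simp_all only: of_nat_le_iff, (intro bd, use that in simp)+)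
    also have "\<dots> = int (2 * D * B ^ (2 * e))" by (simp add: power_mult)
    finally have "\<bar>delta j g\<bar> \<le> int (2 * D * B ^ (2 * e))" by simp
    then have "nat \<bar>delta j g\<bar> \<le> 2 * D * B ^ (2 * e)" by (simp only: nat_le_iff)
    also have "\<dots> \<le> B ^ (2 * D) * B ^ (2 * e)"
    proof (rule mult_right_mono)
      have "2 * D \<le> 2 ^ (2 * D)" by (rule less_imp_le [OF less_exp])
      also have "\<dots> \<le> B ^ (2 * D)" using that by (intro power_mono) auto
      finally show "2 * D \<le> B ^ (2 * D)" .
    qed simp
    finally show ?thesis by (simp add: power_add)
  qed
  then show ?thesis by blast
qed

end

section \<open>Generators of kernels\<close>

text \<open>Reduce one coefficient modulo \<open>b\<close> and let the other compensate; solving for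
  it then bounds it too.\<close>

lemma bezout_bounded:
  fixes a b :: int
  assumes "b \<noteq> 0"
  shows "\<exists>x y. x * a + y * b = gcd a b \<and> \<bar>x\<bar> \<le> \<bar>b\<bar> \<and> \<bar>y\<bar> \<le> \<bar>a\<bar> + 1"
proof -
  obtain u v where uv: "u * a + v * b = gcd a b" using bezout_int by blast
  define x where "x = u mod b"
  define y where "y = v + (u div b) * a"
  have "x * a + y * b = (u mod b + b * (u div b)) * a + v * b"
    unfolding x_def y_def distrib_right by (simp add: mult.commute mult.left_commute)
  then have xy: "x * a + y * b = gcd a b" using uv by (simp only: mod_mult_div_eq)
  have x: "\<bar>x\<bar> \<le> \<bar>b\<bar>" using abs_mod_less [OF assms, of u] by (simp add: x_def)
  have "\<bar>gcd a b\<bar> \<le> \<bar>b\<bar>" by (rule dvd_imp_le_int [OF assms gcd_dvd2])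
  have "\<bar>y\<bar> * \<bar>b\<bar> = \<bar>gcd a b - x * a\<bar>" using xy by (simp flip: abs_mult add: algebra_simps)
  also have "\<dots> \<le> \<bar>gcd a b\<bar> + \<bar>x\<bar> * \<bar>a\<bar>" by (metis abs_mult abs_triangle_ineq4)
  also have "\<dots> \<le> \<bar>b\<bar> + \<bar>b\<bar> * \<bar>a\<bar>"
    by (intro add_mono mult_right_mono x) (use \<open>\<bar>gcd a b\<bar> \<le> \<bar>b\<bar>\<close> in auto)
  finally have "\<bar>y\<bar> * \<bar>b\<bar> \<le> (\<bar>a\<bar> + 1) * \<bar>b\<bar>" by (simp add: algebra_simps)
  then have "\<bar>y\<bar> \<le> \<bar>a\<bar> + 1" using assms by simp
  then show ?thesis using xy x by blast
qed

context group
begin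

lemma generate_conj_closed:
  assumes T: "T \<subseteq> carrier G" and g: "g \<in> carrier G"
    and conj: "\<And>v. v \<in> T \<Longrightarrow> g \<otimes> v \<otimes> inv g \<in> generate G T"
    and v: "v \<in> generate G T"
  shows "g \<otimes> v \<otimes> inv g \<in> generate G T"
proof -
  have V: "subgroup (generate G T) G" by (rule generate_is_subgroup [OF T])
  interpret V: subgroup "generate G T" G by (rule V)
  from v show ?thesis
  proof (induction rule: generate.induct)
    case one then show ?case using g by simp
  next
    case (incl h) then show ?case by (rule conj)
  next
    case (inv h)
    then have h: "h \<in> carrier G" using T by auto
    have "inv (g \<otimes> h \<otimes> inv g) \<in> generate G T" using conj [OF inv] by (rule V.m_inv_closed)
    then show ?case using h g by (simp add: group_word_simps)
  next
    case (eng h k)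
    then have hk: "h \<in> carrier G" "k \<in> carrier G" using V.mem_carrier by auto
    have "g \<otimes> (h \<otimes> k) \<otimes> inv g = (g \<otimes> h \<otimes> inv g) \<otimes> (g \<otimes> k \<otimes> inv g)"
      using hk g by (simp add: group_word_simps)
    then show ?case using V.m_closed [OF eng.IH] by simp
  qed
qed

lemma int_pow_conj_closed:
  assumes V: "V \<subseteq> carrier G" and g: "g \<in> carrier G"
    and conj: "\<And>v. v \<in> V \<Longrightarrow> g \<otimes> v \<otimes> inv g \<in> V" "\<And>v. v \<in> V \<Longrightarrow> inv g \<otimes> v \<otimes> g \<in> V"
    and v: "v \<in> V"
  shows "g [^] (k::int) \<otimes> v \<otimes> inv (g [^] k) \<in> V"
proof -
  have gen: "h [^] n \<otimes> v \<otimes> inv (h [^] n) \<in> V"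
    if h: "h \<in> carrier G" "\<And>v. v \<in> V \<Longrightarrow> h \<otimes> v \<otimes> inv h \<in> V" for h and n :: nat
  proof (induction n)
    case 0 then show ?case using v V by auto
  next
    case (Suc n)
    have "h [^] Suc n \<otimes> v \<otimes> inv (h [^] Suc n) = h \<otimes> (h [^] n \<otimes> v \<otimes> inv (h [^] n)) \<otimes> inv h"
    proof -
      have "h [^] Suc n = h \<otimes> h [^] n" using h by (metis nat_pow_Suc2)
      then show ?thesis using h v V by (auto simp: group_word_simps)
    qed
    then show ?case using h(2) [OF Suc] by simp
  qed
  show ?thesis
  proof (cases k rule: int_cases2)
    case (nonneg n) then show ?thesis using gen [of g n] g conj by (simp add: int_pow_int)
  next
    case (nonpos n)
    have "inv g [^] n \<otimes> v \<otimes> inv (inv g [^] n) \<in> V" by (rule gen) (use g conj in auto)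
    then show ?thesis using g nonpos by (simp add: int_pow_neg int_pow_int nat_pow_inv)
  qed
qed

lemma hom_on_int_pow:
  fixes \<epsilon> :: "'a \<Rightarrow> int"
  assumes H: "subgroup H G" and hom: "\<And>g h. \<lbrakk>g \<in> H; h \<in> H\<rbrakk> \<Longrightarrow> \<epsilon> (g \<otimes> h) = \<epsilon> g + \<epsilon> h"
    and g: "g \<in> H"
  shows "\<epsilon> (g [^] (k::int)) = k * \<epsilon> g"
proof -
  interpret H: subgroup H G by (rule H)
  have one: "\<epsilon> \<one> = 0" using hom [of \<one> \<one>] by simp
  have pow_in: "g [^] (n::nat) \<in> H" for n using subgroup_int_pow [OF H g, of "int n"] by (simp add: int_pow_int)
  have nat: "\<epsilon> (g [^] n) = int n * \<epsilon> g" for n :: nat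
  proof (induction n)
    case (Suc n) then show ?case using hom [OF pow_in g] by (simp add: algebra_simps)
  qed (simp add: one)
  have "\<epsilon> (inv h) = - \<epsilon> h" if "h \<in> H" for h
    using hom [of h "inv h"] that one by simp
  then show ?thesis using nat pow_in g
    by (cases k rule: int_cases2) (simp_all add: int_pow_int int_pow_neg)
qed

end

context fg_group
begin

text \<open>Bezout is realized by products of powers, one list entry at a time. Each entry
  multiplies the length bound by at most \<open>2 * E + 2\<close>, hence the exponent
  \<open>length us\<close>.\<close>

lemma gcd_element:
  fixes \<epsilon> :: "'a \<Rightarrow> int"
  assumes H: "subgroup H G" and hom: "\<And>g h. \<lbrakk>g \<in> H; h \<in> H\<rbrakk> \<Longrightarrow> \<epsilon> (g \<otimes> h) = \<epsilon> g + \<epsilon> h"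
    and us: "set us \<subseteq> H" "\<And>u. u \<in> set us \<Longrightarrow> \<bar>\<epsilon> u\<bar> \<le> int E" "\<And>u. u \<in> set us \<Longrightarrow> wl u \<le> B"
  shows "\<exists>t\<in>H. (\<forall>u\<in>set us. \<epsilon> t dvd \<epsilon> u) \<and> \<bar>\<epsilon> t\<bar> \<le> int E \<and> wl t \<le> B * (2 * E + 2) ^ length us"
  using us
proof (induction us)
  case Nil
  have "\<epsilon> \<one> = 0" using hom [of \<one> \<one>] subgroup.one_closed [OF H] by simp
  then show ?case using subgroup.one_closed [OF H] by (intro bexI [of _ \<one>]) auto
next
  case (Cons u us)
  interpret H: subgroup H G by (rule H)
  let ?F = "2 * E + 2" and ?s = "length us"
  obtain t where t: "t \<in> H" "\<forall>u\<in>set us. \<epsilon> t dvd \<epsilon> u" "\<bar>\<epsilon> t\<bar> \<le> int E" "wl t \<le> B * ?F ^ ?s"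
    using Cons by auto
  have u: "u \<in> H" "\<bar>\<epsilon> u\<bar> \<le> int E" "wl u \<le> B" using Cons.prems by auto
  have F1: "1 \<le> ?F ^ ?s" by (rule one_le_power) simp
  show ?case
  proof (cases "\<epsilon> t = 0")
    case True
    have "B * 1 \<le> B * ?F ^ length (u # us)" by (intro mult_left_mono one_le_power) auto
    then have "wl u \<le> B * ?F ^ length (u # us)" using u by linarith
    then show ?thesis using True t u by (intro bexI [of _ u] conjI ballI) auto
  next
    case False
    obtain x y where xy: "x * \<epsilon> u + y * \<epsilon> t = gcd (\<epsilon> u) (\<epsilon> t)" "\<bar>x\<bar> \<le> \<bar>\<epsilon> t\<bar>" "\<bar>y\<bar> \<le> \<bar>\<epsilon> u\<bar> + 1"
      using bezout_bounded [OF False] by blast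
    define v where "v = u [^] x \<otimes> t [^] y"
    have ux: "u [^] x \<in> H" and ty: "t [^] y \<in> H" using u t by (auto intro: subgroup_int_pow [OF H])
    have \<epsilon>v: "\<epsilon> v = gcd (\<epsilon> u) (\<epsilon> t)"
      unfolding v_def using hom [OF ux ty] hom_on_int_pow [OF H hom u(1)] hom_on_int_pow [OF H hom t(1)] xy by simp
    have "wl v \<le> wl (u [^] x) + wl (t [^] y)" unfolding v_def using ux ty by (intro wl_mult) auto
    also have "\<dots> \<le> nat \<bar>x\<bar> * wl u + nat \<bar>y\<bar> * wl t"
      using u t by (intro add_mono wl_int_pow) auto
    also have "\<dots> \<le> E * B + (E + 1) * (B * ?F ^ ?s)"
      using xy u t by (intro add_mono mult_mono) auto
    also have "\<dots> \<le> (E + 1) * (B * ?F ^ ?s) + (E + 1) * (B * ?F ^ ?s)"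
    proof (rule add_right_mono)
      have "E * (B * 1) \<le> (E + 1) * (B * ?F ^ ?s)" using F1 by (intro mult_mono) auto
      then show "E * B \<le> (E + 1) * (B * ?F ^ ?s)" by simp
    qed
    also have "\<dots> = B * ?F ^ length (u # us)" by (simp add: algebra_simps)
    finally have wlv: "wl v \<le> B * ?F ^ length (u # us)" .
    have "\<bar>\<epsilon> v\<bar> \<le> \<bar>\<epsilon> t\<bar>" unfolding \<epsilon>v by (rule dvd_imp_le_int [OF False gcd_dvd2])
    then have "\<bar>\<epsilon> v\<bar> \<le> int E" using t by simp
    moreover have "\<epsilon> v dvd \<epsilon> w" if "w \<in> set (u # us)" for w
    proof (cases "w = u")
      case True then show ?thesis by (simp add: \<epsilon>v)
    next
      case False
      then have "\<epsilon> t dvd \<epsilon> w" using t that by simp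
      then show ?thesis unfolding \<epsilon>v by (rule dvd_trans [OF gcd_dvd2])
    qed
    moreover have "v \<in> H" unfolding v_def using ux ty by simp
    ultimately show ?thesis using wlv by blast
  qed
qed

primrec engel :: "'a \<Rightarrow> nat \<Rightarrow> 'a \<Rightarrow> 'a" where
  "engel t 0 v = v"
| "engel t (Suc k) v = commutator t (engel t k v)"

lemma engel_closed: "\<lbrakk>t \<in> carrier G; v \<in> carrier G\<rbrakk> \<Longrightarrow> engel t k v \<in> carrier G"
  by (induction k) auto

lemma engel_lower_central:
  "\<lbrakk>t \<in> carrier G; v \<in> carrier G\<rbrakk> \<Longrightarrow> engel t k v \<in> lower_central G k"
  by (induction k) (auto simp: commutator_def intro!: generate.incl)

lemma wl_commutator:
  assumes "g \<in> carrier G" "h \<in> carrier G"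
  shows "wl (commutator g h) \<le> 2 * wl g + 2 * wl h"
proof -
  have "wl (commutator g h) \<le> wl (g \<otimes> h) + wl (inv g) + wl (inv h)"
    unfolding commutator_def using assms
    by (intro order_trans [OF wl_mult] add_right_mono wl_mult) auto
  then show ?thesis using wl_mult [OF assms] assms by (simp add: wl_inv)
qed

lemma wl_engel:
  assumes "t \<in> carrier G" "v \<in> carrier G" "wl t \<le> M" "wl v \<le> M"
  shows "wl (engel t k v) \<le> 4 ^ k * M"
proof (induction k)
  case (Suc k)
  have "wl (engel t (Suc k) v) \<le> 2 * wl t + 2 * wl (engel t k v)"
    using assms engel_closed by (simp add: wl_commutator)
  also have "\<dots> \<le> 2 * (4 ^ k * M) + 2 * (4 ^ k * M)"
  proof (intro add_mono mult_left_mono)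
    have "1 * M \<le> 4 ^ k * M" by (intro mult_right_mono one_le_power) simp_all
    then show "wl t \<le> 4 ^ k * M" using assms by linarith
  qed (use Suc in simp_all)
  finally show ?case by (simp add: mult.commute mult.left_commute)
qed (use assms in simp)

text \<open>The kernel is generated by iterated commutators of \<open>t\<close> with the elements \<open>u t\<^bsup>-q\<^esup>\<close>, because
  the subgroup they generate is normalized by \<open>t\<close>.\<close>

lemma kernel_generators:
  fixes \<epsilon> :: "'a \<Rightarrow> int"
  assumes us: "set us \<subseteq> carrier G"
    and hom: "\<And>g h. \<lbrakk>g \<in> generate G (set us); h \<in> generate G (set us)\<rbrakk> \<Longrightarrow> \<epsilon> (g \<otimes> h) = \<epsilon> g + \<epsilon> h"
    and t: "t \<in> generate G (set us)" and dvd: "\<And>u. u \<in> set us \<Longrightarrow> \<epsilon> t dvd \<epsilon> u"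
    and c: "lower_central G c = {\<one>}"
  defines "V \<equiv> {engel t k (u \<otimes> t [^] (- (\<epsilon> u div \<epsilon> t))) | k u. k \<le> c \<and> u \<in> set us}"
  shows "generate G V = {z \<in> generate G (set us). \<epsilon> z = 0}"
proof -
  let ?H = "generate G (set us)"
  have H: "subgroup ?H G" by (rule generate_is_subgroup [OF us])
  interpret H: subgroup ?H G by (rule H)
  have tc: "t \<in> carrier G" using t by simp
  define v where "v u = u \<otimes> t [^] (- (\<epsilon> u div \<epsilon> t))" for u
  have powH: "t [^] (k::int) \<in> ?H" for k by (rule subgroup_int_pow [OF H t])
  have usH: "u \<in> ?H" if "u \<in> set us" for u using that by (rule generate.incl)
  have \<epsilon>one: "\<epsilon> \<one> = 0" using hom [of \<one> \<one>] by simp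
  have \<epsilon>inv: "\<epsilon> (inv h) = - \<epsilon> h" if "h \<in> ?H" for h
    using hom [of h "inv h"] that \<epsilon>one by simp
  have vH: "v u \<in> ?H \<and> \<epsilon> (v u) = 0" if "u \<in> set us" for u
    unfolding v_def using usH [OF that] powH hom [OF usH [OF that] powH]
      hom_on_int_pow [OF H hom t] dvd [OF that] by simp
  define N where "N = {z \<in> ?H. \<epsilon> z = 0}"
  have N: "subgroup N G"
    by (rule subgroup.intro) (use \<epsilon>one \<epsilon>inv hom in \<open>auto simp: N_def\<close>)
  have engelN: "engel t k (v u) \<in> N" if "u \<in> set us" for k u
  proof (induction k)
    case 0 then show ?case using vH [OF that] by (simp add: N_def)
  next
    case (Suc k)
    let ?w = "engel t k (v u)"
    have w: "?w \<in> ?H" using Suc by (simp add: N_def)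
    have "\<epsilon> (commutator t ?w) = \<epsilon> t + \<epsilon> ?w - \<epsilon> t - \<epsilon> ?w"
      unfolding commutator_def using w t by (simp add: hom \<epsilon>inv)
    moreover have "commutator t ?w \<in> ?H" unfolding commutator_def using w t by simp
    ultimately show ?case by (simp add: N_def)
  qed
  have V: "V = {engel t k (v u) | k u. k \<le> c \<and> u \<in> set us}" by (simp add: V_def v_def)
  have VN: "V \<subseteq> N" using engelN by (auto simp: V)
  have Vc: "V \<subseteq> carrier G" using VN by (auto simp: N_def)
  let ?V = "generate G V"
  interpret V: subgroup ?V G by (rule generate_is_subgroup [OF Vc])
  have engelV: "engel t k (v u) \<in> ?V" if "u \<in> set us" for k u
  proof (cases "k \<le> c")
    case True then show ?thesis using that by (auto simp: V intro: generate.incl)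
  next
    case False
    have vc: "v u \<in> carrier G" using vH [OF that] by simp
    have "engel t (c + i) (v u) = \<one>" for i
    proof (induction i)
      case 0 then show ?case using engel_lower_central [OF tc vc, of c] c by simp
    next
      case (Suc i) then show ?case using tc by (simp add: commutator_def)
    qed
    from this [of "k - c"] show ?thesis using False by simp
  qed
  have engel_car: "engel t k (v u) \<in> carrier G" if "u \<in> set us" for k u
    using engelV [OF that] by simp
  have conj1: "t \<otimes> z \<otimes> inv t \<in> ?V" if "z \<in> ?V" for z
  proof (rule generate_conj_closed [OF Vc tc _ that])
    fix z assume "z \<in> V"
    then obtain k u where z: "z = engel t k (v u)" "u \<in> set us" by (auto simp: V)
    have "t \<otimes> z \<otimes> inv t = engel t (Suc k) (v u) \<otimes> z"
      using engel_car [OF z(2), of k] tc z by (simp add: commutator_def group_word_simps)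
    then show "t \<otimes> z \<otimes> inv t \<in> ?V" using engelV [OF z(2)] z(1) by (metis V.m_closed)
  qed
  have conj2: "inv t \<otimes> z \<otimes> t \<in> ?V" if "z \<in> ?V" for z
  proof -
    \<comment> \<open>Conjugation by \<open>t\<close> expresses itself through the next commutator,
      but conjugation by \<open>inv t\<close> needs the conjugate of that commutator. So the
      induction runs downwards from depth \<open>Suc c\<close>, where the commutator is
      trivial.\<close>
    have base: "inv t \<otimes> engel t k (v u) \<otimes> t \<in> ?V" if u: "u \<in> set us" and "k \<le> Suc c" for k u
      using \<open>k \<le> Suc c\<close>
    proof (induction k rule: inc_induct)
      case base
      have vc: "v u \<in> carrier G" using vH [OF u] by simp
      have "engel t c (v u) = \<one>" using engel_lower_central [OF tc vc, of c] c by simp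
      then show ?case using tc by (simp add: commutator_def)
    next
      case (step k)
      let ?w = "engel t k (v u)"
      have wc: "?w \<in> carrier G" by (rule engel_car [OF u])
      have "inv t \<otimes> ?w \<otimes> t = inv (inv t \<otimes> engel t (Suc k) (v u) \<otimes> t) \<otimes> ?w"
        using wc tc by (simp add: commutator_def group_word_simps)
      then show ?case using step engelV [OF u, of k] by (metis V.m_closed V.m_inv_closed)
    qed
    have "inv t \<otimes> z \<otimes> inv (inv t) \<in> ?V"
    proof (rule generate_conj_closed [OF Vc _ _ that])
      fix z assume "z \<in> V"
      then obtain k u where "z = engel t k (v u)" "u \<in> set us" "k \<le> c" by (auto simp: V)
      then show "inv t \<otimes> z \<otimes> inv (inv t) \<in> ?V" using base [of u k] tc by simp
    qed (use tc in simp)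
    then show ?thesis using tc by simp
  qed
  have conj: "t [^] k \<otimes> z \<otimes> inv (t [^] k) \<in> ?V" if "z \<in> ?V" for z and k :: int
    by (rule int_pow_conj_closed [OF V.subset tc conj1 conj2 that])
  have conj': "inv (t [^] k) \<otimes> z \<otimes> t [^] k \<in> ?V" if "z \<in> ?V" for z and k :: int
    using conj [OF that, of "- k"] tc by (simp add: int_pow_neg)
  have decomp: "\<exists>k::int. \<exists>l\<in>?V. z = t [^] k \<otimes> l" if "z \<in> ?H" for z
    using that
  proof (induction rule: generate.induct)
    case one show ?case by (intro exI [of _ 0] bexI [of _ \<one>]) auto
  next
    case (incl u)
    let ?q = "\<epsilon> u div \<epsilon> t"
    have uc: "u \<in> carrier G" using incl us by auto
    have "v u \<in> ?V" using engelV [OF incl, of 0] by simp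
    then have "inv (t [^] ?q) \<otimes> v u \<otimes> t [^] ?q \<in> ?V" by (rule conj')
    moreover have "u = t [^] ?q \<otimes> (inv (t [^] ?q) \<otimes> v u \<otimes> t [^] ?q)"
      using uc tc by (simp add: v_def int_pow_neg group_word_simps)
    ultimately show ?case by blast
  next
    case (inv u)
    let ?q = "\<epsilon> u div \<epsilon> t"
    have uc: "u \<in> carrier G" using inv us by auto
    have "v u \<in> ?V" using engelV [OF inv, of 0] by simp
    then have "inv (v u) \<in> ?V" by simp
    moreover have "inv u = t [^] (- ?q) \<otimes> inv (v u)"
      using uc tc by (simp add: v_def int_pow_neg group_word_simps)
    ultimately show ?case by blast
  next
    case (eng x y)
    then obtain k l k' l' where *: "l \<in> ?V" "x = t [^] (k::int) \<otimes> l" "l' \<in> ?V" "y = t [^] (k'::int) \<otimes> l'"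
      by blast
    have "x \<otimes> y = t [^] (k + k') \<otimes> ((inv (t [^] k') \<otimes> l \<otimes> t [^] k') \<otimes> l')"
      using * tc by (simp add: int_pow_mult group_word_simps)
    moreover have "(inv (t [^] k') \<otimes> l \<otimes> t [^] k') \<otimes> l' \<in> ?V" using conj' * by simp
    ultimately show ?case by blast
  qed
  have "?V \<subseteq> N" by (rule generate_subgroup_incl [OF VN N])
  moreover have "N \<subseteq> ?V"
  proof
    fix z assume z: "z \<in> N"
    then have zH: "z \<in> ?H" "\<epsilon> z = 0" by (auto simp: N_def)
    show "z \<in> ?V"
    proof (cases "\<epsilon> t = 0")
      case True
      have "set us \<subseteq> ?V"
      proof
        fix u assume u: "u \<in> set us"
        \<comment> \<open>Division by zero yields \<open>0\<close>, so the correcting power of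
          \<open>t\<close> is trivial.\<close>
        then have "v u = u" using True us by (auto simp: v_def)
        then show "u \<in> ?V" using engelV [OF u, of 0] by simp
      qed
      then have "?H \<subseteq> ?V" by (rule generate_subgroup_incl [OF _ V.subgroup_axioms])
      then show ?thesis using zH by blast
    next
      case False
      obtain k l where kl: "l \<in> ?V" "z = t [^] (k::int) \<otimes> l" using decomp [OF zH(1)] by blast
      have "l \<in> N" using kl \<open>?V \<subseteq> N\<close> by blast
      then have "\<epsilon> z = k * \<epsilon> t"
        unfolding kl(2) using hom [OF powH, of l k] hom_on_int_pow [OF H hom t] by (simp add: N_def)
      then have "k = 0" using zH False by simp
      then show ?thesis using kl by simp
    qed
  qed
  ultimately show ?thesis by (simp add: N_def)
qed

end

section \<open>Approximate twisted centralizers\<close>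

context separating_flag
begin

definition twist :: "('a \<Rightarrow> 'a) \<Rightarrow> 'a \<Rightarrow> 'a" where "twist \<psi> z = z \<otimes> inv (\<psi> z)"

definition H :: "('a \<Rightarrow> 'a) \<Rightarrow> nat \<Rightarrow> 'a set"
  where "H \<psi> j = {z \<in> carrier G. twist \<psi> z \<in> K j}"

definition eps :: "('a \<Rightarrow> 'a) \<Rightarrow> nat \<Rightarrow> 'a \<Rightarrow> int" where "eps \<psi> j z = delta j (twist \<psi> z)"

text \<open>A single parameter \<open>A\<close> bounds all the data; since \<open>A \<ge> 2\<close>, constants are absorbed into
  exponents of \<open>A\<close>.\<close>

definition admissible :: "('a \<Rightarrow> 'a) \<Rightarrow> nat \<Rightarrow> bool" where
  "admissible \<psi> A \<longleftrightarrow> \<psi> \<in> hom G G \<and> 2 \<le> A \<and> (\<forall>g\<in>carrier G. wl (\<psi> g) \<le> A * wl g)"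

lemma H_carrier: "z \<in> H \<psi> j \<Longrightarrow> z \<in> carrier G"
  by (simp add: H_def)

lemma H_0: "\<psi> \<in> hom G G \<Longrightarrow> H \<psi> 0 = carrier G"
  by (auto simp: H_def K_0 twist_def hom_in_carrier)

lemma twist_closed: "\<lbrakk>\<psi> \<in> hom G G; z \<in> carrier G\<rbrakk> \<Longrightarrow> twist \<psi> z \<in> carrier G"
  by (simp add: twist_def hom_in_carrier)

lemma twist_mult:
  assumes "\<psi> \<in> hom G G" "y \<in> carrier G" "z \<in> carrier G"
  shows "twist \<psi> (y \<otimes> z) = (y \<otimes> twist \<psi> z \<otimes> inv y) \<otimes> twist \<psi> y"
  using assms hom_in_carrier [OF assms(1)] by (simp add: twist_def hom_mult [OF assms(1)] group_word_simps)

lemma twist_inv: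
  assumes "\<psi> \<in> hom G G" "z \<in> carrier G"
  shows "twist \<psi> (inv z) = inv z \<otimes> inv (twist \<psi> z) \<otimes> z"
proof -
  interpret h: group_hom G G \<psi> using assms(1) by unfold_locales
  show ?thesis using assms(2) by (simp add: twist_def group_word_simps)
qed

text \<open>\<open>twist\<close> is a crossed homomorphism: in \<open>twist_mult\<close> only a
  conjugate of a twist appears, so normality of \<open>K j\<close> gives closure. The same
  filtration thus serves every \<open>\<psi>\<close>.\<close>

lemma H_subgroup:
  assumes \<psi>: "\<psi> \<in> hom G G" and j: "j \<le> R"
  shows "subgroup (H \<psi> j) G"
proof -
  interpret h: group_hom G G \<psi> using \<psi> by unfold_locales
  interpret K: subgroup "K j" G by (rule K_subgroup)
  show ?thesis
  proof
    show "H \<psi> j \<subseteq> carrier G" by (auto simp: H_def)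
    show "\<one> \<in> H \<psi> j" by (simp add: H_def twist_def)
  next
    fix y z assume "y \<in> H \<psi> j" "z \<in> H \<psi> j"
    then show "y \<otimes> z \<in> H \<psi> j"
      using normal_conj [OF K_normal [OF j]] by (simp add: H_def twist_mult [OF \<psi>])
  next
    fix z assume "z \<in> H \<psi> j"
    then show "inv z \<in> H \<psi> j"
      using normal_conj_inv [OF K_normal [OF j]] by (simp add: H_def twist_inv [OF \<psi>])
  qed
qed

text \<open>Conjugation invariance of \<open>delta j\<close> removes the conjugate from
  \<open>twist_mult\<close> and turns the crossed homomorphism into a homomorphism.\<close>

lemma eps_mult:
  assumes \<psi>: "\<psi> \<in> hom G G" and j: "j < R" and y: "y \<in> H \<psi> j" and z: "z \<in> H \<psi> j"
  shows "eps \<psi> j (y \<otimes> z) = eps \<psi> j y + eps \<psi> j z"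
proof -
  have yz: "y \<in> carrier G" "z \<in> carrier G" "twist \<psi> y \<in> K j" "twist \<psi> z \<in> K j"
    using y z by (auto simp: H_def)
  have "y \<otimes> twist \<psi> z \<otimes> inv y \<in> K j" by (rule normal_conj [OF K_normal]) (use j yz in auto)
  then show ?thesis
    using yz j delta_mult delta_conj by (simp add: eps_def twist_mult [OF \<psi>])
qed

lemma H_SucI: "\<lbrakk>j < R; z \<in> H \<psi> j; eps \<psi> j z = 0\<rbrakk> \<Longrightarrow> z \<in> H \<psi> (Suc j)"
  using K_SucI by (auto simp: H_def eps_def)

lemma H_Suc: "j < R \<Longrightarrow> H \<psi> (Suc j) = {z \<in> H \<psi> j. eps \<psi> j z = 0}"
  using H_SucI subsetD [OF K_Suc_subset] delta_K_Suc by (auto simp: H_def eps_def)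

lemma power_bound:
  fixes A :: nat
  assumes "2 \<le> A" shows "n \<le> A ^ n"
proof -
  have "n \<le> 2 ^ n" by (rule less_imp_le [OF less_exp])
  also have "\<dots> \<le> A ^ n" using assms by (intro power_mono) auto
  finally show ?thesis .
qed

lemma wl_twist:
  assumes "admissible \<psi> A" "z \<in> carrier G" "wl z \<le> B"
  shows "wl (twist \<psi> z) \<le> (1 + A) * B"
proof -
  have \<psi>: "\<psi> \<in> hom G G" and w: "wl (\<psi> z) \<le> A * wl z" using assms by (auto simp: admissible_def)
  have "wl (twist \<psi> z) \<le> wl z + wl (\<psi> z)"
    unfolding twist_def using wl_mult [of z "inv (\<psi> z)"] assms(2) hom_in_carrier [OF \<psi>] by (simp add: wl_inv)
  also have "\<dots> \<le> B + A * B" using w assms(3) by (intro add_mono order_trans [OF w] mult_left_mono) auto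
  finally show ?thesis by simp
qed

section \<open>Polynomial bounds for generators and pivots\<close>

lemma eps_bound:
  "\<exists>q. \<forall>\<psi> A j z B. admissible \<psi> A \<longrightarrow> j < R \<longrightarrow> z \<in> carrier G \<longrightarrow> A \<le> B \<longrightarrow> wl z \<le> B \<longrightarrow>
     \<bar>eps \<psi> j z\<bar> \<le> int (B ^ q)"
proof -
  obtain p where p: "\<forall>j<R. \<forall>g\<in>carrier G. \<forall>B\<ge>2. wl g \<le> B \<longrightarrow> nat \<bar>delta j g\<bar> \<le> B ^ p"
    using delta_bound by blast
  have "\<bar>eps \<psi> j z\<bar> \<le> int (B ^ (3 * p))"
    if h: "admissible \<psi> A" "j < R" "z \<in> carrier G" "A \<le> B" "wl z \<le> B" for \<psi> A j z B
  proof -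
    have A: "2 \<le> A" "\<psi> \<in> hom G G" using h by (auto simp: admissible_def)
    then have B: "2 \<le> B" using h by simp
    have "wl (twist \<psi> z) \<le> (1 + A) * B" by (rule wl_twist) (use h in auto)
    also have "\<dots> \<le> (2 * B) * B" using h B by (intro mult_right_mono) auto
    also have "\<dots> \<le> (B * B) * B" using B by (intro mult_right_mono) auto
    finally have "wl (twist \<psi> z) \<le> B ^ 3" by (simp add: power3_eq_cube)
    moreover have "2 \<le> B ^ 3"
    proof -
      have "B ^ 1 \<le> B ^ 3" using B by (intro power_increasing) auto
      then show ?thesis using B by simp
    qed
    ultimately have "nat \<bar>delta j (twist \<psi> z)\<bar> \<le> (B ^ 3) ^ p"
      using p h twist_closed [OF A(2) h(3)] by blast
    then show ?thesis by (simp only: eps_def nat_le_iff power_mult)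
  qed
  then show ?thesis by blast
qed

text \<open>The exponent \<open>p\<close> and the number \<open>n\<close> are chosen before
  \<open>\<psi>\<close> and \<open>A\<close>. Both have to be carried along, since \<open>n\<close>
  enters the exponent of the next bound through \<open>gcd_element\<close>.\<close>

definition bounded_generators :: "nat \<Rightarrow> nat \<Rightarrow> nat \<Rightarrow> bool" where
  "bounded_generators j p n \<longleftrightarrow> (\<forall>\<psi> A. admissible \<psi> A \<longrightarrow> (\<exists>us. set us \<subseteq> carrier G \<and>
     generate G (set us) = H \<psi> j \<and> length us \<le> n \<and> (\<forall>u\<in>set us. wl u \<le> A ^ p)))"

lemma bounded_pivot:
  assumes gens: "bounded_generators j p n" and p: "1 \<le> p" and j: "j < R"
  shows "\<exists>q. p \<le> q \<and> (\<forall>\<psi> A. admissible \<psi> A \<longrightarrow> (\<exists>us t. set us \<subseteq> carrier G \<and>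
     generate G (set us) = H \<psi> j \<and> length us \<le> n \<and> (\<forall>u\<in>set us. wl u \<le> A ^ p \<and> \<bar>eps \<psi> j u\<bar> \<le> int (A ^ q)) \<and>
     t \<in> H \<psi> j \<and> wl t \<le> A ^ q \<and> (\<forall>z\<in>H \<psi> j. eps \<psi> j t dvd eps \<psi> j z)))"
proof -
  obtain c where c: "\<And>\<psi> A j z B. \<lbrakk>admissible \<psi> A; j < R; z \<in> carrier G; A \<le> B; wl z \<le> B\<rbrakk> \<Longrightarrow>
     \<bar>eps \<psi> j z\<bar> \<le> int (B ^ c)" using eps_bound by blast
  \<comment> \<open>Here \<open>A ^ (p * c)\<close> bounds the values on the generators. The
    \<open>n\<close> Bezout steps cost a factor \<open>A ^ (p * c + 2)\<close> each, starting from
    length \<open>A ^ p\<close>; the last summand only ensures that \<open>A ^ q\<close> bounds the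
    values as well.\<close>
  define q where "q = p + (p * c + 2) * n + p * c"
  have "\<exists>us t. set us \<subseteq> carrier G \<and>
     generate G (set us) = H \<psi> j \<and> length us \<le> n \<and> (\<forall>u\<in>set us. wl u \<le> A ^ p \<and> \<bar>eps \<psi> j u\<bar> \<le> int (A ^ q)) \<and>
     t \<in> H \<psi> j \<and> wl t \<le> A ^ q \<and> (\<forall>z\<in>H \<psi> j. eps \<psi> j t dvd eps \<psi> j z)"
    if adm: "admissible \<psi> A" for \<psi> A
  proof -
    have A: "2 \<le> A" and \<psi>: "\<psi> \<in> hom G G" using adm by (auto simp: admissible_def)
    obtain us where us: "set us \<subseteq> carrier G" "generate G (set us) = H \<psi> j" "length us \<le> n"
      "\<And>u. u \<in> set us \<Longrightarrow> wl u \<le> A ^ p" using gens adm unfolding bounded_generators_def by blast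
    have Hs: "subgroup (H \<psi> j) G" using \<psi> j by (intro H_subgroup) auto
    have usH: "set us \<subseteq> H \<psi> j" using us(2) by (auto intro: generate.incl)
    define E where "E = A ^ (p * c)"
    have Ap: "A \<le> A ^ p" using power_increasing [of 1 p A] A p by simp
    have epsu: "\<bar>eps \<psi> j u\<bar> \<le> int E" if "u \<in> set us" for u
      using c [OF adm j _ Ap us(4) [OF that]] us(1) that by (auto simp: E_def power_mult)
    obtain t where t: "t \<in> H \<psi> j" "\<forall>u\<in>set us. eps \<psi> j t dvd eps \<psi> j u"
      "wl t \<le> A ^ p * (2 * E + 2) ^ length us"
      using gcd_element [OF Hs eps_mult [OF \<psi> j] usH epsu us(4)] by blast
    have E1: "1 \<le> E" using A by (simp add: E_def)
    have "2 * E + 2 \<le> 4 * E" using E1 by simp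
    also have "\<dots> \<le> A ^ 2 * E"
      using power_mono [of 2 A 2] A by (intro mult_right_mono) auto
    also have "\<dots> = A ^ (p * c + 2)" by (simp only: E_def power_add mult.commute)
    finally have "2 * E + 2 \<le> A ^ (p * c + 2)" .
    then have "(2 * E + 2) ^ length us \<le> (A ^ (p * c + 2)) ^ length us" by (intro power_mono) auto
    also have "\<dots> \<le> (A ^ (p * c + 2)) ^ n" using us(3) A by (intro power_increasing one_le_power) auto
    finally have "wl t \<le> A ^ p * (A ^ (p * c + 2)) ^ n"
      by (rule order_trans [OF t(3) mult_left_mono]) simp
    also have "\<dots> = A ^ (p + (p * c + 2) * n)" by (simp only: power_add power_mult)
    also have "\<dots> \<le> A ^ q" using A by (intro power_increasing) (auto simp: q_def)
    finally have wt: "wl t \<le> A ^ q" .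
    have "E \<le> A ^ q" unfolding E_def using A by (intro power_increasing) (auto simp: q_def)
    then have epsu': "\<bar>eps \<psi> j u\<bar> \<le> int (A ^ q)" if "u \<in> set us" for u
      using epsu [OF that] by (meson of_nat_le_iff order_trans)
    interpret Hs: subgroup "H \<psi> j" G by (rule Hs)
    have e1: "eps \<psi> j \<one> = 0" using eps_mult [OF \<psi> j, of \<one> \<one>] by simp
    have einv: "eps \<psi> j (inv h) = - eps \<psi> j h" if "h \<in> H \<psi> j" for h
      using eps_mult [OF \<psi> j that, of "inv h"] that e1 by simp
    have "z \<in> H \<psi> j \<and> eps \<psi> j t dvd eps \<psi> j z" if "z \<in> generate G (set us)" for z
      using that
    proof (induction rule: generate.induct)
      case (eng x y)
      then show ?case using eps_mult [OF \<psi> j] by simp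
    qed (use t usH e1 einv in auto)
    then have "\<forall>z\<in>H \<psi> j. eps \<psi> j t dvd eps \<psi> j z" using us(2) by simp
    then show ?thesis using us epsu' t wt by blast
  qed
  moreover have "p \<le> q" by (simp add: q_def)
  ultimately show ?thesis by blast
qed

lemma bounded_generators_step:
  assumes gens: "bounded_generators j p n" and p: "1 \<le> p" and j: "j < R"
    and c: "lower_central G c = {\<one>}"
  shows "\<exists>p' n'. 1 \<le> p' \<and> bounded_generators (Suc j) p' n'"
proof -
  obtain q where q: "p \<le> q" "\<And>\<psi> A. admissible \<psi> A \<Longrightarrow> \<exists>us t. set us \<subseteq> carrier G \<and>
     generate G (set us) = H \<psi> j \<and> length us \<le> n \<and> (\<forall>u\<in>set us. wl u \<le> A ^ p \<and> \<bar>eps \<psi> j u\<bar> \<le> int (A ^ q)) \<and>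
     t \<in> H \<psi> j \<and> wl t \<le> A ^ q \<and> (\<forall>z\<in>H \<psi> j. eps \<psi> j t dvd eps \<psi> j z)"
    using bounded_pivot [OF gens p j] by blast
  \<comment> \<open>\<open>q + q\<close> pays for the power of \<open>t\<close> in
    \<open>w u\<close>, \<open>1\<close> for adding the length of \<open>u\<close>, and
    \<open>2 * c\<close> for the factor \<open>4 ^ k\<close> of an iterated commutator of depth
    \<open>k \<le> c\<close>.\<close>
  define p' where "p' = 2 * c + (1 + (q + q))"
  have "\<exists>vs. set vs \<subseteq> carrier G \<and> generate G (set vs) = H \<psi> (Suc j) \<and>
      length vs \<le> Suc c * n \<and> (\<forall>v\<in>set vs. wl v \<le> A ^ p')" if adm: "admissible \<psi> A" for \<psi> A
  proof -
    have A: "2 \<le> A" and \<psi>: "\<psi> \<in> hom G G" using adm by (auto simp: admissible_def)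
    obtain us t where us: "set us \<subseteq> carrier G" "generate G (set us) = H \<psi> j" "length us \<le> n"
      "\<And>u. u \<in> set us \<Longrightarrow> wl u \<le> A ^ p" "\<And>u. u \<in> set us \<Longrightarrow> \<bar>eps \<psi> j u\<bar> \<le> int (A ^ q)"
      and t: "t \<in> H \<psi> j" "wl t \<le> A ^ q" "\<And>z. z \<in> H \<psi> j \<Longrightarrow> eps \<psi> j t dvd eps \<psi> j z"
      using q(2) [OF adm] by blast
    have tc: "t \<in> carrier G" using t H_carrier by blast
    have usH: "set us \<subseteq> H \<psi> j" using us(2) by (auto intro: generate.incl)
    define w where "w u = u \<otimes> t [^] (- (eps \<psi> j u div eps \<psi> j t))" for u
    define vs where "vs = concat (map (\<lambda>k. map (\<lambda>u. engel t k (w u)) us) [0..<Suc c])"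
    have "set vs = {engel t k (u \<otimes> t [^] (- (eps \<psi> j u div eps \<psi> j t))) | k u. k \<le> c \<and> u \<in> set us}"
      by (auto simp: vs_def w_def less_Suc_eq_le simp del: upt_Suc) blast+
    moreover have "generate G {engel t k (u \<otimes> t [^] (- (eps \<psi> j u div eps \<psi> j t))) | k u. k \<le> c \<and> u \<in> set us}
      = {z \<in> generate G (set us). eps \<psi> j z = 0}"
      by (rule kernel_generators [OF us(1) _ _ _ c])
         (use us(2) t usH eps_mult [OF \<psi> j] in auto)
    ultimately have "generate G (set vs) = {z \<in> generate G (set us). eps \<psi> j z = 0}" by simp
    then have gen: "generate G (set vs) = H \<psi> (Suc j)" using us(2) H_Suc [OF j] by simp
    have "length vs = Suc c * length us"
      by (simp add: vs_def length_concat comp_def sum_list_triv del: upt_Suc)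
    then have len: "length vs \<le> Suc c * n" using us(3) by (simp only: mult_le_mono2)
    have wl: "wl v \<le> A ^ p'" if v: "v \<in> set vs" for v
    proof -
      obtain k u where ku: "v = engel t k (w u)" "k \<le> c" "u \<in> set us"
        using v by (auto simp: vs_def less_Suc_eq_le simp del: upt_Suc)
      have uc: "u \<in> carrier G" using us ku by auto
      define Q where "Q = eps \<psi> j u div eps \<psi> j t"
      have "\<bar>Q\<bar> \<le> \<bar>eps \<psi> j u\<bar>"
      proof -
        have e: "eps \<psi> j u = Q * eps \<psi> j t" unfolding Q_def using t(3) usH ku by auto
        show ?thesis
        proof (cases "eps \<psi> j t = 0")
          case True then show ?thesis by (simp add: Q_def)
        next
          case False
          then have "\<bar>Q\<bar> * 1 \<le> \<bar>Q\<bar> * \<bar>eps \<psi> j t\<bar>" by (intro mult_left_mono) auto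
          then show ?thesis by (simp add: e abs_mult)
        qed
      qed
      also have "\<dots> \<le> int (A ^ q)" by (rule us(5) [OF ku(3)])
      finally have "\<bar>Q\<bar> \<le> int (A ^ q)" by simp
      then have Q: "nat \<bar>Q\<bar> \<le> A ^ q" by (simp only: nat_le_iff)
      let ?M = "A ^ (1 + (q + q))"
      have "wl (w u) \<le> wl u + wl (t [^] (- Q))"
        unfolding w_def Q_def [symmetric] using uc tc by (intro wl_mult) auto
      also have "\<dots> \<le> A ^ p + nat \<bar>- Q\<bar> * wl t"
        using us(4) ku tc by (intro add_mono wl_int_pow) auto
      also have "\<dots> \<le> A ^ (q + q) + A ^ q * A ^ q"
      proof (intro add_mono mult_mono)
        show "A ^ p \<le> A ^ (q + q)" using q(1) A by (intro power_increasing) auto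
      qed (use Q t in auto)
      also have "\<dots> = 2 * A ^ (q + q)" by (simp add: power_add)
      also have "\<dots> \<le> ?M" using A by simp
      finally have wu: "wl (w u) \<le> ?M" .
      have "A ^ q \<le> ?M" using A by (intro power_increasing) auto
      then have wt: "wl t \<le> ?M" using t by linarith
      have "wl v \<le> 4 ^ k * ?M" unfolding ku(1)
        by (rule wl_engel) (use tc uc wt wu in \<open>auto simp: w_def\<close>)
      also have "\<dots> \<le> A ^ (2 * c) * ?M"
      proof (rule mult_right_mono)
        have "(4::nat) ^ k \<le> 4 ^ c" using ku by (intro power_increasing) auto
        also have "\<dots> = 2 ^ (2 * c)" by (simp add: power_mult)
        also have "\<dots> \<le> A ^ (2 * c)" using A by (intro power_mono) auto
        finally show "4 ^ k \<le> A ^ (2 * c)" .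
      qed simp
      also have "\<dots> = A ^ p'" by (simp only: p'_def power_add)
      finally show ?thesis .
    qed
    have "set vs \<subseteq> carrier G"
      using engel_closed tc us(1) by (auto simp: vs_def w_def subset_iff simp del: upt_Suc)
    then show ?thesis using gen len wl by blast
  qed
  then have "bounded_generators (Suc j) p' (Suc c * n)" unfolding bounded_generators_def by blast
  moreover have "1 \<le> p'" by (simp add: p'_def)
  ultimately show ?thesis by blast
qed

lemma bounded_generators_exist:
  assumes c: "lower_central G c = {\<one>}"
  shows "j \<le> R \<Longrightarrow> \<exists>p n. 1 \<le> p \<and> bounded_generators j p n"
proof (induction j)
  case 0
  obtain ss where ss: "set ss = S" using finite_S finite_list by blast
  have "\<exists>us. set us \<subseteq> carrier G \<and> generate G (set us) = H \<psi> 0 \<and> length us \<le> length ss \<and>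
      (\<forall>u\<in>set us. wl u \<le> A ^ 1)" if adm: "admissible \<psi> A" for \<psi> A
  proof (intro exI [of _ ss] conjI ballI)
    show "generate G (set ss) = H \<psi> 0" using gen_S H_0 ss adm by (simp add: admissible_def)
    fix u assume "u \<in> set ss"
    then have "wl u \<le> 1" using wl_letter ss by (simp add: letters_def)
    then show "wl u \<le> A ^ 1" using adm by (simp add: admissible_def)
  qed (use ss S_sub in auto)
  then have "bounded_generators 0 1 (length ss)" unfolding bounded_generators_def by blast
  then show ?case by blast
next
  case (Suc j)
  then obtain p n where "1 \<le> p" "bounded_generators j p n" by auto
  then show ?case using bounded_generators_step [of j p n c] Suc.prems c by auto
qed

text \<open>The value of \<open>eps \<psi> j\<close> at \<open>t j\<close> generates its image on
  \<open>H \<psi> j\<close>; the value \<open>0\<close> occurs when the image is trivial.\<close>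

definition pivots :: "('a \<Rightarrow> 'a) \<Rightarrow> nat \<Rightarrow> nat \<Rightarrow> (nat \<Rightarrow> 'a) \<Rightarrow> bool" where
  "pivots \<psi> A p t \<longleftrightarrow> (\<forall>j<R. t j \<in> H \<psi> j \<and> wl (t j) \<le> A ^ p \<and>
     (\<forall>z\<in>H \<psi> j. eps \<psi> j (t j) dvd eps \<psi> j z))"

lemma pivots_exist:
  assumes c: "lower_central G c = {\<one>}"
  shows "\<exists>p\<ge>1. \<forall>\<psi> A. admissible \<psi> A \<longrightarrow> (\<exists>t. pivots \<psi> A p t)"
proof -
  have "\<exists>q. \<forall>\<psi> A. admissible \<psi> A \<longrightarrow> (\<exists>t. t \<in> H \<psi> j \<and> wl t \<le> A ^ q \<and>
     (\<forall>z\<in>H \<psi> j. eps \<psi> j t dvd eps \<psi> j z))" if j: "j < R" for j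
  proof -
    obtain p n where "1 \<le> p" "bounded_generators j p n" using bounded_generators_exist [OF c, of j] j by auto
    then obtain q where q: "\<And>\<psi> A. admissible \<psi> A \<Longrightarrow> \<exists>us t. set us \<subseteq> carrier G \<and>
     generate G (set us) = H \<psi> j \<and> length us \<le> n \<and> (\<forall>u\<in>set us. wl u \<le> A ^ p \<and> \<bar>eps \<psi> j u\<bar> \<le> int (A ^ q)) \<and>
     t \<in> H \<psi> j \<and> wl t \<le> A ^ q \<and> (\<forall>z\<in>H \<psi> j. eps \<psi> j t dvd eps \<psi> j z)"
      using bounded_pivot [of j p n] j by blast
    have "\<exists>t. t \<in> H \<psi> j \<and> wl t \<le> A ^ q \<and> (\<forall>z\<in>H \<psi> j. eps \<psi> j t dvd eps \<psi> j z)"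
      if "admissible \<psi> A" for \<psi> A using q [OF that] by (elim exE conjE) (intro exI conjI)
    then show ?thesis by blast
  qed
  then obtain q where q: "\<And>j \<psi> A. \<lbrakk>j < R; admissible \<psi> A\<rbrakk> \<Longrightarrow> \<exists>t. t \<in> H \<psi> j \<and> wl t \<le> A ^ q j \<and>
     (\<forall>z\<in>H \<psi> j. eps \<psi> j t dvd eps \<psi> j z)" by metis
  define p where "p = 1 + sum q {..<R}"
  have "\<exists>t. pivots \<psi> A p t" if adm: "admissible \<psi> A" for \<psi> A
  proof -
    have "\<forall>j\<in>{..<R}. \<exists>t. t \<in> H \<psi> j \<and> wl t \<le> A ^ q j \<and>
     (\<forall>z\<in>H \<psi> j. eps \<psi> j t dvd eps \<psi> j z)" using q adm by simp
    from bchoice [OF this] obtain t where t: "\<forall>j\<in>{..<R}. t j \<in> H \<psi> j \<and> wl (t j) \<le> A ^ q j \<and>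
     (\<forall>z\<in>H \<psi> j. eps \<psi> j (t j) dvd eps \<psi> j z)" by blast
    have "A ^ q j \<le> A ^ p" if "j < R" for j
    proof (rule power_increasing)
      have "q j \<le> sum q {..<R}" by (rule member_le_sum) (use that in auto)
      then show "q j \<le> p" by (simp add: p_def)
      show "1 \<le> A" using adm by (simp add: admissible_def)
    qed
    then have "pivots \<psi> A p t" unfolding pivots_def using t
      by (auto intro: order_trans)
    then show ?thesis by blast
  qed
  then show ?thesis by (intro exI [of _ p]) (simp add: p_def)
qed

end

section \<open>Separation modulo powers\<close>

context separating_flag
begin

text \<open>Each level of the descent in \<open>approximate_H\<close> consumes one factor:
  \<open>fact e\<close> for the congruence of the polynomial function, and the pivot value for
  dividing by it. The maximum with \<open>1\<close> keeps the product positive at a zero pivot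
  value.\<close>

definition modulus :: "('a \<Rightarrow> 'a) \<Rightarrow> (nat \<Rightarrow> 'a) \<Rightarrow> nat \<Rightarrow> nat" where
  "modulus \<psi> t j = (\<Prod>i<j. fact e * nat (max 1 \<bar>eps \<psi> i (t i)\<bar>))"

lemma power_subgroup_carrier: "g \<in> power_subgroup m \<Longrightarrow> g \<in> carrier G"
  using power_subgroup_subgroup subgroup.mem_carrier by metis

lemma twist_mod_power_subgroup:
  assumes \<psi>: "\<psi> \<in> hom G G" and h: "h \<in> carrier G" and g': "g' \<in> power_subgroup m"
    and k: "k \<in> carrier G" and g: "g \<in> power_subgroup m" and eq: "twist \<psi> (h \<otimes> g') = k \<otimes> g"
  shows "\<exists>p\<in>power_subgroup m. twist \<psi> h = k \<otimes> p"
proof -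
  interpret P: subgroup "power_subgroup m" G by (rule power_subgroup_subgroup)
  define p where "p = h \<otimes> twist \<psi> g' \<otimes> inv h"
  have "twist \<psi> g' \<in> power_subgroup m"
    unfolding twist_def using g' power_subgroup_hom [OF \<psi> g'] by simp
  then have p: "p \<in> power_subgroup m"
    unfolding p_def by (rule normal_conj [OF power_subgroup_normal h])
  have "k \<otimes> g = p \<otimes> twist \<psi> h"
    using eq twist_mult [OF \<psi> h power_subgroup_carrier [OF g']] by (simp add: p_def)
  then have "twist \<psi> h = inv p \<otimes> (k \<otimes> g)"
    using p twist_closed [OF \<psi> h] by (simp add: inv_cancel_left)
  then have "twist \<psi> h = k \<otimes> ((inv k \<otimes> inv p \<otimes> k) \<otimes> g)"
    using k p g by (simp add: group_word_simps)
  moreover have "(inv k \<otimes> inv p \<otimes> k) \<otimes> g \<in> power_subgroup m"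
    using normal_conj_inv [OF power_subgroup_normal k, of "inv p" m] p g by simp
  ultimately show ?thesis by blast
qed

text \<open>Suppose \<open>z\<close> is corrected to some \<open>h\<close> in
  \<open>H \<psi> j\<close>, and let \<open>d\<close> be the pivot value. Up to powers the twist of
  \<open>h\<close> lies in \<open>K (Suc j)\<close>, so \<open>m * \<bar>d\<bar>\<close> divides
  \<open>eps \<psi> j h = d * q\<close>. Then \<open>m\<close> divides \<open>q\<close>, and the
  factor \<open>t j [^] q\<close>, itself in \<open>power_subgroup m\<close>, can be split off,
  leaving an element of \<open>H \<psi> (Suc j)\<close>. If \<open>d = 0\<close>, the value at
  \<open>h\<close> is already \<open>0\<close>.\<close>

lemma approximate_H:
  assumes \<psi>: "\<psi> \<in> hom G G" and piv: "pivots \<psi> A p t"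
  shows "\<lbrakk>j \<le> R; z \<in> carrier G; k \<in> K j; g \<in> power_subgroup (m * modulus \<psi> t j);
    twist \<psi> z = k \<otimes> g\<rbrakk> \<Longrightarrow> \<exists>h\<in>H \<psi> j. \<exists>g'\<in>power_subgroup m. z = h \<otimes> g'"
proof (induction j arbitrary: m k g)
  case 0
  then show ?case
    using H_0 [OF \<psi>] subgroup.one_closed [OF power_subgroup_subgroup, of m]
    by (intro bexI [of _ z] bexI [of _ \<one>]) auto
next
  case (Suc j)
  define d where "d = eps \<psi> j (t j)"
  define m1 where "m1 = m * nat (max 1 \<bar>d\<bar>) * fact e"
  have j: "j < R" using Suc.prems by simp
  have mod: "m * modulus \<psi> t (Suc j) = m1 * modulus \<psi> t j"
    by (simp add: modulus_def m1_def d_def)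
  have kj: "k \<in> K j" using Suc.prems K_Suc_subset by blast
  have kc: "k \<in> carrier G" using kj K_carrier by blast
  interpret P1: subgroup "power_subgroup m1" G by (rule power_subgroup_subgroup)
  interpret P: subgroup "power_subgroup m" G by (rule power_subgroup_subgroup)
  have g: "g \<in> power_subgroup (m1 * modulus \<psi> t j)" using Suc.prems by (simp only: mod)
  then have g1: "g \<in> power_subgroup m1" using power_subgroup_mono [of m1 "m1 * modulus \<psi> t j"] by auto
  obtain h g' where h: "h \<in> H \<psi> j" "g' \<in> power_subgroup m1" "z = h \<otimes> g'"
    using Suc.IH [OF _ Suc.prems(2) kj g Suc.prems(5)] Suc.prems by auto
  have hc: "h \<in> carrier G" using h H_carrier by blast
  obtain g2 where g2: "g2 \<in> power_subgroup m1" and th: "twist \<psi> h = k \<otimes> g2"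
    using twist_mod_power_subgroup [OF \<psi> hc h(2) kc g1 Suc.prems(5) [unfolded h(3)]] by blast
  have "int (m * nat (max 1 \<bar>d\<bar>)) dvd (fs ! j) (k \<otimes> g2) - (fs ! j) k"
    using fs_congruence [OF j g2 [unfolded m1_def] kc] .
  moreover have "(fs ! j) k = (fs ! j) \<one>"
    using delta_K_Suc [OF Suc.prems(3)] by (simp add: delta_def)
  ultimately have dv: "int (m * nat (max 1 \<bar>d\<bar>)) dvd eps \<psi> j h"
    by (simp add: eps_def delta_def th)
  have tj: "t j \<in> H \<psi> j" and "d dvd eps \<psi> j h"
    using piv j h unfolding pivots_def d_def by auto
  then obtain q where q: "eps \<psi> j h = d * q" by (auto simp: dvd_def)
  have sub: "power_subgroup m1 \<subseteq> power_subgroup m"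
    by (rule power_subgroup_mono) (simp add: m1_def)
  show ?case
  proof (cases "d = 0")
    case True
    then have "h \<in> H \<psi> (Suc j)" using H_SucI [OF j h(1)] q by simp
    then show ?thesis using h sub by blast
  next
    case False
    have "int (nat (max 1 \<bar>d\<bar>)) = \<bar>d\<bar>" using False by simp
    then have "int m * \<bar>d\<bar> dvd d * q" using dv q by (simp only: of_nat_mult)
    then have "\<bar>int m * d\<bar> dvd d * q" by (simp add: abs_mult)
    then have "int m * d dvd q * d" by (simp only: abs_dvd_iff mult.commute [of d])
    then have mq: "int m dvd q" using False by simp
    have Hs: "subgroup (H \<psi> j) G" using \<psi> j by (intro H_subgroup) auto
    have tc: "t j \<in> carrier G" using tj H_carrier by blast
    define h' where "h' = t j [^] (- q) \<otimes> h"
    have tq: "t j [^] (- q) \<in> H \<psi> j" by (rule subgroup_int_pow [OF Hs tj])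
    have h'H: "h' \<in> H \<psi> j" unfolding h'_def using subgroup.m_closed [OF Hs tq h(1)] .
    have "eps \<psi> j h' = - q * d + d * q"
      using hom_on_int_pow [OF Hs eps_mult [OF \<psi> j] tj, of "- q"] q
      unfolding h'_def eps_mult [OF \<psi> j tq h(1)] d_def by simp
    then have h': "h' \<in> H \<psi> (Suc j)" using H_SucI [OF j h'H] by simp
    have h'c: "h' \<in> carrier G" using h'H H_carrier by blast
    have tqP: "t j [^] q \<in> power_subgroup m" by (rule int_pow_in_power_subgroup [OF tc mq])
    have g'P: "g' \<in> power_subgroup m" using h sub by blast
    have "z = h' \<otimes> ((inv h' \<otimes> t j [^] q \<otimes> h') \<otimes> g')"
      unfolding h(3) using hc tc h(2) by (simp add: h'_def int_pow_neg group_word_simps)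
    moreover have "(inv h' \<otimes> t j [^] q \<otimes> h') \<otimes> g' \<in> power_subgroup m"
      using normal_conj_inv [OF power_subgroup_normal h'c tqP] g'P by simp
    ultimately show ?thesis using h' by blast
  qed
qed

text \<open>A nonzero pivot value is itself a modulus that detects non-divisibility. For pivot value
  \<open>0\<close> the task is to detect a nonzero integer, and a number exceeding its absolute
  value does so.\<close>

definition obstruction_modulus :: "('a \<Rightarrow> 'a) \<Rightarrow> (nat \<Rightarrow> 'a) \<Rightarrow> nat \<Rightarrow> 'a \<Rightarrow> nat" where
  "obstruction_modulus \<psi> t i w =
     (let d = eps \<psi> i (t i); c = (if d = 0 then \<bar>delta i w\<bar> + 1 else \<bar>d\<bar>)
      in nat c * fact e * modulus \<psi> t i)"

text \<open>\<open>approximate_H\<close> replaces a solution modulo powers by some \<open>h\<close>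
  in \<open>H \<psi> i\<close> whose value is congruent to \<open>delta i w\<close>. Values on
  \<open>H \<psi> i\<close> are multiples of the pivot value, which contradicts
  \<open>ndvd\<close>.\<close>

lemma obstruction:
  assumes \<psi>: "\<psi> \<in> hom G G" and piv: "pivots \<psi> A p t" and i: "i < R" and w: "w \<in> K i"
    and ndvd: "\<not> eps \<psi> i (t i) dvd delta i w"
    and z: "z \<in> carrier G" and g: "g \<in> power_subgroup (obstruction_modulus \<psi> t i w)"
  shows "twist \<psi> z \<noteq> w \<otimes> g"
proof
  assume eq: "twist \<psi> z = w \<otimes> g"
  define d where "d = eps \<psi> i (t i)"
  define c where "c = (if d = 0 then \<bar>delta i w\<bar> + 1 else \<bar>d\<bar>)"
  have c: "c > 0" by (simp add: c_def)
  let ?m = "nat c * fact e"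
  have om: "obstruction_modulus \<psi> t i w = ?m * modulus \<psi> t i"
    by (simp add: obstruction_modulus_def Let_def c_def d_def)
  interpret P: subgroup "power_subgroup ?m" G by (rule power_subgroup_subgroup)
  have wc: "w \<in> carrier G" using w K_carrier by blast
  have gm: "g \<in> power_subgroup ?m"
    using g power_subgroup_mono [of ?m "?m * modulus \<psi> t i"] unfolding om by auto
  obtain h g' where h: "h \<in> H \<psi> i" "g' \<in> power_subgroup ?m" "z = h \<otimes> g'"
    using approximate_H [OF \<psi> piv _ z w g [unfolded om] eq] i by auto
  have hc: "h \<in> carrier G" using h H_carrier by blast
  obtain g2 where g2: "g2 \<in> power_subgroup ?m" and th: "twist \<psi> h = w \<otimes> g2"
    using twist_mod_power_subgroup [OF \<psi> hc h(2) wc gm eq [unfolded h(3)]] by blast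
  have "int (nat c) dvd (fs ! i) (w \<otimes> g2) - (fs ! i) w" by (rule fs_congruence [OF i g2 wc])
  then have dv: "c dvd eps \<psi> i h - delta i w" using c by (simp add: eps_def delta_def th)
  have dh: "d dvd eps \<psi> i h" using piv i h unfolding pivots_def d_def by auto
  show False
  proof (cases "d = 0")
    case True
    then have "c dvd delta i w" using dv dh by simp
    moreover have "delta i w \<noteq> 0" using ndvd by auto
    ultimately have "\<bar>c\<bar> \<le> \<bar>delta i w\<bar>" by (rule dvd_imp_le_int [rotated])
    then show False using True by (simp add: c_def)
  next
    case False
    then have "d dvd eps \<psi> i h - delta i w" using dv by (simp add: c_def)
    then have "d dvd eps \<psi> i h - (eps \<psi> i h - delta i w)" by (rule dvd_diff [OF dh])
    then show False using ndvd by (simp add: d_def)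
  qed
qed

text \<open>As long as the pivot value divides \<open>delta j\<close> of the current element,
  twisted conjugation by a power of the pivot pushes it one level down. Every step raises the length
  bound to a power that does not depend on \<open>\<psi>\<close>.\<close>

lemma reduction:
  assumes "1 \<le> p"
  shows "j \<le> R \<Longrightarrow> \<exists>q\<ge>1. \<forall>\<psi> A t w. admissible \<psi> A \<longrightarrow> pivots \<psi> A p t \<longrightarrow> w \<in> carrier G \<longrightarrow> wl w \<le> A \<longrightarrow>
    (\<exists>z\<in>carrier G. \<exists>i\<le>j. z \<otimes> w \<otimes> inv (\<psi> z) \<in> K i \<and> wl (z \<otimes> w \<otimes> inv (\<psi> z)) \<le> A ^ q \<and>
       (i = j \<or> \<not> eps \<psi> i (t i) dvd delta i (z \<otimes> w \<otimes> inv (\<psi> z))))"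
proof (induction j)
  case 0
  have "\<one> \<otimes> w \<otimes> inv (\<psi> \<one>) \<in> K 0 \<and> wl (\<one> \<otimes> w \<otimes> inv (\<psi> \<one>)) \<le> A ^ 1"
    if "admissible \<psi> A" "w \<in> carrier G" "wl w \<le> A" for \<psi> A w
  proof -
    interpret h: group_hom G G \<psi> using that by unfold_locales (simp add: admissible_def)
    show ?thesis using that by (simp add: K_0)
  qed
  then show ?case by (intro exI [of _ 1]) blast
next
  case (Suc j)
  then have j: "j < R" by simp
  obtain q where q: "1 \<le> q" "\<And>\<psi> A t w. \<lbrakk>admissible \<psi> A; pivots \<psi> A p t; w \<in> carrier G; wl w \<le> A\<rbrakk> \<Longrightarrow>
    \<exists>z\<in>carrier G. \<exists>i\<le>j. z \<otimes> w \<otimes> inv (\<psi> z) \<in> K i \<and> wl (z \<otimes> w \<otimes> inv (\<psi> z)) \<le> A ^ q \<and>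
       (i = j \<or> \<not> eps \<psi> i (t i) dvd delta i (z \<otimes> w \<otimes> inv (\<psi> z)))"
  proof -
    have "j \<le> R" using j by simp
    from Suc.IH [OF this] show ?thesis using that by (elim exE conjE) blast
  qed
  obtain b where b: "\<forall>j<R. \<forall>g\<in>carrier G. \<forall>B\<ge>2. wl g \<le> B \<longrightarrow> nat \<bar>delta j g\<bar> \<le> B ^ b"
    using delta_bound by blast
  \<comment> \<open>\<open>q * b\<close> bounds the exponent of the pivot, \<open>p\<close> its
    length and \<open>q\<close> the previous element; \<open>2\<close> absorbs the factor
    \<open>2 + A \<le> A ^ 2\<close>.\<close>
  define q' where "q' = 2 + (q * b + p + q)"
  have "\<exists>z\<in>carrier G. \<exists>i\<le>Suc j. z \<otimes> w \<otimes> inv (\<psi> z) \<in> K i \<and> wl (z \<otimes> w \<otimes> inv (\<psi> z)) \<le> A ^ q' \<and>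
       (i = Suc j \<or> \<not> eps \<psi> i (t i) dvd delta i (z \<otimes> w \<otimes> inv (\<psi> z)))"
    if adm: "admissible \<psi> A" and piv: "pivots \<psi> A p t" and w: "w \<in> carrier G" "wl w \<le> A" for \<psi> A t w
  proof -
    have A: "2 \<le> A" and \<psi>: "\<psi> \<in> hom G G" using adm by (auto simp: admissible_def)
    interpret h: group_hom G G \<psi> using \<psi> by unfold_locales
    have Aq: "A ^ q \<le> A ^ q'" using A by (intro power_increasing) (auto simp: q'_def)
    obtain z i where zi: "z \<in> carrier G" "i \<le> j" "z \<otimes> w \<otimes> inv (\<psi> z) \<in> K i"
      "wl (z \<otimes> w \<otimes> inv (\<psi> z)) \<le> A ^ q"
      "i = j \<or> \<not> eps \<psi> i (t i) dvd delta i (z \<otimes> w \<otimes> inv (\<psi> z))"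
      using q(2) [OF adm piv w] by blast
    define w' where "w' = z \<otimes> w \<otimes> inv (\<psi> z)"
    show ?thesis
    proof (cases "eps \<psi> i (t i) dvd delta i w'")
      case False
      moreover have "wl w' \<le> A ^ q'" using zi(4) Aq by (simp add: w'_def)
      moreover have "i \<le> Suc j" using zi by simp
      ultimately show ?thesis using zi(1,3) unfolding w'_def by blast
    next
      case True
      then have ij: "i = j" using zi(5) by (simp add: w'_def)
      define d where "d = eps \<psi> j (t j)"
      define u where "u = delta j w' div d"
      have du: "delta j w' = u * d" using True unfolding ij d_def u_def by simp
      have w'K: "w' \<in> K j" and w'q: "wl w' \<le> A ^ q" using zi ij by (auto simp: w'_def)
      have w'c: "w' \<in> carrier G" using w'K K_carrier by blast
      have tj: "t j \<in> H \<psi> j" "wl (t j) \<le> A ^ p" using piv j by (auto simp: pivots_def)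
      have tc: "t j \<in> carrier G" using tj H_carrier by blast
      have Hs: "subgroup (H \<psi> j) G" using \<psi> j by (intro H_subgroup) auto
      \<comment> \<open>Twisted conjugation by \<open>s\<close> adds \<open>- u * d\<close> to the
        value \<open>u * d\<close>. For \<open>d = 0\<close> divisibility makes the value
        \<open>0\<close>, and division by zero gives \<open>u = 0\<close>.\<close>
      define s where "s = t j [^] (- u)"
      have sH: "s \<in> H \<psi> j" unfolding s_def by (rule subgroup_int_pow [OF Hs tj(1)])
      have sc: "s \<in> carrier G" using sH H_carrier by blast
      have sK: "twist \<psi> s \<in> K j" using sH by (simp add: H_def)
      have eps_s: "delta j (twist \<psi> s) = - u * d"
        using hom_on_int_pow [OF Hs eps_mult [OF \<psi> j] tj(1), of "- u"] by (simp add: s_def d_def eps_def)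
      define w2 where "w2 = (s \<otimes> w' \<otimes> inv s) \<otimes> twist \<psi> s"
      have w2: "w2 = (s \<otimes> z) \<otimes> w \<otimes> inv (\<psi> (s \<otimes> z))"
        using sc zi(1) w(1) by (simp add: w2_def w'_def twist_def group_word_simps)
      have cK: "s \<otimes> w' \<otimes> inv s \<in> K j" by (rule normal_conj [OF K_normal]) (use j sc w'K in auto)
      have "w2 \<in> K j" unfolding w2_def using subgroup.m_closed [OF K_subgroup cK sK] .
      moreover have "delta j w2 = 0"
        unfolding w2_def delta_mult [OF j cK sK] delta_conj [OF j sc w'K] eps_s du by simp
      ultimately have w2K: "w2 \<in> K (Suc j)" by (rule K_SucI [OF j])
      have "A ^ 1 \<le> A ^ q" using A q(1) by (intro power_increasing) auto
      then have "2 \<le> A ^ q" using A by simp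
      then have "nat \<bar>delta j w'\<bar> \<le> (A ^ q) ^ b" using b j w'c w'q by blast
      moreover have "\<bar>u\<bar> \<le> \<bar>delta j w'\<bar>"
      proof (cases "d = 0")
        case True then show ?thesis by (simp add: u_def)
      next
        case False
        then have "\<bar>u\<bar> * 1 \<le> \<bar>u\<bar> * \<bar>d\<bar>" by (intro mult_left_mono) auto
        then show ?thesis by (simp add: du abs_mult)
      qed
      ultimately have u: "nat \<bar>u\<bar> \<le> A ^ (q * b)" by (simp add: power_mult)
      let ?M = "A ^ (q * b + p + q)"
      have "wl s \<le> nat \<bar>u\<bar> * wl (t j)" unfolding s_def using wl_int_pow [OF tc, of "- u"] by simp
      also have "\<dots> \<le> A ^ (q * b) * A ^ p" using u tj by (intro mult_mono) auto
      also have "\<dots> = A ^ (q * b + p)" by (simp add: power_add)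
      also have "\<dots> \<le> ?M" using A by (intro power_increasing) auto
      finally have s: "wl s \<le> ?M" .
      have "A ^ q \<le> ?M" using A by (intro power_increasing) auto
      then have w'M: "wl w' \<le> ?M" using w'q by linarith
      have "wl w2 \<le> wl s + wl w' + wl (\<psi> s)"
      proof -
        have "w2 = (s \<otimes> w') \<otimes> inv (\<psi> s)" using sc w'c by (simp add: w2_def twist_def group_word_simps)
        then have "wl w2 \<le> wl (s \<otimes> w') + wl (inv (\<psi> s))" using sc w'c by (simp add: wl_mult)
        then show ?thesis using wl_mult [OF sc w'c] sc by (simp add: wl_inv)
      qed
      also have "wl (\<psi> s) \<le> A * wl s" using adm sc by (simp add: admissible_def)
      finally have "wl w2 \<le> wl s + wl w' + A * wl s" by simp
      also have "\<dots> \<le> ?M + ?M + A * ?M" by (intro add_mono mult_left_mono s w'M) simp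
      also have "\<dots> = (2 + A) * ?M" by (simp add: algebra_simps)
      also have "\<dots> \<le> A ^ 2 * ?M"
      proof (rule mult_right_mono)
        have "2 * A \<le> A * A" using A by (intro mult_right_mono) auto
        then show "2 + A \<le> A ^ 2" using A unfolding power2_eq_square by linarith
      qed simp
      also have "\<dots> = A ^ q'" by (simp only: q'_def power_add)
      finally have "wl w2 \<le> A ^ q'" .
      moreover have "s \<otimes> z \<in> carrier G" using sc zi by simp
      ultimately show ?thesis using w2K unfolding w2 by blast
    qed
  qed
  moreover have "1 \<le> q'" by (simp add: q'_def)
  ultimately show ?case by blast
qed

theorem twisted_separation:
  assumes c: "lower_central G c = {\<one>}"
  shows "\<exists>P. \<forall>\<psi> A w. admissible \<psi> A \<longrightarrow> w \<in> carrier G \<longrightarrow> wl w \<le> A \<longrightarrow> w \<notin> twist \<psi> ` carrier G \<longrightarrow>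
    (\<exists>m>0. m \<le> A ^ P \<and> (\<forall>z\<in>carrier G. \<forall>g\<in>power_subgroup m. twist \<psi> z \<noteq> w \<otimes> g))"
proof -
  obtain p where p: "1 \<le> p" "\<And>\<psi> A. admissible \<psi> A \<Longrightarrow> \<exists>t. pivots \<psi> A p t"
    using pivots_exist [OF c] by blast
  obtain q where q: "1 \<le> q" "\<And>\<psi> A t w. \<lbrakk>admissible \<psi> A; pivots \<psi> A p t; w \<in> carrier G; wl w \<le> A\<rbrakk> \<Longrightarrow>
    \<exists>z\<in>carrier G. \<exists>i\<le>R. z \<otimes> w \<otimes> inv (\<psi> z) \<in> K i \<and> wl (z \<otimes> w \<otimes> inv (\<psi> z)) \<le> A ^ q \<and>
       (i = R \<or> \<not> eps \<psi> i (t i) dvd delta i (z \<otimes> w \<otimes> inv (\<psi> z)))"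
    using reduction [OF p(1) order_refl] by blast
  obtain b where b: "\<forall>j<R. \<forall>g\<in>carrier G. \<forall>B\<ge>2. wl g \<le> B \<longrightarrow> nat \<bar>delta j g\<bar> \<le> B ^ b"
    using delta_bound by blast
  obtain b' where b': "\<And>\<psi> A j z B. \<lbrakk>admissible \<psi> A; j < R; z \<in> carrier G; A \<le> B; wl z \<le> B\<rbrakk> \<Longrightarrow>
     \<bar>eps \<psi> j z\<bar> \<le> int (B ^ b')" using eps_bound by blast
  \<comment> \<open>The three summands bound the factors of the obstruction modulus: the detecting
    number in either case, \<open>fact e\<close>, and a product over at most \<open>R\<close>
    levels.\<close>
  define P where "P = (q * b + 1 + p * b') + fact e + (fact e + p * b') * R"
  have "\<exists>m>0. m \<le> A ^ P \<and> (\<forall>z\<in>carrier G. \<forall>g\<in>power_subgroup m. twist \<psi> z \<noteq> w \<otimes> g)"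
    if adm: "admissible \<psi> A" and w: "w \<in> carrier G" "wl w \<le> A" and nin: "w \<notin> twist \<psi> ` carrier G" for \<psi> A w
  proof -
    have A: "2 \<le> A" and \<psi>: "\<psi> \<in> hom G G" using adm by (auto simp: admissible_def)
    interpret h: group_hom G G \<psi> using \<psi> by unfold_locales
    obtain t where piv: "pivots \<psi> A p t" using p(2) adm by blast
    obtain z i where zi: "z \<in> carrier G" "i \<le> R" "z \<otimes> w \<otimes> inv (\<psi> z) \<in> K i"
      "wl (z \<otimes> w \<otimes> inv (\<psi> z)) \<le> A ^ q"
      "i = R \<or> \<not> eps \<psi> i (t i) dvd delta i (z \<otimes> w \<otimes> inv (\<psi> z))"
      using q(2) [OF adm piv w] by blast
    define w' where "w' = z \<otimes> w \<otimes> inv (\<psi> z)"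
    have w'c: "w' \<in> carrier G" using zi w by (simp add: w'_def)
    \<comment> \<open>At level \<open>R\<close> the element would be \<open>\<one>\<close>,
      exhibiting \<open>w\<close> as the twist of \<open>inv z\<close>.\<close>
    have "i \<noteq> R"
    proof
      assume "i = R"
      then have "w' = \<one>" using zi(3) K_R by (simp add: w'_def)
      moreover have "w = inv z \<otimes> w' \<otimes> \<psi> z" using zi(1) w(1) by (simp add: w'_def group_word_simps)
      ultimately have "w = twist \<psi> (inv z)" using zi(1) by (simp add: twist_def)
      then show False using nin zi(1) by blast
    qed
    then have i: "i < R" and nd: "\<not> eps \<psi> i (t i) dvd delta i w'" using zi by (auto simp: w'_def)
    define m where "m = obstruction_modulus \<psi> t i w'"
    define Y where "Y j = nat (max 1 \<bar>eps \<psi> j (t j)\<bar>)" for j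
    have Y: "0 < Y j \<and> Y j \<le> A ^ (p * b')" if "j < R" for j
    proof -
      have tj: "t j \<in> carrier G" "wl (t j) \<le> A ^ p" using piv that H_carrier by (auto simp: pivots_def)
      have "A ^ 1 \<le> A ^ p" using A p(1) by (intro power_increasing) auto
      then have "\<bar>eps \<psi> j (t j)\<bar> \<le> int ((A ^ p) ^ b')" using b' [OF adm that tj(1) _ tj(2)] by simp
      then have "nat \<bar>eps \<psi> j (t j)\<bar> \<le> A ^ (p * b')" by (simp only: nat_le_iff power_mult)
      moreover have "1 \<le> A ^ (p * b')" using A by (intro one_le_power) simp
      ultimately show ?thesis by (auto simp: Y_def max_def)
    qed
    have fe: "fact e \<le> A ^ fact e" using power_bound [OF A] .
    have mod_pos: "modulus \<psi> t i > 0" unfolding modulus_def by (intro prod_pos) auto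
    have "modulus \<psi> t i \<le> (\<Prod>j<i. A ^ (fact e + p * b'))"
      unfolding modulus_def Y_def [symmetric]
    proof (rule prod_mono, intro conjI)
      fix j assume "j \<in> {..<i}"
      then have "Y j \<le> A ^ (p * b')" using Y i by auto
      then show "fact e * Y j \<le> A ^ (fact e + p * b')"
        unfolding power_add by (intro mult_mono fe) auto
    qed simp
    also have "\<dots> = A ^ ((fact e + p * b') * i)" by (simp add: power_mult)
    also have "\<dots> \<le> A ^ ((fact e + p * b') * R)" using A i by (intro power_increasing) auto
    finally have modb: "modulus \<psi> t i \<le> A ^ ((fact e + p * b') * R)" .
    define d where "d = eps \<psi> i (t i)"
    define cc where "cc = (if d = 0 then \<bar>delta i w'\<bar> + 1 else \<bar>d\<bar>)"
    have m: "m = nat cc * fact e * modulus \<psi> t i"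
      by (simp add: m_def obstruction_modulus_def Let_def cc_def d_def)
    have cc: "nat cc \<le> A ^ (q * b + 1 + p * b')"
    proof (cases "d = 0")
      case True
      have "A ^ 1 \<le> A ^ q" using A q(1) by (intro power_increasing) auto
      then have "2 \<le> A ^ q" using A by simp
      then have "nat \<bar>delta i w'\<bar> \<le> (A ^ q) ^ b" using b i w'c zi(4) unfolding w'_def by blast
      moreover have "1 \<le> (A ^ q) ^ b" using A by (intro one_le_power) simp
      ultimately have "nat \<bar>delta i w'\<bar> + 1 \<le> 2 * (A ^ q) ^ b" by linarith
      also have "\<dots> \<le> A * A ^ (q * b)" using A by (simp add: power_mult)
      also have "\<dots> = A ^ (q * b + 1)" by simp
      also have "\<dots> \<le> A ^ (q * b + 1 + p * b')" using A by (intro power_increasing) auto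
      finally show ?thesis using True by (simp add: cc_def nat_add_distrib)
    next
      case False
      have "nat cc \<le> Y i" using False by (simp add: cc_def Y_def d_def)
      also have "\<dots> \<le> A ^ (p * b')" using Y i by blast
      also have "\<dots> \<le> A ^ (q * b + 1 + p * b')" using A by (intro power_increasing) auto
      finally show ?thesis .
    qed
    have "m \<le> (A ^ (q * b + 1 + p * b') * A ^ fact e) * A ^ ((fact e + p * b') * R)"
      unfolding m by (intro mult_mono cc fe modb) auto
    also have "\<dots> = A ^ P" by (simp only: P_def power_add)
    finally have "m \<le> A ^ P" .
    moreover have "m > 0" using mod_pos by (simp add: m cc_def)
    moreover have "twist \<psi> y \<noteq> w \<otimes> g" if y: "y \<in> carrier G" and g: "g \<in> power_subgroup m" for y g
    proof
      assume eq: "twist \<psi> y = w \<otimes> g"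
      have gc: "g \<in> carrier G" using g power_subgroup_carrier by blast
      \<comment> \<open>Moving from \<open>w\<close> to \<open>w'\<close> conjugates
        \<open>g\<close> by \<open>\<psi> z\<close>, which stays in the normal power subgroup, so
        the modulus found for \<open>w'\<close> works for \<open>w\<close>.\<close>
      have "twist \<psi> (z \<otimes> y) = z \<otimes> twist \<psi> y \<otimes> inv (\<psi> z)"
        using y zi(1) by (simp add: twist_def group_word_simps)
      also have "\<dots> = w' \<otimes> (\<psi> z \<otimes> g \<otimes> inv (\<psi> z))"
        unfolding eq using y zi(1) w(1) gc by (simp add: w'_def group_word_simps)
      finally have "twist \<psi> (z \<otimes> y) = w' \<otimes> (\<psi> z \<otimes> g \<otimes> inv (\<psi> z))" .
      moreover have "\<psi> z \<otimes> g \<otimes> inv (\<psi> z) \<in> power_subgroup m"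
        by (rule normal_conj [OF power_subgroup_normal _ g]) (use zi in simp)
      moreover have "w' \<in> K i" using zi(3) by (simp add: w'_def)
      ultimately show False
        using obstruction [OF \<psi> piv i _ nd, of "z \<otimes> y"] y zi(1) unfolding m_def by auto
    qed
    ultimately show ?thesis by blast
  qed
  then show ?thesis by blast
qed

end

section \<open>Finite quotients and the final bounds\<close>

lemma (in group) sep_depth_le:
  assumes P: "P \<lhd> G" and R: "finite R" "R \<subseteq> carrier G" "\<And>x. x \<in> carrier G \<Longrightarrow> \<exists>y\<in>R. \<exists>p\<in>P. x = y \<otimes> p"
    and B: "B \<subseteq> carrier G" and y: "y \<in> carrier G"
    and sep: "\<And>b p. \<lbrakk>b \<in> B; p \<in> P\<rbrakk> \<Longrightarrow> b \<noteq> y \<otimes> p"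
  shows "sep_depth G B y \<le> enat (card R)"
proof -
  interpret P: subgroup P G using P by (rule normal_subgroup)
  have coset_eq: "P #> x = P #> y \<longleftrightarrow> (\<exists>p\<in>P. x = y \<otimes> p)" if "x \<in> carrier G" "y \<in> carrier G" for x y
  proof
    assume "P #> x = P #> y"
    then have "x \<in> P #> y" using rcos_self [OF that(1) P.subgroup_axioms] by simp
    then obtain p where p: "p \<in> P" "x = p \<otimes> y" by (auto simp: r_coset_def)
    then have "x = y \<otimes> (inv y \<otimes> p \<otimes> y)" using that by (simp add: group_word_simps)
    then show "\<exists>p\<in>P. x = y \<otimes> p" using normal_conj_inv [OF P that(2) p(1)] by blast
  next
    assume "\<exists>p\<in>P. x = y \<otimes> p"
    then obtain p where p: "p \<in> P" "x = y \<otimes> p" by blast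
    then have "x = (y \<otimes> p \<otimes> inv y) \<otimes> y" using that by (simp add: group_word_simps)
    then have "x \<in> P #> y" using normal_conj [OF P that(2) p(1)] by (auto simp: r_coset_def)
    then show "P #> x = P #> y" using repr_independence [OF _ that(2) P.subgroup_axioms] by simp
  qed
  have "(\<lambda>x. P #> x) ` carrier G \<subseteq> (\<lambda>x. P #> x) ` R"
  proof clarify
    fix x assume x: "x \<in> carrier G"
    then obtain y where "y \<in> R" "\<exists>p\<in>P. x = y \<otimes> p" using R(3) by blast
    then show "P #> x \<in> (\<lambda>x. P #> x) ` R" using coset_eq [OF x, of y] R(2) by blast
  qed
  note sub = this
  have finR: "finite ((\<lambda>x. P #> x) ` R)" using R(1) by simp
  have fin: "finite ((\<lambda>x. P #> x) ` carrier G)" by (rule finite_subset [OF sub finR])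
  have cardle: "card ((\<lambda>x. P #> x) ` carrier G) \<le> card R"
    by (rule order_trans [OF card_mono [OF finR sub] card_image_le [OF R(1)]])
  obtain idx :: "'a set \<Rightarrow> nat" where idx: "inj_on idx ((\<lambda>x. P #> x) ` carrier G)"
    using finite_imp_inj_to_nat_seg [OF fin] by blast
  define f where "f x = idx (P #> x)" for x
  have f_eq: "f x = f y \<longleftrightarrow> (\<exists>p\<in>P. x = y \<otimes> p)" if "x \<in> carrier G" "y \<in> carrier G" for x y
    using inj_on_eq_iff [OF idx, of "P #> x" "P #> y"] coset_eq [OF that] that by (simp add: f_def)
  define rep where "rep a = (SOME x. x \<in> carrier G \<and> f x = a)" for a
  have rep: "rep (f x) \<in> carrier G \<and> f (rep (f x)) = f x" if "x \<in> carrier G" for x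
    unfolding rep_def by (rule someI [of _ x]) (use that in simp)
  \<comment> \<open>\<open>sep_depth\<close> ranges over groups of naturals, so cosets are coded by
    \<open>idx\<close>. \<open>H0\<close> is an auxiliary structure in which \<open>f\<close> is
    multiplicative; the group is its restriction to the image of \<open>f\<close>.\<close>
  define H0 :: "nat monoid" where "H0 = \<lparr>carrier = UNIV, monoid.mult = \<lambda>a b. f (rep a \<otimes> rep b), one = f \<one>\<rparr>"
  have hom: "f \<in> hom G H0"
  proof (rule homI)
    fix x y assume x: "x \<in> carrier G" and y: "y \<in> carrier G"
    obtain p where p: "p \<in> P" "rep (f x) = x \<otimes> p" using f_eq [of "rep (f x)" x] rep [OF x] x by blast
    obtain p' where p': "p' \<in> P" "rep (f y) = y \<otimes> p'" using f_eq [of "rep (f y)" y] rep [OF y] y by blast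
    have "rep (f x) \<otimes> rep (f y) = (x \<otimes> y) \<otimes> ((inv y \<otimes> p \<otimes> y) \<otimes> p')"
      using p p' x y by (simp add: group_word_simps)
    moreover have "(inv y \<otimes> p \<otimes> y) \<otimes> p' \<in> P" using normal_conj_inv [OF P y p(1)] p' by simp
    ultimately have "f (rep (f x) \<otimes> rep (f y)) = f (x \<otimes> y)"
      using f_eq [of "rep (f x) \<otimes> rep (f y)" "x \<otimes> y"] rep x y by blast
    then show "f (x \<otimes> y) = f x \<otimes>\<^bsub>H0\<^esub> f y" by (simp add: H0_def)
  qed (simp add: H0_def)
  define Q where "Q = H0\<lparr>carrier := f ` carrier G, one := f \<one>\<rparr>"
  have Q: "group Q" unfolding Q_def using hom_imp_img_group [OF hom] by (simp add: H0_def)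
  have cQ: "carrier Q = f ` carrier G" by (simp add: Q_def)
  have img: "f ` carrier G = idx ` ((\<lambda>x. P #> x) ` carrier G)" by (auto simp: f_def)
  have "f \<in> hom G Q" using hom by (auto simp: hom_def Q_def H0_def)
  moreover have "f y \<notin> f ` B"
  proof
    assume "f y \<in> f ` B"
    then obtain b where "b \<in> B" "f b = f y" by auto
    then show False using f_eq [of b y] sep B y by blast
  qed
  moreover have "finite (carrier Q)" using fin img cQ by simp
  ultimately have "sep_depth G B y \<le> enat (card (carrier Q))"
    unfolding sep_depth_def using Q cQ by (intro Inf_lower) blast
  also have "card (carrier Q) \<le> card R"
    using cardle card_image_le [OF fin, of idx] unfolding cQ img by linarith
  finally show ?thesis by simp
qed

context fg_group
begin

lemma conj_x_le:
  assumes nil: "nilpotent_group G" and tf: "torsion_free G"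
  shows "\<exists>P. \<forall>\<phi>\<in>iso G G. \<forall>x\<in>carrier G. \<forall>n\<ge>1.
    conj_x G S \<phi> x n \<le> enat ((6 * aut_norm G S \<phi> * max 1 (wl x) * n) ^ P)"
proof -
  obtain c where c: "lower_central G c = {\<one>}" using nil by (auto simp: nilpotent_group_def)
  obtain L a r where "central_series G L a r" using central_series_exists [OF nil] by blast
  then interpret central_series G L a r .
  obtain fs e where fs: "flag fs" "\<forall>f\<in>set fs. poly_fun (carrier G) e f"
    "\<forall>g\<in>carrier G. (\<forall>f\<in>set fs. \<forall>x\<in>carrier G. f (x \<otimes> g) = f x) \<longrightarrow> g = \<one>"
    using separating_flag_exists [OF tf nil] by blast
  interpret separating_flag G S fs e
    by (intro separating_flag.intro separating_flag_axioms.intro fg_group_axioms)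
       (use fs in blast)+
  obtain P where P: "\<And>\<psi> A w. \<lbrakk>admissible \<psi> A; w \<in> carrier G; wl w \<le> A; w \<notin> twist \<psi> ` carrier G\<rbrakk> \<Longrightarrow>
    \<exists>m>0. m \<le> A ^ P \<and> (\<forall>z\<in>carrier G. \<forall>g\<in>power_subgroup m. twist \<psi> z \<noteq> w \<otimes> g)"
    using twisted_separation [OF c] by blast
  have "conj_x G S \<phi> x n \<le> enat ((6 * aut_norm G S \<phi> * max 1 (wl x) * n) ^ (P * r))"
    if \<phi>: "\<phi> \<in> iso G G" and x: "x \<in> carrier G" and n: "n \<ge> 1" for \<phi> x n
    unfolding conj_x_def
  proof (rule Sup_least, clarify)
    fix y assume y: "y \<in> carrier G" "wl y \<le> n" "y \<notin> twisted_class G \<phi> x"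
    have \<phi>h: "\<phi> \<in> hom G G" and inj: "inj_on \<phi> (carrier G)" using \<phi> by (auto simp: iso_def bij_betw_def)
    interpret h: group_hom G G \<phi> using \<phi>h by unfold_locales
    define N where "N = aut_norm G S \<phi>"
    have \<phi>s: "wl (\<phi> s) \<le> N" if "s \<in> S" for s
      unfolding N_def aut_norm_def using finite_S that by (intro Max_ge) auto
    \<comment> \<open>Norm \<open>0\<close> would make the base of the bound \<open>0\<close>. It
      occurs only for the trivial group, where no \<open>y\<close> lies outside the class.\<close>
    have "N \<noteq> 0"
    proof
      assume "N = 0"
      have "g = \<one>" if g: "g \<in> carrier G" for g
      proof -
        have "wl (\<phi> g) \<le> N * wl g" by (rule wl_hom [OF \<phi>h \<phi>s g])
        then have "\<phi> g = \<phi> \<one>" using wl_zero [of "\<phi> g"] g \<open>N = 0\<close> by simp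
        then show ?thesis by (rule inj_onD [OF inj]) (use g in simp_all)
      qed
      then have "y = \<one>" "x = \<one>" using x y by auto
      moreover have "\<one> \<in> twisted_class G \<phi> \<one>" unfolding twisted_class_def by (auto intro!: exI [of _ \<one>])
      ultimately show False using y by simp
    qed
    \<comment> \<open>The product without the \<open>6\<close> dominates each of \<open>N\<close>,
      \<open>wl x\<close>, \<open>n\<close> and \<open>1\<close>. They are needed with coefficients
      \<open>1\<close>, \<open>2\<close>, \<open>1\<close> and \<open>2\<close>, to bound
      \<open>\<psi>\<close> on generators, the length of \<open>w\<close>, and to have
      \<open>2 \<le> A\<close>.\<close>
    define A where "A = 6 * N * max 1 (wl x) * n"
    have A: "N + 2 * wl x + n + 2 \<le> A"
    proof -
      let ?M = "N * max 1 (wl x) * n"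
      have M: "N * 1 * 1 \<le> ?M" "1 * wl x * 1 \<le> ?M" "1 * 1 * n \<le> ?M" "1 * 1 * 1 \<le> ?M"
        using \<open>N \<noteq> 0\<close> n by (intro mult_mono; simp)+
      then have "N + 2 * wl x + n + 2 \<le> 6 * ?M" by linarith
      then show ?thesis by (simp add: A_def)
    qed
    define \<psi> where "\<psi> z = x \<otimes> \<phi> z \<otimes> inv x" for z
    have \<psi>h: "\<psi> \<in> hom G G"
      by (rule homI) (use x in \<open>auto simp: \<psi>_def group_word_simps\<close>)
    have "wl (\<psi> s) \<le> A" if s: "s \<in> S" for s
    proof -
      have sc: "s \<in> carrier G" using s S_sub by blast
      have "wl (\<psi> s) \<le> wl (x \<otimes> \<phi> s) + wl (inv x)" unfolding \<psi>_def using x sc by (intro wl_mult) auto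
      also have "\<dots> \<le> (wl x + wl (\<phi> s)) + wl x"
        using x sc by (intro add_mono wl_mult) (auto simp: wl_inv)
      finally show ?thesis using \<phi>s [OF s] A by linarith
    qed
    then have "\<forall>g\<in>carrier G. wl (\<psi> g) \<le> A * wl g" using wl_hom [OF \<psi>h] by blast
    then have adm: "admissible \<psi> A" using \<psi>h A by (simp add: admissible_def)
    have tw: "twist \<psi> z \<otimes> x = z \<otimes> x \<otimes> inv (\<phi> z)" if "z \<in> carrier G" for z
      using that x by (simp add: twist_def \<psi>_def group_word_simps)
    define w where "w = y \<otimes> inv x"
    have wc: "w \<in> carrier G" using x y by (simp add: w_def)
    have wle: "wl w \<le> A" using wl_mult [of y "inv x"] x y A by (simp add: w_def wl_inv)
    have "w \<notin> twist \<psi> ` carrier G"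
    proof
      assume "w \<in> twist \<psi> ` carrier G"
      then obtain z where z: "z \<in> carrier G" "w = twist \<psi> z" by auto
      have "y = w \<otimes> x" using x y by (simp add: w_def m_assoc)
      also have "\<dots> = z \<otimes> x \<otimes> inv (\<phi> z)" using tw z by simp
      finally show False using y(3) z(1) unfolding twisted_class_def by blast
    qed
    then obtain m where m: "m > 0" "m \<le> A ^ P"
      "\<And>z g. \<lbrakk>z \<in> carrier G; g \<in> power_subgroup m\<rbrakk> \<Longrightarrow> twist \<psi> z \<noteq> w \<otimes> g"
      using P [OF adm wc wle] by blast
    obtain T where T: "finite T" "card T \<le> m ^ (r - 0)" "T \<subseteq> carrier G"
      "\<And>x. x \<in> L 0 \<Longrightarrow> \<exists>y\<in>T. \<exists>p\<in>power_subgroup m. x = y \<otimes> p"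
      using L_mod_power_subgroup [OF m(1), of 0] by blast
    have "sep_depth G (twisted_class G \<phi> x) y \<le> enat (card T)"
    proof (rule sep_depth_le [OF power_subgroup_normal T(1,3)])
      show "\<exists>y\<in>T. \<exists>p\<in>power_subgroup m. x = y \<otimes> p" if "x \<in> carrier G" for x
        using T(4) that by (simp add: L_0)
      show "twisted_class G \<phi> x \<subseteq> carrier G" using x by (auto simp: twisted_class_def)
      show "y \<in> carrier G" by (rule y)
      fix b p assume b: "b \<in> twisted_class G \<phi> x" and p: "p \<in> power_subgroup m"
      show "b \<noteq> y \<otimes> p"
      proof
        assume eq: "b = y \<otimes> p"
        obtain z where z: "z \<in> carrier G" "b = z \<otimes> x \<otimes> inv (\<phi> z)"
          using b unfolding twisted_class_def by blast
        have pc: "p \<in> carrier G" by (rule power_subgroup_carrier [OF p])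
        have tc: "twist \<psi> z \<in> carrier G" by (rule twist_closed [OF \<psi>h z(1)])
        have "twist \<psi> z \<otimes> x = y \<otimes> p" using tw [OF z(1)] z(2) eq by simp
        then have "twist \<psi> z = y \<otimes> p \<otimes> inv x" using tc x y pc by (simp add: inv_solve_right)
        also have "\<dots> = w \<otimes> (x \<otimes> p \<otimes> inv x)" using x y pc by (simp add: w_def group_word_simps)
        finally show False
          using m(3) [OF z(1) normal_conj [OF power_subgroup_normal x p]] by simp
      qed
    qed
    \<comment> \<open>The modulus is at most \<open>A ^ P\<close>, and each of the \<open>r\<close>
      cyclic factors contributes at most \<open>m\<close> classes.\<close>
    also have "card T \<le> A ^ (P * r)"
      using T(2) power_mono [OF m(2), of r] by (simp add: power_mult)
    finally show "sep_depth G (twisted_class G \<phi> x) y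
        \<le> enat ((6 * aut_norm G S \<phi> * max 1 (wl x) * n) ^ (P * r))"
      by (simp add: A_def N_def)
  qed
  then show ?thesis by blast
qed

end

theorem mainTheorem2:
  fixes N :: "('a, 'b) monoid_scheme" and S :: "'a set"
  assumes "group N" and "nilpotent_group N" and "torsion_free N"
    and "finite S" and "S \<subseteq> carrier N" and "generate N S = carrier N"
  shows "\<exists>k1 k2 k3 C :: nat.
    (\<forall>\<phi> \<in> iso N N. \<forall>x \<in> carrier N. \<forall>n::nat. n \<ge> 1 \<longrightarrow>
        conj_x N S \<phi> x n
          \<le> enat (C * aut_norm N S \<phi> ^ k1 * max 1 (word_length N S x) ^ k2 * (C * n) ^ k3))
  \<and> (\<exists>C'::nat. \<forall>\<phi> \<in> iso N N. \<forall>n::nat. n \<ge> 1 \<longrightarrow>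
        conj_phi N S \<phi> n \<le> enat (C' * aut_norm N S \<phi> ^ k1 * (C' * n) ^ (k2 + k3)))
  \<and> (\<exists>C'::nat. \<forall>n::nat. n \<ge> 1 \<longrightarrow>
        tconj N S n \<le> enat (C' * (C' * n) ^ (k1 + k2 + k3)))"
proof -
  interpret fg_group N S using assms by (intro fg_group.intro fg_group_axioms.intro)
  obtain P where P: "\<forall>\<phi>\<in>iso N N. \<forall>x\<in>carrier N. \<forall>n\<ge>1.
      conj_x N S \<phi> x n \<le> enat ((6 * aut_norm N S \<phi> * max 1 (wl x) * n) ^ P)"
    using conj_x_le assms(2,3) by blast
  \<comment> \<open>All three exponents are taken to be \<open>P\<close>, and the constant factor
    \<open>6\<close> of the base, raised to \<open>P\<close>, becomes \<open>C\<close>.\<close>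
  define C :: nat where "C = 6 ^ P"
  have C1: "1 \<le> C" by (simp add: C_def)
  have x_bound: "conj_x N S \<phi> x n \<le> enat (C * aut_norm N S \<phi> ^ P * max 1 (wl x) ^ P * (C * n) ^ P)"
    if h: "\<phi> \<in> iso N N" "x \<in> carrier N" "n \<ge> 1" for \<phi> x n
  proof -
    have "(6 * aut_norm N S \<phi> * max 1 (wl x) * n) ^ P = C * aut_norm N S \<phi> ^ P * max 1 (wl x) ^ P * n ^ P"
      by (simp add: C_def power_mult_distrib)
    also have "\<dots> \<le> C * aut_norm N S \<phi> ^ P * max 1 (wl x) ^ P * (C * n) ^ P"
      using C1 by (intro mult_left_mono power_mono) auto
    finally show ?thesis using P h by (meson enat_ord_simps(1) order_trans)
  qed
  have phi_bound: "conj_phi N S \<phi> n \<le> enat (C * aut_norm N S \<phi> ^ P * (C * n) ^ (P + P))"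
    if h: "\<phi> \<in> iso N N" "n \<ge> 1" for \<phi> n
    unfolding conj_phi_def
  proof (rule Sup_least, clarify)
    fix x assume x: "x \<in> carrier N" "wl x \<le> n"
    have "n \<le> C * n" using mult_le_mono1 [OF C1, of n] by simp
    then have "max 1 (wl x) \<le> C * n" using x h by linarith
    then have "C * aut_norm N S \<phi> ^ P * max 1 (wl x) ^ P * (C * n) ^ P
        \<le> C * aut_norm N S \<phi> ^ P * (C * n) ^ P * (C * n) ^ P"
      by (intro mult_right_mono mult_left_mono power_mono) auto
    also have "\<dots> = C * aut_norm N S \<phi> ^ P * (C * n) ^ (P + P)"
      by (simp only: power_add mult.assoc)
    finally show "conj_x N S \<phi> x n \<le> enat (C * aut_norm N S \<phi> ^ P * (C * n) ^ (P + P))"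
      by (intro order_trans [OF x_bound [OF h(1) x(1) h(2)]]) (simp only: enat_ord_simps)
  qed
  have tconj_bound: "tconj N S n \<le> enat (C * (C * n) ^ (P + P + P))" if n: "n \<ge> 1" for n
    unfolding tconj_def
  proof (rule Sup_least, clarify)
    fix \<phi> assume \<phi>: "\<phi> \<in> iso N N" "aut_norm N S \<phi> \<le> n"
    have "n \<le> C * n" using mult_le_mono1 [OF C1, of n] by simp
    then have "aut_norm N S \<phi> \<le> C * n" using \<phi> by linarith
    then have "C * aut_norm N S \<phi> ^ P * (C * n) ^ (P + P) \<le> C * (C * n) ^ P * (C * n) ^ (P + P)"
      by (intro mult_right_mono mult_left_mono power_mono) auto
    also have "\<dots> = C * (C * n) ^ (P + P + P)" by (simp only: power_add mult.assoc)
    finally show "conj_phi N S \<phi> n \<le> enat (C * (C * n) ^ (P + P + P))"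
      by (intro order_trans [OF phi_bound [OF \<phi>(1) n]]) (simp only: enat_ord_simps)
  qed
  show ?thesis using x_bound phi_bound tconj_bound by blast
qed

end
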